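(* Let $\mathcal{M}=\{M_1,M_2\}$ be a binary MMDP. The algorithm BiAPD (described in the context) determines in finite time the existence of a policy that achieves asymptotic perfect detection (APD) for $\mathcal{M}$ and synthesizes a policy when one exists. That is: BiAPD terminates in finite time on input $\mathcal{M}$; it returns the flag $1$ if and only if there exists a (history-dependent randomized) policy that achieves APD for $\mathcal{M}$ (and returns the flag $0$ otherwise); and whenever it returns the flag $1$, the policy it returns achieves APD for $\mathcal{M}$.
   Context: **MDPs and policies.** An MDP is $M=(\mathcal{S},\mathcal{A},\delta,s_{\mathrm{init}})$ with a finite state set $\mathcal{S}$, finite nonempty action sets $\mathcal{A}_s$ ($s\in\mathcal{S}$), $\mathcal{A}=\cup_s\mathcal{A}_s$, a kernel $\delta(s'|s,a)\in[0,1]$ for $s,s'\in\mathcal{S}$, $a\in\mathcal{A}_s$, with $\sum_{s'}\delta(s'|s,a)=1$, and an initial state $s_{\mathrm{init}}$. $\mathrm{Supp}(p)$ is the support of a probability mass function $p$. A history at step $t$ is $h_t=(s_0,a_0,\dots,s_t)$ with $s_0=s_{\mathrm{init}}$, $a_\tau\in\mathcal{A}_{s_\tau}$, $\delta(s_{\tau+1}|s_\tau,a_\tau)>0$. A (history-dependent randomized) policy $\boldsymbol{\pi}=(\pi_0,\pi_1,\dots)$ assigns to each history $h_t$ ending in $s_t$ a probability distribution $\pi_t(\cdot|h_t)$ on $\mathcal{A}_{s_t}$. **Binary MMDP and APD.** A binary MMDP $\mathcal{M}=\{M_1,M_2\}$ is a pair of MDPs $M_i=(\mathcal{S},\mathcal{A},\delta_i,s_{\mathrm{init}})$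 with the same states, available actions and initial state. $\mathcal{H}_t$ is the union of the sets of step-$t$ histories of $M_1$ and $M_2$ (policies are defined on these), and $\mathbb{P}_i^{\boldsymbol\pi}(h_t)$ is the probability of $h_t$ in $M_i$ under $\boldsymbol\pi$. For an estimated prior $q\in(0,1)$ and a true prior $\theta\in(0,1)$ of $M_1$, the error probability of the maximum a posteriori rule based on $h_t$ is $$P_{\mathrm{error}}(t,q,\theta)=\theta\sum_{h_t:\ q\mathbb{P}_1^{\boldsymbol\pi}(h_t)\le(1-q)\mathbb{P}_2^{\boldsymbol\pi}(h_t)}\mathbb{P}_1^{\boldsymbol\pi}(h_t)+(1-\theta)\sum_{h_t:\ q\mathbb{P}_1^{\boldsymbol\pi}(h_t)\ge(1-q)\mathbb{P}_2^{\boldsymbol\pi}(h_t)}\mathbb{P}_2^{\boldsymbol\pi}(h_t).$$ The policy $\boldsymbol\pi$ achieves APD for $\mathcal{M}$ if $\lim_{t\to\infty}P_{\mathrm{error}}(t,q,\theta)=0$ for all $q,\theta\in(0,1)$. **Informative and revealing pairs.** For $s\in\mathcal{S},a\in\mathcal{A}_s$, the pair $(s,a)$ is *revealing* if $\mathrm{Supp}(\delta_1(\cdot|s,a))\cap\mathrm{Supp}(\delta_2(\cdot|s,a))=\emptyset$; it is *informative* if $\delta_1(\cdot|s,a)\ne\delta_2(\cdot|s,a)$ and these supports intersect. A state $s$ is revealing if $(s,a)$ is revealing for some $a\in\mathcal{A}_s$ (then $a$ is a revealing action). $\mathrm{ISA}$ is the set of informative pairs of $\mathcal{M}$. A transition $(s,a,s')$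 is identity-revealing if exactly one of $\delta_1(s'|s,a),\delta_2(s'|s,a)$ is positive. **Preprocessed MMDP and informative MDP.** $M_i^{\mathrm p}=(\mathcal{S}^{\mathrm p},\mathcal{A}^{\mathrm p},\delta_i^{\mathrm p},s_{\mathrm{init}})$, $i\in\{1,2\}$, where $\mathcal{S}^{\mathrm p}=\mathcal{S}\cup\{\bot_1,\bot_2\}$ with two new states; $\mathcal{A}^{\mathrm p}_s=\mathcal{A}_s$ if $s\in\mathcal{S}$ is not revealing; $\mathcal{A}^{\mathrm p}_s=\{a\}$ for one chosen revealing action $a\in\mathcal{A}_s$ if $s\in\mathcal{S}$ is revealing; $\mathcal{A}^{\mathrm p}_{\bot_j}=\{a^{\bot_j}\}$. Kernels: $\delta_i^{\mathrm p}(\bot_j|\bot_j,a^{\bot_j})=1$ for $j\in\{1,2\}$; if $s$ is revealing, $\delta_i^{\mathrm p}(\bot_i|s,a)=1$ for the unique $a\in\mathcal{A}^{\mathrm p}_s$; if $s$ is not revealing and $(s,a)$ is not informative, $\delta_i^{\mathrm p}(\cdot|s,a)=\delta_i(\cdot|s,a)$; if $s$ is not revealing and $(s,a)$ is informative, $\delta_i^{\mathrm p}(s'|s,a)=\delta_i(s'|s,a)$ for $s'\in\mathrm{Supp}(\delta_1(\cdot|s,a))\cap\mathrm{Supp}(\delta_2(\cdot|s,a))$, and $\delta_i^{\mathrm p}(\bot_i|s,a)$ is the remaining mass $\sum_{s'\in\mathrm{Supp}(\delta_i(\cdot|s,a))\setminus\mathrm{Supp}(\delta_{3-i}(\cdot|s,a))}\delta_i(s'|s,a)$.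 Put $\mathrm{ISA}^{\mathrm p}=\mathrm{ISA}\cup\{(\bot_1,a^{\bot_1}),(\bot_2,a^{\bot_2})\}$. An informative MDP is $M^{\mathrm I}=(\mathcal{S}^{\mathrm p},\mathcal{A}^{\mathrm p},\delta^{\mathrm I},s_{\mathrm{init}})$ with $\delta^{\mathrm I}=\gamma\delta_1^{\mathrm p}+(1-\gamma)\delta_2^{\mathrm p}$ for some $\gamma\in(0,1)$ (any choice of $\gamma$ is allowed). **Maximal end components (MECs).** An end component of an MDP $M=(\mathcal{S},\mathcal{A},\delta,s_{\mathrm{init}})$ is $C=(\mathcal{X},\mathcal{U})$ with $\emptyset\ne\mathcal{X}\subseteq\mathcal{S}$, $\mathcal{U}_s\subseteq\mathcal{A}_s$ for $s\in\mathcal{X}$, $\mathcal{U}=\cup_{s\in\mathcal{X}}\mathcal{U}_s$, such that $\mathrm{Supp}(\delta(\cdot|s,u))\subseteq\mathcal{X}$ for all $s\in\mathcal{X},u\in\mathcal{U}_s$, and for every ordered pair of distinct states of $\mathcal{X}$ there is a path from the first to the second of positive-probability transitions using only actions $u\in\mathcal{U}_{s}$ at states $s\in\mathcal{X}$. It is maximal if no other end component $(\mathcal{X}',\mathcal{U}')$ satisfies $\mathcal{X}\subseteq\mathcal{X}'$ and $\mathcal{U}_s\subseteq\mathcal{U}'_s$ for all $s\in\mathcal{X}$. **Algorithm BiAPD.** Input: $\mathcal{M}$. 1. Construct an informative MDP $M^{\mathrm I}$ of $\mathcal{M}$. 2. Compute the set $\mathcal{C}(M^{\mathrm I})$ of MECs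 of $M^{\mathrm I}$ and the set $\mathcal{C}^{\mathrm I}(M^{\mathrm I})$ of informative MECs, i.e. those $(\mathcal{X},\mathcal{U})\in\mathcal{C}(M^{\mathrm I})$ for which there is $(s,a)\in\mathrm{ISA}^{\mathrm p}$ with $s\in\mathcal{X}$, $a\in\mathcal{U}_s$. 3. Compute the set $\mathcal{R}^{\max}\subseteq\mathcal{S}^{\mathrm p}$ of states $s$ such that the maximum over policies of the probability, in $M^{\mathrm I}$ started from $s$, of reaching some state belonging to an informative MEC equals $1$. 4. If $s_{\mathrm{init}}\notin\mathcal{R}^{\max}$, return $(0,\emptyset)$. 5. Otherwise synthesize a policy $\boldsymbol\pi^0$ such that, in $M^{\mathrm I}$, the set of states of informative MECs is reached with probability $1$ from $s_{\mathrm{init}}$; the policy $\boldsymbol\pi^0$ is specified as follows: at a state $s\in\mathcal{R}^{\max}$ that belongs to no informative MEC, it takes, with probability $1$, any action $a\in\mathcal{A}^{\mathrm p}_s$ that satisfies $\mathrm{Supp}(\delta^{\mathrm I}(\cdot|s,a))\subseteq\mathcal{R}^{\max}$ (such an action always exists at these states). For each informative MEC $C=(\mathcal{X},\mathcal{U})$ let $\boldsymbol\pi^C$ be the memoryless policy with $\boldsymbol\pi^C(a|s)=1/|\mathcal{U}_s|$ for $s\in\mathcal{X}$, $a\in\mathcal{U}_s$. Return $(1,\{\boldsymbol\pi^0\}\cup\{\boldsymbol\pi^C\}_C)$. The first output is the flag. The returned policy is: follow $\boldsymbol\pi^0$ outside the informative MECs, until a state of some informative MEC $C$ is first reached, and follow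 $\boldsymbol\pi^C$ from then on. A policy of $\{M_1^{\mathrm p},M_2^{\mathrm p}\}$ is used on $\mathcal{M}$ by prescribing the same action distributions on histories containing no identity-revealing transition, and arbitrarily after an identity-revealing transition has occurred. *)

theory Defs
  imports "HOL-Probability.Probability"
begin

section \<open>MDPs, histories and policies\<close>

text \<open>
  Transition kernels are valued in \<^typ>\<open>'s pmf\<close>, so \<open>\<delta>(s'|s,a)\<close> is \<open>pmf (kernel M s a) s'\<close> and
  \<open>Supp\<close> is \<^const>\<open>set_pmf\<close>. Values of \<open>kernel M s a\<close> for \<open>s \<notin> states M\<close> or \<open>a \<notin> actions M s\<close>
  carry no meaning.
\<close>

record ('s, 'a) mdp =
  states :: "'s set"
  actions :: "'s \<Rightarrow> 'a set"
  kernel :: "'s \<Rightarrow> 'a \<Rightarrow> 's pmf"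
  init :: 's

datatype ('s, 'a) hist = Start 's | Snoc "('s, 'a) hist" 'a 's

primrec last_state :: "('s, 'a) hist \<Rightarrow> 's" where
  "last_state (Start s) = s"
| "last_state (Snoc h a s) = s"

primrec steps :: "('s, 'a) hist \<Rightarrow> nat" where
  "steps (Start s) = 0"
| "steps (Snoc h a s) = Suc (steps h)"

primrec visited :: "('s, 'a) hist \<Rightarrow> 's set" where
  "visited (Start s) = {s}"
| "visited (Snoc h a s) = insert s (visited h)"

primrec is_history :: "('s, 'a) mdp \<Rightarrow> ('s, 'a) hist \<Rightarrow> bool" where
  "is_history M (Start s) \<longleftrightarrow> s = init M"
| "is_history M (Snoc h a s) \<longleftrightarrow> is_history M h \<and> a \<in> actions M (last_state h) \<and>
     s \<in> set_pmf (kernel M (last_state h) a)"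

definition histories :: "('s, 'a) mdp \<Rightarrow> nat \<Rightarrow> ('s, 'a) hist set" where
  "histories M t = {h. is_history M h \<and> steps h = t}"

type_synonym ('s, 'a) policy = "('s, 'a) hist \<Rightarrow> 'a pmf"

definition is_policy :: "('s, 'a) mdp \<Rightarrow> ('s, 'a) policy \<Rightarrow> bool" where
  "is_policy M \<pi> \<longleftrightarrow> (\<forall>h. is_history M h \<longrightarrow> set_pmf (\<pi> h) \<subseteq> actions M (last_state h))"

primrec hist_prob :: "('s, 'a) mdp \<Rightarrow> ('s, 'a) policy \<Rightarrow> ('s, 'a) hist \<Rightarrow> real" where
  "hist_prob M \<pi> (Start s) = (if s = init M then 1 else 0)"
| "hist_prob M \<pi> (Snoc h a s) =
     hist_prob M \<pi> h * pmf (\<pi> h) a * pmf (kernel M (last_state h) a) s"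

text \<open>
  The event of reaching \<open>T\<close> is the increasing union over \<open>t\<close> of the events that \<open>T\<close> is reached
  within \<open>t\<close> steps, each of which is determined by the step-\<open>t\<close> history; hence the supremum.
\<close>

definition reach_prob :: "('s, 'a) mdp \<Rightarrow> ('s, 'a) policy \<Rightarrow> 's set \<Rightarrow> real" where
  "reach_prob M \<pi> T =
     (SUP t. \<Sum>h\<in>{h \<in> histories M t. visited h \<inter> T \<noteq> {}}. hist_prob M \<pi> h)"

definition is_maximum :: "real set \<Rightarrow> real \<Rightarrow> bool" where
  "is_maximum S m \<longleftrightarrow> m \<in> S \<and> (\<forall>x\<in>S. x \<le> m)"


section \<open>Binary MMDPs and asymptotic perfect detection\<close>

datatype model = One | Two

primrec other :: "model \<Rightarrow> model" where
  "other One = Two"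
| "other Two = One"

record ('s, 'a) mmdp =
  mstates :: "'s set"
  mactions :: "'s \<Rightarrow> 'a set"
  mkernel :: "model \<Rightarrow> 's \<Rightarrow> 'a \<Rightarrow> 's pmf"
  minit :: 's

definition binary_mmdp :: "('s, 'a) mmdp \<Rightarrow> bool" where
  "binary_mmdp M \<longleftrightarrow> finite (mstates M) \<and> minit M \<in> mstates M \<and>
     (\<forall>s\<in>mstates M. finite (mactions M s) \<and> mactions M s \<noteq> {}) \<and>
     (\<forall>i. \<forall>s\<in>mstates M. \<forall>a\<in>mactions M s. set_pmf (mkernel M i s a) \<subseteq> mstates M)"

definition mdp_of :: "('s, 'a) mmdp \<Rightarrow> model \<Rightarrow> ('s, 'a) mdp" where
  "mdp_of M i =
     \<lparr>states = mstates M, actions = mactions M, kernel = mkernel M i, init = minit M\<rparr>"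

definition mhistories :: "('s, 'a) mmdp \<Rightarrow> nat \<Rightarrow> ('s, 'a) hist set" where
  "mhistories M t = histories (mdp_of M One) t \<union> histories (mdp_of M Two) t"

definition is_mpolicy :: "('s, 'a) mmdp \<Rightarrow> ('s, 'a) policy \<Rightarrow> bool" where
  "is_mpolicy M \<pi> \<longleftrightarrow>
     (\<forall>t. \<forall>h\<in>mhistories M t. set_pmf (\<pi> h) \<subseteq> mactions M (last_state h))"

abbreviation mprob :: "('s, 'a) mmdp \<Rightarrow> model \<Rightarrow> ('s, 'a) policy \<Rightarrow> ('s, 'a) hist \<Rightarrow> real" where
  "mprob M i \<equiv> hist_prob (mdp_of M i)"

definition P_error :: "('s, 'a) mmdp \<Rightarrow> ('s, 'a) policy \<Rightarrow> nat \<Rightarrow> real \<Rightarrow> real \<Rightarrow> real" where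
  "P_error M \<pi> t q \<theta> =
     \<theta> * (\<Sum>h\<in>{h \<in> mhistories M t. q * mprob M One \<pi> h \<le> (1 - q) * mprob M Two \<pi> h}.
            mprob M One \<pi> h) +
     (1 - \<theta>) * (\<Sum>h\<in>{h \<in> mhistories M t. q * mprob M One \<pi> h \<ge> (1 - q) * mprob M Two \<pi> h}.
            mprob M Two \<pi> h)"

definition achieves_APD :: "('s, 'a) mmdp \<Rightarrow> ('s, 'a) policy \<Rightarrow> bool" where
  "achieves_APD M \<pi> \<longleftrightarrow>
     (\<forall>q\<in>{0<..<1}. \<forall>\<theta>\<in>{0<..<1}. (\<lambda>t. P_error M \<pi> t q \<theta>) \<longlonglongrightarrow> 0)"


section \<open>Informative and revealing pairs\<close>

definition common_support :: "('s, 'a) mmdp \<Rightarrow> 's \<Rightarrow> 'a \<Rightarrow> 's set" where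
  "common_support M s a = set_pmf (mkernel M One s a) \<inter> set_pmf (mkernel M Two s a)"

definition revealing_pair :: "('s, 'a) mmdp \<Rightarrow> 's \<Rightarrow> 'a \<Rightarrow> bool" where
  "revealing_pair M s a \<longleftrightarrow>
     s \<in> mstates M \<and> a \<in> mactions M s \<and> common_support M s a = {}"

definition revealing_state :: "('s, 'a) mmdp \<Rightarrow> 's \<Rightarrow> bool" where
  "revealing_state M s \<longleftrightarrow> (\<exists>a. revealing_pair M s a)"

definition ISA :: "('s, 'a) mmdp \<Rightarrow> ('s \<times> 'a) set" where
  "ISA M = {(s, a). s \<in> mstates M \<and> a \<in> mactions M s \<and>
     mkernel M One s a \<noteq> mkernel M Two s a \<and> common_support M s a \<noteq> {}}"

definition identity_revealing :: "('s, 'a) mmdp \<Rightarrow> 's \<Rightarrow> 'a \<Rightarrow> 's \<Rightarrow> bool" where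
  "identity_revealing M s a s' \<longleftrightarrow>
     (pmf (mkernel M One s a) s' > 0) \<noteq> (pmf (mkernel M Two s a) s' > 0)"

primrec no_identity_revealing :: "('s, 'a) mmdp \<Rightarrow> ('s, 'a) hist \<Rightarrow> bool" where
  "no_identity_revealing M (Start s) \<longleftrightarrow> True"
| "no_identity_revealing M (Snoc h a s) \<longleftrightarrow>
     no_identity_revealing M h \<and> \<not> identity_revealing M (last_state h) a s"


section \<open>Preprocessed MMDP and informative MDP\<close>

text \<open>
  \<open>Bot i\<close> is the new state \<open>\<bottom>\<^sub>i\<close> when used as a state, and its only action \<open>a\<close> with
  superscript \<open>\<bottom>\<^sub>i\<close> when used as an action.
\<close>

datatype 'x ext = Orig 'x | Bot model

definition action_choice :: "('s, 'a) mmdp \<Rightarrow> ('s \<Rightarrow> 'a) \<Rightarrow> bool" where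
  "action_choice M \<alpha> \<longleftrightarrow> (\<forall>s. revealing_state M s \<longrightarrow> revealing_pair M s (\<alpha> s))"

fun pre_actions :: "('s, 'a) mmdp \<Rightarrow> ('s \<Rightarrow> 'a) \<Rightarrow> 's ext \<Rightarrow> 'a ext set" where
  "pre_actions M \<alpha> (Orig s) =
     (if revealing_state M s then {Orig (\<alpha> s)} else Orig ` mactions M s)"
| "pre_actions M \<alpha> (Bot j) = {Bot j}"

text \<open>
  The informative case moves the mass of all successors outside the common support to \<open>\<bottom>\<^sub>i\<close>;
  see \<open>pmf_pre_kernel_informative\<close> below for the pointwise form. The last two equations cover
  a non-available action and the absorbing states.
\<close>

fun pre_kernel :: "('s, 'a) mmdp \<Rightarrow> model \<Rightarrow> 's ext \<Rightarrow> 'a ext \<Rightarrow> 's ext pmf" where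
  "pre_kernel M i (Orig s) (Orig a) =
     (if revealing_state M s then return_pmf (Bot i)
      else if (s, a) \<in> ISA M
      then map_pmf (\<lambda>s'. if s' \<in> common_support M s a then Orig s' else Bot i) (mkernel M i s a)
      else map_pmf Orig (mkernel M i s a))"
| "pre_kernel M i (Orig s) (Bot j) = return_pmf (Bot i)"
| "pre_kernel M i (Bot j) u = return_pmf (Bot j)"

definition preprocessed :: "('s, 'a) mmdp \<Rightarrow> ('s \<Rightarrow> 'a) \<Rightarrow> ('s ext, 'a ext) mmdp" where
  "preprocessed M \<alpha> =
     \<lparr>mstates = Orig ` mstates M \<union> {Bot One, Bot Two}, mactions = pre_actions M \<alpha>,
      mkernel = pre_kernel M, minit = Orig (minit M)\<rparr>"

definition ISAp :: "('s, 'a) mmdp \<Rightarrow> ('s ext \<times> 'a ext) set" where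
  "ISAp M = {(Orig s, Orig a) | s a. (s, a) \<in> ISA M} \<union> {(Bot One, Bot One), (Bot Two, Bot Two)}"

definition mixture :: "real \<Rightarrow> 'x pmf \<Rightarrow> 'x pmf \<Rightarrow> 'x pmf" where
  "mixture \<gamma> p q = bind_pmf (bernoulli_pmf \<gamma>) (\<lambda>b. if b then p else q)"

definition informative_mdp ::
  "('s, 'a) mmdp \<Rightarrow> ('s \<Rightarrow> 'a) \<Rightarrow> real \<Rightarrow> ('s ext, 'a ext) mdp" where
  "informative_mdp M \<alpha> \<gamma> =
     (let P = preprocessed M \<alpha> in
      \<lparr>states = mstates P, actions = mactions P,
       kernel = (\<lambda>x u. mixture \<gamma> (mkernel P One x u) (mkernel P Two x u)), init = minit P\<rparr>)"

lemma pmf_mixture: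
  assumes "0 \<le> \<gamma>" "\<gamma> \<le> 1"
  shows "pmf (mixture \<gamma> p q) x = \<gamma> * pmf p x + (1 - \<gamma>) * pmf q x"
  using assms by (simp add: mixture_def pmf_bind)

lemma pmf_pre_kernel_informative:
  assumes "\<not> revealing_state M s" "(s, a) \<in> ISA M"
  shows "s' \<in> common_support M s a \<Longrightarrow>
           pmf (pre_kernel M i (Orig s) (Orig a)) (Orig s') = pmf (mkernel M i s a) s'"
    and "s' \<notin> common_support M s a \<Longrightarrow> pmf (pre_kernel M i (Orig s) (Orig a)) (Orig s') = 0"
    and "pmf (pre_kernel M i (Orig s) (Orig a)) (Bot i) =
           infsetsum (pmf (mkernel M i s a))
             (set_pmf (mkernel M i s a) - set_pmf (mkernel M (other i) s a))"
    and "pmf (pre_kernel M i (Orig s) (Orig a)) (Bot (other i)) = 0"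
proof -
  let ?f = "\<lambda>s'. if s' \<in> common_support M s a then Orig s' else Bot i"
  have pk: "pre_kernel M i (Orig s) (Orig a) = map_pmf ?f (mkernel M i s a)"
    using assms by simp
  show "pmf (pre_kernel M i (Orig s) (Orig a)) (Orig s') = pmf (mkernel M i s a) s'"
    if "s' \<in> common_support M s a"
  proof -
    have "?f -` {Orig s'} = {s'}" using that by (auto split: if_splits)
    then show ?thesis by (simp only: pk pmf_map) (simp add: measure_pmf_single)
  qed
  show "pmf (pre_kernel M i (Orig s) (Orig a)) (Orig s') = 0"
    if "s' \<notin> common_support M s a"
  proof -
    have "?f -` {Orig s'} = {}" using that by (auto split: if_splits)
    then show ?thesis by (simp only: pk pmf_map) simp
  qed
  show "pmf (pre_kernel M i (Orig s) (Orig a)) (Bot i) =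
          infsetsum (pmf (mkernel M i s a))
            (set_pmf (mkernel M i s a) - set_pmf (mkernel M (other i) s a))"
  proof -
    have "?f -` {Bot i} = - common_support M s a" by (auto split: if_splits)
    moreover have "- common_support M s a \<inter> set_pmf (mkernel M i s a) =
        set_pmf (mkernel M i s a) - set_pmf (mkernel M (other i) s a)"
      by (cases i) (auto simp: common_support_def)
    ultimately show ?thesis
      by (simp only: pk pmf_map) (metis measure_Int_set_pmf measure_pmf_conv_infsetsum)
  qed
  show "pmf (pre_kernel M i (Orig s) (Orig a)) (Bot (other i)) = 0"
  proof -
    have "?f -` {Bot (other i)} = {}" by (cases i) (auto split: if_splits)
    then show ?thesis by (simp only: pk pmf_map) simp
  qed
qed


section \<open>Maximal end components\<close>

text \<open>
  \<open>U s = {}\<close> is demanded outside \<open>X\<close> so that an end component is represented by exactly one pair.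
  As in the underlying definition, \<open>U s\<close> may be empty for \<open>s \<in> X\<close>.
\<close>

type_synonym ('s, 'a) component = "'s set \<times> ('s \<Rightarrow> 'a set)"

definition component_candidates :: "('s, 'a) mdp \<Rightarrow> ('s, 'a) component set" where
  "component_candidates M =
     {(X, U). X \<subseteq> states M \<and> (\<forall>s\<in>X. U s \<subseteq> actions M s) \<and> (\<forall>s. s \<notin> X \<longrightarrow> U s = {})}"

definition component_edges :: "('s, 'a) mdp \<Rightarrow> ('s, 'a) component \<Rightarrow> ('s \<times> 's) set" where
  "component_edges M = (\<lambda>(X, U). {(s, s'). s \<in> X \<and> (\<exists>u\<in>U s. s' \<in> set_pmf (kernel M s u))})"

definition end_component :: "('s, 'a) mdp \<Rightarrow> ('s, 'a) component \<Rightarrow> bool" where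
  "end_component M = (\<lambda>(X, U).
     (X, U) \<in> component_candidates M \<and> X \<noteq> {} \<and>
     (\<forall>s\<in>X. \<forall>u\<in>U s. set_pmf (kernel M s u) \<subseteq> X) \<and>
     (\<forall>s\<in>X. \<forall>s'\<in>X. s \<noteq> s' \<longrightarrow> (s, s') \<in> (component_edges M (X, U))\<^sup>+))"

definition is_MEC :: "('s, 'a) mdp \<Rightarrow> ('s, 'a) component \<Rightarrow> bool" where
  "is_MEC M = (\<lambda>(X, U). end_component M (X, U) \<and>
     (\<forall>X' U'. end_component M (X', U') \<and> X \<subseteq> X' \<and> (\<forall>s\<in>X. U s \<subseteq> U' s) \<longrightarrow>
        (X', U') = (X, U)))"

definition informative_component ::
  "('s, 'a) mmdp \<Rightarrow> ('s ext, 'a ext) component \<Rightarrow> bool" where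
  "informative_component M = (\<lambda>(X, U). \<exists>(s, a)\<in>ISAp M. s \<in> X \<and> a \<in> U s)"

definition informative_MECs ::
  "('s, 'a) mmdp \<Rightarrow> ('s \<Rightarrow> 'a) \<Rightarrow> real \<Rightarrow> ('s ext, 'a ext) component set" where
  "informative_MECs M \<alpha> \<gamma> =
     {C. is_MEC (informative_mdp M \<alpha> \<gamma>) C \<and> informative_component M C}"

definition covered :: "('s, 'a) component set \<Rightarrow> 's set" where
  "covered \<C> = (\<Union>(X, U)\<in>\<C>. X)"


section \<open>What BiAPD is required to return\<close>

definition Rmax :: "('s, 'a) mdp \<Rightarrow> 's set \<Rightarrow> 's set" where
  "Rmax M T = {s \<in> states M.
     is_maximum {reach_prob (M\<lparr>init := s\<rparr>) \<pi> T | \<pi>. is_policy (M\<lparr>init := s\<rparr>) \<pi>} 1}"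

text \<open>A memoryless policy; its value at a state outside its intended domain is irrelevant.\<close>

type_synonym ('s, 'a) mless = "'s \<Rightarrow> 'a pmf"

text \<open>
  The two requirements on \<open>\<pi>\<^sup>0\<close> are imposed jointly: it reaches \<open>T\<close> almost surely, and at states
  of \<open>R - T\<close> it is a point mass on an action that cannot leave \<open>R\<close>. The second requirement does
  not imply the first, since an action looping at a state of \<open>R - T\<close> satisfies it.
\<close>

definition reaching_policy ::
  "('s, 'a) mdp \<Rightarrow> 's set \<Rightarrow> 's set \<Rightarrow> ('s, 'a) mless \<Rightarrow> bool" where
  "reaching_policy M T R \<pi> \<longleftrightarrow>
     (\<forall>s\<in>states M. set_pmf (\<pi> s) \<subseteq> actions M s) \<and>
     (\<forall>s\<in>R - T. \<exists>a\<in>actions M s. \<pi> s = return_pmf a \<and> set_pmf (kernel M s a) \<subseteq> R) \<and>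
     reach_prob M (\<lambda>h. \<pi> (last_state h)) T = 1"

text \<open>
  The second output of BiAPD is a set of memoryless policies; the label \<open>None\<close> marks \<open>\<pi>\<^sup>0\<close> and
  \<open>Some C\<close> marks the policy of the informative MEC \<open>C\<close>.
\<close>

type_synonym ('s, 'a) policies = "(('s, 'a) component option \<times> ('s, 'a) mless) set"

definition MEC_policy :: "('s, 'a) component \<Rightarrow> ('s, 'a) mless" where
  "MEC_policy = (\<lambda>(X, U). \<lambda>s. pmf_of_set (U s))"

definition assemble ::
  "('s, 'a) mless \<Rightarrow> ('s, 'a) component set \<Rightarrow> ('s, 'a) policies" where
  "assemble \<pi>0 \<C> = insert (None, \<pi>0) ((\<lambda>C. (Some C, MEC_policy C)) ` \<C>)"

text \<open>
  \<open>(flag, \<Psi>)\<close> is a result of BiAPD on \<open>M\<close> for the informative MDP constructed from \<open>\<alpha>\<close>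
  and \<open>\<gamma>\<close>.
\<close>

definition biapd_result ::
  "('s, 'a) mmdp \<Rightarrow> ('s \<Rightarrow> 'a) \<Rightarrow> real \<Rightarrow> nat \<Rightarrow> ('s ext, 'a ext) policies \<Rightarrow> bool" where
  "biapd_result M \<alpha> \<gamma> flag \<Psi> \<longleftrightarrow>
     action_choice M \<alpha> \<and> 0 < \<gamma> \<and> \<gamma> < 1 \<and>
     (let MI = informative_mdp M \<alpha> \<gamma>;
          \<C> = informative_MECs M \<alpha> \<gamma>;
          T = covered \<C>;
          R = Rmax MI T
      in if init MI \<notin> R then flag = 0 \<and> \<Psi> = {}
         else flag = 1 \<and> (\<exists>\<pi>0. reaching_policy MI T R \<pi>0 \<and> \<Psi> = assemble \<pi>0 \<C>))"


section \<open>Using the returned policies\<close>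

primrec entry :: "'s set \<Rightarrow> ('s, 'a) hist \<Rightarrow> 's option" where
  "entry T (Start s) = (if s \<in> T then Some s else None)"
| "entry T (Snoc h a s) =
     (case entry T h of Some x \<Rightarrow> Some x | None \<Rightarrow> if s \<in> T then Some s else None)"

text \<open>
  \<open>\<rho>\<close> follows \<open>\<Psi>\<close>: it uses \<open>\<pi>\<^sup>0\<close> until the union \<open>T\<close> of the informative MECs is first entered,
  at \<open>x\<close> say, and then the policy of the MEC containing \<open>x\<close>. The choice is left open on histories
  that have left this MEC again, where its policy is undefined.
\<close>

definition follows ::
  "('s, 'a) mmdp \<Rightarrow> ('s, 'a) policies \<Rightarrow> ('s, 'a) policy \<Rightarrow> bool" where
  "follows P \<Psi> \<rho> \<longleftrightarrow> is_mpolicy P \<rho> \<and>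
     (let T = covered {C. \<exists>p. (Some C, p) \<in> \<Psi>} in
      \<forall>t. \<forall>h\<in>mhistories P t.
        (\<forall>p. (None, p) \<in> \<Psi> \<and> entry T h = None \<longrightarrow> \<rho> h = p (last_state h)) \<and>
        (\<forall>X U p x. (Some (X, U), p) \<in> \<Psi> \<and> entry T h = Some x \<and> x \<in> X \<and> last_state h \<in> X \<longrightarrow>
           \<rho> h = p (last_state h)))"

text \<open>
  \<open>\<pi>\<close> is the policy \<open>\<rho>\<close> of the preprocessed MMDP used on \<open>M\<close>. It is unconstrained, apart from
  being a policy of \<open>M\<close>, after an identity-revealing transition and on histories that are not
  histories of the preprocessed MMDP because they use a removed action, where \<open>\<rho>\<close> is undefined.
\<close>

definition used_on ::
  "('s, 'a) mmdp \<Rightarrow> ('s \<Rightarrow> 'a) \<Rightarrow> ('s ext, 'a ext) policy \<Rightarrow> ('s, 'a) policy \<Rightarrow> bool" where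
  "used_on M \<alpha> \<rho> \<pi> \<longleftrightarrow> is_mpolicy M \<pi> \<and>
     (\<forall>t. \<forall>h\<in>mhistories M t.
        no_identity_revealing M h \<and>
        map_hist Orig Orig h \<in> mhistories (preprocessed M \<alpha>) t \<longrightarrow>
        map_pmf Orig (\<pi> h) = \<rho> (map_hist Orig Orig h))"


section \<open>BiAPD as a procedure\<close>

text \<open>
  Each transition of the procedure below performs one test that quantifies only over finite sets
  built from the states and actions and inspects the kernels only through their supports and
  through the equality of \<open>\<delta>\<^sub>1(\<cdot>|s,a)\<close> and \<open>\<delta>\<^sub>2(\<cdot>|s,a)\<close>. In particular the two tests related to
  reachability are graph tests; that they compute the sets and policies required by
  \<^const>\<open>biapd_result\<close> is not built into the definition.

  \<open>FindMECs\<close> checks the candidate components one by one. \<open>FindR\<close> removes states, one by one,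
  from which \<open>T\<close> cannot be reached by actions that stay in the current set \<open>R\<close>. \<open>FindPolicy\<close>
  checks the candidate action choices for \<open>\<pi>\<^sup>0\<close> one by one.
\<close>

text \<open>
  Arguments of the configurations: the chosen revealing actions and the weight of the informative
  MDP; then, for \<open>FindMECs\<close>, the components still to be checked and the informative MECs found
  so far; for \<open>FindR\<close>, the informative MECs and the current \<open>R\<close>; for \<open>FindPolicy\<close>, the
  informative MECs, \<open>R\<close> and the action choices still to be checked; for \<open>Return\<close>, the result.
\<close>

datatype ('s, 'a) config =
    Begin
  | FindMECs "'s \<Rightarrow> 'a" real "('s ext, 'a ext) component set" "('s ext, 'a ext) component set"
  | FindR "'s \<Rightarrow> 'a" real "('s ext, 'a ext) component set" "'s ext set"
  | FindPolicy "'s \<Rightarrow> 'a" real "('s ext, 'a ext) component set" "'s ext set"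
      "('s ext \<Rightarrow> 'a ext) set"
  | Return "'s \<Rightarrow> 'a" real nat "('s ext, 'a ext) policies"

definition staying_edges :: "('s, 'a) mdp \<Rightarrow> 's set \<Rightarrow> ('s \<times> 's) set" where
  "staying_edges M R = {(s, s'). s \<in> R \<and>
     (\<exists>a\<in>actions M s. set_pmf (kernel M s a) \<subseteq> R \<and> s' \<in> set_pmf (kernel M s a))}"

definition can_reach :: "('s, 'a) mdp \<Rightarrow> 's set \<Rightarrow> 's set \<Rightarrow> 's \<Rightarrow> bool" where
  "can_reach M T R s \<longleftrightarrow> (\<exists>s'\<in>T. (s, s') \<in> (staying_edges M R)\<^sup>*)"

definition selector_candidates ::
  "('s, 'a) mdp \<Rightarrow> 's set \<Rightarrow> 's set \<Rightarrow> ('s \<Rightarrow> 'a) set" where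
  "selector_candidates M T R =
     {f \<in> Pi\<^sub>E (states M) (actions M). \<forall>s\<in>R - T. set_pmf (kernel M s (f s)) \<subseteq> R}"

definition selector_edges :: "('s, 'a) mdp \<Rightarrow> 's set \<Rightarrow> ('s \<Rightarrow> 'a) \<Rightarrow> ('s \<times> 's) set" where
  "selector_edges M T f = {(s, s'). s \<in> states M - T \<and> s' \<in> set_pmf (kernel M s (f s))}"

definition selector_ok :: "('s, 'a) mdp \<Rightarrow> 's set \<Rightarrow> ('s \<Rightarrow> 'a) \<Rightarrow> bool" where
  "selector_ok M T f \<longleftrightarrow>
     (\<forall>s. (init M, s) \<in> (selector_edges M T f)\<^sup>* \<longrightarrow>
        (\<exists>s'\<in>T. (s, s') \<in> (selector_edges M T f)\<^sup>*))"

inductive biapd_step :: "('s, 'a) mmdp \<Rightarrow> ('s, 'a) config \<Rightarrow> ('s, 'a) config \<Rightarrow> bool" for M where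
  construct: "action_choice M \<alpha> \<Longrightarrow> 0 < \<gamma> \<Longrightarrow> \<gamma> < 1 \<Longrightarrow>
    biapd_step M Begin
      (FindMECs \<alpha> \<gamma> (component_candidates (informative_mdp M \<alpha> \<gamma>)) {})"
| check_component: "C \<in> K \<Longrightarrow>
    biapd_step M (FindMECs \<alpha> \<gamma> K F)
      (FindMECs \<alpha> \<gamma> (K - {C})
         (if is_MEC (informative_mdp M \<alpha> \<gamma>) C \<and> informative_component M C
          then insert C F else F))"
| components_done:
    "biapd_step M (FindMECs \<alpha> \<gamma> {} F)
      (FindR \<alpha> \<gamma> F (states (informative_mdp M \<alpha> \<gamma>)))"
| prune: "s \<in> R \<Longrightarrow> \<not> can_reach (informative_mdp M \<alpha> \<gamma>) (covered F) R s \<Longrightarrow>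
    biapd_step M (FindR \<alpha> \<gamma> F R) (FindR \<alpha> \<gamma> F (R - {s}))"
| negative: "\<forall>s\<in>R. can_reach (informative_mdp M \<alpha> \<gamma>) (covered F) R s \<Longrightarrow>
    init (informative_mdp M \<alpha> \<gamma>) \<notin> R \<Longrightarrow>
    biapd_step M (FindR \<alpha> \<gamma> F R) (Return \<alpha> \<gamma> 0 {})"
| positive: "\<forall>s\<in>R. can_reach (informative_mdp M \<alpha> \<gamma>) (covered F) R s \<Longrightarrow>
    init (informative_mdp M \<alpha> \<gamma>) \<in> R \<Longrightarrow>
    biapd_step M (FindR \<alpha> \<gamma> F R)
      (FindPolicy \<alpha> \<gamma> F R (selector_candidates (informative_mdp M \<alpha> \<gamma>) (covered F) R))"
| reject: "f \<in> K \<Longrightarrow> \<not> selector_ok (informative_mdp M \<alpha> \<gamma>) (covered F) f \<Longrightarrow>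
    biapd_step M (FindPolicy \<alpha> \<gamma> F R K) (FindPolicy \<alpha> \<gamma> F R (K - {f}))"
| accept: "f \<in> K \<Longrightarrow> selector_ok (informative_mdp M \<alpha> \<gamma>) (covered F) f \<Longrightarrow>
    biapd_step M (FindPolicy \<alpha> \<gamma> F R K)
      (Return \<alpha> \<gamma> 1 (assemble (\<lambda>s. return_pmf (f s)) F))"

text \<open>No execution is infinite, and none gets stuck before it has returned a result.\<close>

definition biapd_terminates :: "('s, 'a) mmdp \<Rightarrow> bool" where
  "biapd_terminates M \<longleftrightarrow>
     \<not> (\<exists>c. c 0 = Begin \<and> (\<forall>n. biapd_step M (c n) (c (Suc n)))) \<and>
     (\<forall>c. (biapd_step M)\<^sup>*\<^sup>* Begin c \<longrightarrow>
        (\<exists>\<alpha> \<gamma> flag \<Psi>. c = Return \<alpha> \<gamma> flag \<Psi>) \<or> (\<exists>c'. biapd_step M c c'))"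

definition biapd_returns ::
  "('s, 'a) mmdp \<Rightarrow> ('s \<Rightarrow> 'a) \<Rightarrow> real \<Rightarrow> nat \<Rightarrow> ('s ext, 'a ext) policies \<Rightarrow> bool" where
  "biapd_returns M \<alpha> \<gamma> flag \<Psi> \<longleftrightarrow> (biapd_step M)\<^sup>*\<^sup>* Begin (Return \<alpha> \<gamma> flag \<Psi>)"

end

theory Submission
  imports Defs
begin

text \<open>
  Let \<open>P\<^sub>1, P\<^sub>2\<close> be the history probabilities of the two models under a policy. The error
  probabilities tend to \<open>0\<close> exactly when \<open>\<Sum>h. min (P\<^sub>1 h) (P\<^sub>2 h)\<close> does. That sum does not factor
  along histories, but it lies between two sums that do: histories weighted by the product of the
  one-step overlaps \<open>min \<delta>\<^sub>1 \<delta>\<^sub>2\<close>, and by the product of the one-step affinities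
  \<open>\<delta>\<^sub>1 powr \<gamma> * \<delta>\<^sub>2 powr (1 - \<gamma>)\<close>. Either product is the survival weight of a substochastic
  decision process in which a pair \<open>(s, a)\<close> loses mass precisely when the kernels of the two models
  differ at it. Detection is thus the almost sure extinction of such a process, and extinction in a
  finite process is a matter of graphs. No measure on infinite paths and no law of large numbers
  enters.

  Necessity. In any finite substochastic process the states split into a set from which every
  policy keeps a uniform positive amount of mass for ever, and a core \<open>G\<close> in which every nonempty
  subset can be left, or can lose mass, by an action that stays in \<open>G\<close> (\<open>extinction_core\<close>).
  For the overlap process, a policy that achieves detection starts in \<open>G\<close>. Inside \<open>G\<close>, together
  with the two absorbing states, the union of the informative MECs is reachable from everywhere:
  a bottom strongly connected class missing it would be an end component, would contain an
  informative pair because it must lose mass, and so would lie in an informative MEC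
  (\<open>core_can_reach\<close>). Following shortest paths turns this into almost sure reachability
  (\<open>subset_Rmax\<close>), so the initial state passes the test of the algorithm.

  Sufficiency. With the exponent \<open>\<gamma>\<close> equal to the weight of the mixture, the inequality between
  geometric and arithmetic means bounds the affinity of a history that has not entered an
  informative MEC by its probability in the informative MDP, and these probabilities are small in
  total once \<open>\<pi>\<^sup>0\<close> has had enough time (\<open>sum_weight_before_entry\<close>). Inside an informative MEC the
  uniform policy is a finite irreducible chain that loses mass at an informative pair, so its
  surviving mass tends to \<open>0\<close> (\<open>survival_in_MEC\<close>).

  The procedure. Removing states that cannot reach the target by staying actions only removes
  states from which every policy misses the target with uniformly positive probability, and the
  states left at the end reach it almost surely under a suitable selector. So the graph tests
  compute the set of almost surely reaching states exactly (\<open>Rmax_eqI\<close>), and some candidate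
  selector is always accepted. Termination is lexicographic in the phase and the number of objects still to be examined.
\<close>

section \<open>Weighted geometric means\<close>

text \<open>
  The weighted geometric mean. It is multiplicative in both arguments, dominates the minimum, and
  is strictly below the arithmetic mean with the same weights unless its arguments agree.
\<close>

definition geo :: "real \<Rightarrow> real \<Rightarrow> real \<Rightarrow> real" where
  "geo \<gamma> p q = p powr \<gamma> * q powr (1 - \<gamma>)"

lemma geo_nonneg [simp]: "0 \<le> geo \<gamma> p q"
  by (simp add: geo_def)

lemma geo_pos_iff: "0 < geo \<gamma> p q \<longleftrightarrow> p \<noteq> 0 \<and> q \<noteq> 0"
  by (simp add: geo_def zero_less_mult_iff)

lemma geo_zero [simp]: "geo \<gamma> 0 q = 0" "geo \<gamma> p 0 = 0"
  by (simp_all add: geo_def)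

lemma geo_self: "0 \<le> p \<Longrightarrow> geo \<gamma> p p = p"
  by (cases "p = 0") (simp_all add: geo_def flip: powr_add)

lemma geo_mult:
  assumes "0 \<le> p" "0 \<le> q" "0 \<le> p'" "0 \<le> q'"
  shows "geo \<gamma> (p * p') (q * q') = geo \<gamma> p q * geo \<gamma> p' q'"
  using assms by (simp add: geo_def powr_mult)

text \<open>
  Divide by the geometric mean \<open>m\<close>: the weighted sum of \<open>ln (p / m)\<close> and \<open>ln (q / m)\<close> vanishes,
  and \<open>ln x < x - 1\<close> for \<open>x \<noteq> 1\<close>.
\<close>

lemma geo_less_mix:
  assumes g: "0 < \<gamma>" "\<gamma> < 1" and "0 \<le> p" "0 \<le> q" "p \<noteq> q"
  shows "geo \<gamma> p q < \<gamma> * p + (1 - \<gamma>) * q"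
proof (cases "p = 0 \<or> q = 0")
  case True
  have "0 < \<gamma> * p + (1 - \<gamma>) * q"
    using assms True by (auto simp: zero_less_mult_iff)
  then show ?thesis using True by (auto simp: geo_def)
next
  case False
  then have pq: "0 < p" "0 < q" using assms by auto
  define m where "m = geo \<gamma> p q"
  have m: "0 < m" using False by (simp add: m_def geo_pos_iff)
  have lm: "ln m = \<gamma> * ln p + (1 - \<gamma>) * ln q"
    using pq by (simp add: m_def geo_def ln_mult)
  have p1: "ln (p / m) \<le> p / m - 1" and q1: "ln (q / m) \<le> q / m - 1"
    using pq m by (auto intro!: ln_le_minus_one)
  have "p \<noteq> m \<or> q \<noteq> m" using assms by auto
  then have "ln (p / m) < p / m - 1 \<or> ln (q / m) < q / m - 1"
  proof
    assume "p \<noteq> m"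
    then have "ln (p / m) \<noteq> p / m - 1" using ln_eq_minus_one[of "p / m"] pq m by auto
    then show ?thesis using p1 by auto
  next
    assume "q \<noteq> m"
    then have "ln (q / m) \<noteq> q / m - 1" using ln_eq_minus_one[of "q / m"] pq m by auto
    then show ?thesis using q1 by auto
  qed
  moreover have weighted: "0 < \<gamma> * x + (1 - \<gamma>) * y" if "0 \<le> x" "0 \<le> y" "0 < x \<or> 0 < y" for x y
    using that(3)
  proof
    assume "0 < x"
    then show ?thesis using g that by (intro add_pos_nonneg mult_pos_pos mult_nonneg_nonneg) auto
  next
    assume "0 < y"
    then show ?thesis using g that by (intro add_nonneg_pos mult_pos_pos mult_nonneg_nonneg) auto
  qed
  moreover have "\<gamma> * ln (p / m) + (1 - \<gamma>) * ln (q / m) = 0"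
    using pq m lm by (simp add: ln_div algebra_simps)
  ultimately have "0 < \<gamma> * (p / m - 1) + (1 - \<gamma>) * (q / m - 1)"
    using weighted[of "p / m - 1 - ln (p / m)" "q / m - 1 - ln (q / m)"] p1 q1
    by (auto simp: algebra_simps)
  also have "\<dots> = (\<gamma> * p + (1 - \<gamma>) * q) / m - 1"
    using m by (simp add: field_simps)
  finally show ?thesis using m by (simp add: m_def[symmetric] field_simps)
qed

lemma geo_le_mix:
  assumes "0 < \<gamma>" "\<gamma> < 1" "0 \<le> p" "0 \<le> q"
  shows "geo \<gamma> p q \<le> \<gamma> * p + (1 - \<gamma>) * q"
proof (cases "p = q")
  case True
  then show ?thesis using assms by (simp add: geo_self algebra_simps)
next
  case False
  then show ?thesis using geo_less_mix assms by fastforce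
qed

lemma min_le_geo:
  assumes "0 < \<gamma>" "\<gamma> < 1" "0 \<le> p" "0 \<le> q"
  shows "min p q \<le> geo \<gamma> p q"
proof -
  have "geo \<gamma> (min p q) (min p q) \<le> geo \<gamma> p q"
    unfolding geo_def using assms by (intro mult_mono powr_mono2) auto
  then show ?thesis using assms by (simp add: geo_self)
qed

lemma sum_pmf_le_1: "finite S \<Longrightarrow> sum (pmf \<mu>) S \<le> 1"
  by (metis measure_measure_pmf_finite measure_pmf.prob_le_1)

lemma sum_geo_pmf_le:
  assumes "0 < \<gamma>" "\<gamma> < 1" "finite S"
  shows "(\<Sum>s\<in>S. geo \<gamma> (pmf \<mu> s) (pmf \<nu> s)) \<le> 1"
proof -
  have "(\<Sum>s\<in>S. geo \<gamma> (pmf \<mu> s) (pmf \<nu> s)) \<le> (\<Sum>s\<in>S. \<gamma> * pmf \<mu> s + (1 - \<gamma>) * pmf \<nu> s)"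
    using assms by (intro sum_mono geo_le_mix) auto
  also have "\<dots> = \<gamma> * sum (pmf \<mu>) S + (1 - \<gamma>) * sum (pmf \<nu>) S"
    by (simp only: sum.distrib sum_distrib_left)
  also have "\<dots> \<le> \<gamma> * 1 + (1 - \<gamma>) * 1"
    using assms by (intro add_mono mult_left_mono sum_pmf_le_1) auto
  finally show ?thesis by simp
qed

lemma sum_geo_pmf_less:
  assumes g: "0 < \<gamma>" "\<gamma> < 1" and S: "finite S" "set_pmf \<mu> \<subseteq> S" "set_pmf \<nu> \<subseteq> S" and ne: "\<mu> \<noteq> \<nu>"
  shows "(\<Sum>s\<in>S. geo \<gamma> (pmf \<mu> s) (pmf \<nu> s)) < 1"
proof -
  obtain s where s: "pmf \<mu> s \<noteq> pmf \<nu> s" using ne pmf_eqI[of \<mu> \<nu>] by auto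
  then have "s \<in> S" using S by (metis pmf_eq_0_set_pmf subsetD)
  have "(\<Sum>s\<in>S. geo \<gamma> (pmf \<mu> s) (pmf \<nu> s)) < (\<Sum>s\<in>S. \<gamma> * pmf \<mu> s + (1 - \<gamma>) * pmf \<nu> s)"
    using S geo_le_mix[OF g] geo_less_mix[OF g _ _ s] \<open>s \<in> S\<close> by (intro sum_strict_mono_ex1) auto
  also have "\<dots> = \<gamma> * sum (pmf \<mu>) S + (1 - \<gamma>) * sum (pmf \<nu>) S"
    by (simp only: sum.distrib sum_distrib_left)
  also have "\<dots> = 1"
    using S by (simp add: sum_pmf_eq_1)
  finally show ?thesis .
qed

section \<open>Finite chains that lose mass\<close>

lemma rtrancl_exit:
  assumes "(a, b) \<in> E\<^sup>*" "a \<in> Y" "b \<notin> Y"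
  shows "\<exists>u v. (u, v) \<in> E \<and> u \<in> Y \<and> v \<notin> Y"
  using assms(1,3)
proof (induction rule: rtrancl_induct)
  case base
  then show ?case using assms by auto
next
  case (step y z)
  then show ?case by (cases "y \<in> Y") auto
qed

text \<open>
  The mass that is still in \<open>X\<close> after \<open>n\<close> steps of the chain \<open>D\<close> started with unit mass at \<open>s\<close>.
\<close>

primrec iterate_mass :: "('s \<Rightarrow> 's \<Rightarrow> real) \<Rightarrow> 's set \<Rightarrow> nat \<Rightarrow> 's \<Rightarrow> real" where
  "iterate_mass D X 0 s = 1"
| "iterate_mass D X (Suc n) s = (\<Sum>s'\<in>X. D s s' * iterate_mass D X n s')"

text \<open>
  The surviving mass decreases to a function that is harmonic for \<open>D\<close>. If its maximum were
  positive, then at a point of the set \<open>Y\<close> where the maximum is attained no mass could be lost and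
  none could leave \<open>Y\<close>, contradicting the leak out of \<open>Y\<close>.
\<close>

lemma iterate_mass_tendsto_0:
  assumes fin: "finite X" and nonneg: "\<And>s s'. s \<in> X \<Longrightarrow> s' \<in> X \<Longrightarrow> 0 \<le> D s s'"
    and sub: "\<And>s. s \<in> X \<Longrightarrow> sum (D s) X \<le> 1"
    and leak: "\<And>Y. Y \<subseteq> X \<Longrightarrow> Y \<noteq> {} \<Longrightarrow> \<exists>s\<in>Y. sum (D s) Y < 1"
    and s: "s \<in> X"
  shows "(\<lambda>n. iterate_mass D X n s) \<longlonglongrightarrow> 0"
proof -
  let ?v = "iterate_mass D X"
  have v0: "0 \<le> ?v n s" if "s \<in> X" for n s
    using that by (induction n arbitrary: s) (auto intro!: sum_nonneg mult_nonneg_nonneg nonneg)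
  have dec: "?v (Suc n) s \<le> ?v n s" if "s \<in> X" for n s
    using that
  proof (induction n arbitrary: s)
    case 0
    then show ?case using sub by simp
  next
    case (Suc n)
    have "(\<Sum>s'\<in>X. D s s' * ?v (Suc n) s') \<le> (\<Sum>s'\<in>X. D s s' * ?v n s')"
      using Suc nonneg by (intro sum_mono mult_left_mono) blast+
    then show ?case by (simp only: iterate_mass.simps(2))
  qed
  have "\<exists>l. (\<lambda>n. ?v n s) \<longlonglongrightarrow> l" if "s \<in> X" for s
  proof -
    have "decseq (\<lambda>n. ?v n s)" by (intro decseq_SucI dec that)
    moreover have "\<forall>i. 0 \<le> ?v i s" using v0[OF that] by blast
    ultimately show ?thesis by (rule decseq_convergent) blast
  qed
  then obtain l where l: "\<And>s. s \<in> X \<Longrightarrow> (\<lambda>n. ?v n s) \<longlonglongrightarrow> l s" by metis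
  have l0: "0 \<le> l s" if "s \<in> X" for s
    using LIMSEQ_le_const[OF l[OF that]] v0[OF that] by blast
  have harm: "l s = (\<Sum>s'\<in>X. D s s' * l s')" if "s \<in> X" for s
  proof (rule LIMSEQ_unique)
    show "(\<lambda>n. ?v (Suc n) s) \<longlonglongrightarrow> l s" using l[OF that] by (rule LIMSEQ_Suc)
    show "(\<lambda>n. ?v (Suc n) s) \<longlonglongrightarrow> (\<Sum>s'\<in>X. D s s' * l s')"
      unfolding iterate_mass.simps(2) by (intro tendsto_sum tendsto_mult_left l)
  qed
  define m where "m = Max (l ` X)"
  have lm: "l s \<le> m" if "s \<in> X" for s using that fin by (simp add: m_def)
  define Y where "Y = {s \<in> X. l s = m}"
  have "m \<in> l ` X" unfolding m_def using fin s by (intro Max_in) auto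
  then have "Y \<noteq> {}" by (auto simp: Y_def)
  moreover have YX: "Y \<subseteq> X" by (auto simp: Y_def)
  ultimately obtain y where y: "y \<in> Y" "sum (D y) Y < 1" using leak by blast
  have yX: "y \<in> X" using y YX by auto
  have m0: "0 \<le> m" using l0[OF yX] y by (simp add: Y_def)
  have "m \<le> 0"
  proof (rule ccontr)
    assume "\<not> m \<le> 0"
    then have mpos: "0 < m" by simp
    have split: "(\<Sum>s'\<in>X. f s') = (\<Sum>s'\<in>Y. f s') + (\<Sum>s'\<in>X - Y. f s')" for f :: "_ \<Rightarrow> real"
      using sum.subset_diff[OF YX fin, of f] by simp
    have "m = (\<Sum>s'\<in>X. D y s' * l s')" using harm[OF yX] y by (simp add: Y_def)
    then have eq: "m = sum (D y) Y * m + (\<Sum>s'\<in>X - Y. D y s' * l s')"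
      unfolding split[of "\<lambda>s'. D y s' * l s'"] by (simp add: sum_distrib_right Y_def)
    have le: "(\<Sum>s'\<in>X - Y. D y s' * l s') \<le> sum (D y) (X - Y) * m"
      unfolding sum_distrib_right using nonneg yX lm by (intro sum_mono mult_left_mono) auto
    show False
    proof (cases "\<exists>s'\<in>X - Y. D y s' > 0")
      case True
      then obtain s' where s': "s' \<in> X - Y" "D y s' > 0" by auto
      have "l s' < m" using s' lm[of s'] by (force simp: Y_def)
      have "(\<Sum>s'\<in>X - Y. D y s' * l s') < (\<Sum>s'\<in>X - Y. D y s' * m)"
      proof (rule sum_strict_mono_ex1)
        show "\<forall>s'\<in>X - Y. D y s' * l s' \<le> D y s' * m"
          using nonneg yX lm by (intro ballI mult_left_mono) auto
        show "\<exists>s'\<in>X - Y. D y s' * l s' < D y s' * m"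
          using s' \<open>l s' < m\<close> by (intro bexI[of _ s']) auto
      qed (use fin in auto)
      then have "m < sum (D y) Y * m + sum (D y) (X - Y) * m"
        using eq by (simp add: sum_distrib_right)
      also have "\<dots> = sum (D y) X * m" unfolding split[of "D y"] by (simp add: algebra_simps)
      also have "\<dots> \<le> 1 * m" using sub[OF yX] m0 by (intro mult_right_mono) auto
      finally show False by simp
    next
      case False
      then have "D y s' = 0" if "s' \<in> X - Y" for s'
        using nonneg[OF yX, of s'] that by force
      then have "m = sum (D y) Y * m" using eq by simp
      then show False using y mpos by simp
    qed
  qed
  then have "l s = 0" using l0[OF s] lm[OF s] by simp
  then show ?thesis using l[OF s] by simp
qed

section \<open>Weighted history trees\<close>

text \<open>
  All histories from \<open>x\<close> that use available actions, whether or not their transitions are possible: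
  a common finite index set for the histories of different models, on which impossible transitions
  simply carry weight \<open>0\<close>.
\<close>

primrec paths :: "'s set \<Rightarrow> ('s \<Rightarrow> 'a set) \<Rightarrow> 's \<Rightarrow> nat \<Rightarrow> ('s, 'a) hist set" where
  "paths S A x 0 = {Start x}"
| "paths S A x (Suc n) =
     (\<lambda>(h, a, s). Snoc h a s) ` (SIGMA h:paths S A x n. A (last_state h) \<times> S)"

primrec weight ::
  "('s \<Rightarrow> 'a \<Rightarrow> 's \<Rightarrow> real) \<Rightarrow> ('s, 'a) policy \<Rightarrow> ('s, 'a) hist \<Rightarrow> real" where
  "weight K \<pi> (Start s) = 1"
| "weight K \<pi> (Snoc h a s) = weight K \<pi> h * pmf (\<pi> h) a * K (last_state h) a s"

text \<open>
  The total weight of the \<open>t\<close>-step continuations of \<open>h\<close>, relative to the weight of \<open>h\<close>. The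
  recursion peels off the first step, while \<^const>\<open>weight\<close> grows at the end; \<open>sum_weight_add\<close>
  below reconciles the two.
\<close>

primrec survival ::
  "'s set \<Rightarrow> ('s \<Rightarrow> 'a set) \<Rightarrow> ('s \<Rightarrow> 'a \<Rightarrow> 's \<Rightarrow> real) \<Rightarrow> ('s, 'a) policy \<Rightarrow> nat \<Rightarrow>
     ('s, 'a) hist \<Rightarrow> real" where
  "survival S A K \<pi> 0 h = 1"
| "survival S A K \<pi> (Suc t) h = (\<Sum>a\<in>A (last_state h). pmf (\<pi> h) a *
     (\<Sum>s\<in>S. K (last_state h) a s * survival S A K \<pi> t (Snoc h a s)))"

lemma Snoc_in_paths_iff:
  "Snoc h a s \<in> paths S A x (Suc n) \<longleftrightarrow> h \<in> paths S A x n \<and> a \<in> A (last_state h) \<and> s \<in> S"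
  by (auto simp: image_iff)

lemma paths_steps: "h \<in> paths S A x n \<Longrightarrow> steps h = n"
  by (induction n arbitrary: h) auto

lemma paths_last_state: "x \<in> S \<Longrightarrow> h \<in> paths S A x n \<Longrightarrow> last_state h \<in> S"
  by (cases n) auto

locale substochastic =
  fixes S :: "'s set" and A :: "'s \<Rightarrow> 'a set" and K :: "'s \<Rightarrow> 'a \<Rightarrow> 's \<Rightarrow> real"
  assumes fin_S: "finite S" and fin_A: "\<And>s. s \<in> S \<Longrightarrow> finite (A s)"
    and nonneg: "\<And>s a s'. s \<in> S \<Longrightarrow> a \<in> A s \<Longrightarrow> s' \<in> S \<Longrightarrow> 0 \<le> K s a s'"
    and total: "\<And>s a. s \<in> S \<Longrightarrow> a \<in> A s \<Longrightarrow> sum (K s a) S \<le> 1"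
begin

abbreviation "surv \<equiv> survival S A K"

lemma finite_paths: "x \<in> S \<Longrightarrow> finite (paths S A x n)"
proof (induction n)
  case (Suc n)
  then show ?case
    by (auto intro!: finite_imageI finite_SigmaI finite_cartesian_product fin_S fin_A
        dest: paths_last_state)
qed simp

lemma sum_paths_Suc:
  assumes "x \<in> S"
  shows "sum f (paths S A x (Suc n)) =
    (\<Sum>h\<in>paths S A x n. \<Sum>a\<in>A (last_state h). \<Sum>s\<in>S. f (Snoc h a s))"
proof -
  have inj: "inj_on (\<lambda>(h, a, s). Snoc h a s) B" for B :: "(('s, 'a) hist \<times> 'a \<times> 's) set"
    by (auto simp: inj_on_def)
  have "sum f (paths S A x (Suc n)) =
    (\<Sum>(h, p)\<in>(SIGMA h:paths S A x n. A (last_state h) \<times> S). case p of (a, s) \<Rightarrow> f (Snoc h a s))"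
    unfolding paths.simps sum.reindex[OF inj] by (intro sum.cong) auto
  also have "\<dots> = (\<Sum>h\<in>paths S A x n. \<Sum>(a, s)\<in>A (last_state h) \<times> S. f (Snoc h a s))"
    using assms by (subst sum.Sigma)
      (auto intro!: finite_paths finite_cartesian_product fin_S fin_A dest: paths_last_state)
  also have "\<dots> = (\<Sum>h\<in>paths S A x n. \<Sum>a\<in>A (last_state h). \<Sum>s\<in>S. f (Snoc h a s))"
    by (simp add: sum.cartesian_product)
  finally show ?thesis .
qed

lemma weight_nonneg:
  assumes "x \<in> S" "h \<in> paths S A x n"
  shows "0 \<le> weight K \<pi> h"
  using assms(2)
proof (induction n arbitrary: h)
  case (Suc n)
  then show ?case
    by (auto intro!: mult_nonneg_nonneg nonneg dest: paths_last_state[OF assms(1)])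
qed simp

lemma surv_nonneg: "last_state h \<in> S \<Longrightarrow> 0 \<le> surv \<pi> t h"
  by (induction t arbitrary: h) (auto intro!: sum_nonneg mult_nonneg_nonneg nonneg)

lemma surv_le_1: "last_state h \<in> S \<Longrightarrow> surv \<pi> t h \<le> 1"
proof (induction t arbitrary: h)
  case (Suc t)
  let ?s = "last_state h"
  have "(\<Sum>s\<in>S. K ?s a s * surv \<pi> t (Snoc h a s)) \<le> 1" if "a \<in> A ?s" for a
  proof -
    have "(\<Sum>s\<in>S. K ?s a s * surv \<pi> t (Snoc h a s)) \<le> (\<Sum>s\<in>S. K ?s a s)"
      using Suc that by (intro sum_mono mult_left_le nonneg) auto
    then show ?thesis using total[of ?s a] Suc.prems that by simp
  qed
  then have "surv \<pi> (Suc t) h \<le> (\<Sum>a\<in>A ?s. pmf (\<pi> h) a)"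
    unfolding survival.simps by (intro sum_mono mult_left_le) auto
  also have "\<dots> \<le> 1" using Suc.prems by (intro sum_pmf_le_1 fin_A)
  finally show ?case .
qed simp

lemma sum_weight_add:
  assumes "x \<in> S"
  shows "(\<Sum>h\<in>paths S A x (n + t). weight K \<pi> h) =
    (\<Sum>h\<in>paths S A x n. weight K \<pi> h * surv \<pi> t h)"
proof (induction t arbitrary: n)
  case (Suc t)
  have "(\<Sum>h\<in>paths S A x (n + Suc t). weight K \<pi> h) =
      (\<Sum>h\<in>paths S A x (Suc n). weight K \<pi> h * surv \<pi> t h)"
    using Suc[of "Suc n"] by simp
  also have "\<dots> = (\<Sum>h\<in>paths S A x n. weight K \<pi> h * surv \<pi> (Suc t) h)"
    unfolding sum_paths_Suc[OF assms] by (simp add: sum_distrib_left mult.assoc)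
  finally show ?case .
qed simp

lemma sum_weight: "x \<in> S \<Longrightarrow> (\<Sum>h\<in>paths S A x t. weight K \<pi> h) = surv \<pi> t (Start x)"
  using sum_weight_add[of x \<pi> 0 t] by simp

text \<open>
  \<open>V\<close> is a set of histories on which \<open>\<pi>\<close> chooses available actions and which is closed under
  transitions of positive weight. It replaces the notion of history of a particular MDP, so that
  the lower bounds apply to processes whose weights are not probabilities.
\<close>

definition proper :: "('s, 'a) policy \<Rightarrow> (('s, 'a) hist \<Rightarrow> bool) \<Rightarrow> bool" where
  "proper \<pi> V \<longleftrightarrow> (\<forall>h. V h \<longrightarrow> last_state h \<in> S \<and> set_pmf (\<pi> h) \<subseteq> A (last_state h) \<and>
     (\<forall>a\<in>A (last_state h). \<forall>s\<in>S. 0 < K (last_state h) a s \<longrightarrow> V (Snoc h a s)))"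

text \<open>
  The bound does not depend on the policy or on time; this uniformity is what lets the pruning
  argument be iterated.
\<close>

definition persistent :: "'s set \<Rightarrow> bool" where
  "persistent B \<longleftrightarrow> (\<exists>\<epsilon>>0. \<forall>\<pi> V t h. proper \<pi> V \<longrightarrow> V h \<longrightarrow> last_state h \<in> B \<longrightarrow> \<epsilon> \<le> surv \<pi> t h)"

lemma persistent_mono: "persistent B \<Longrightarrow> C \<subseteq> B \<Longrightarrow> persistent C"
  unfolding persistent_def by (meson subsetD)

lemma positive_bound: "\<exists>p>0. p \<le> 1 \<and> (\<forall>s\<in>S. \<forall>a\<in>A s. \<forall>s'\<in>S. 0 < K s a s' \<longrightarrow> p \<le> K s a s')"
proof -
  define P where "P = {r. 0 < r \<and> (\<exists>s\<in>S. \<exists>a\<in>A s. \<exists>s'\<in>S. r = K s a s')}"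
  have "P \<subseteq> (\<Union>s\<in>S. \<Union>a\<in>A s. K s a ` S)" by (auto simp: P_def)
  moreover have "finite (\<Union>s\<in>S. \<Union>a\<in>A s. K s a ` S)" using fin_S fin_A by blast
  ultimately have "finite P" by (rule finite_subset)
  then have "0 < Min (insert 1 P)" "Min (insert 1 P) \<le> 1"
    "\<And>r. r \<in> P \<Longrightarrow> Min (insert 1 P) \<le> r"
    by (auto simp: P_def)
  then show ?thesis by (intro exI[of _ "Min (insert 1 P)"]) (auto simp: P_def)
qed

text \<open>
  At a state of \<open>Z\<close> every action either sends at least the least positive weight \<open>p\<close> into \<open>B\<close>, where
  a fraction \<open>\<epsilon>\<close> survives, or keeps all mass in \<open>Z\<close>. By induction on time \<open>p * \<epsilon>\<close> survives
  from \<open>Z\<close>.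
\<close>

lemma persistent_extend:
  assumes B: "persistent B" "B \<subseteq> S" and Z: "Z \<subseteq> S"
    and step: "\<And>s a. s \<in> Z \<Longrightarrow> a \<in> A s \<Longrightarrow> (\<exists>s'\<in>B. 0 < K s a s') \<or> 1 \<le> sum (K s a) Z"
  shows "persistent (B \<union> Z)"
proof -
  obtain \<epsilon>' where \<epsilon>': "\<epsilon>' > 0"
    "\<And>\<pi> V t h. proper \<pi> V \<Longrightarrow> V h \<Longrightarrow> last_state h \<in> B \<Longrightarrow> \<epsilon>' \<le> surv \<pi> t h"
    using B(1) unfolding persistent_def by blast
  \<comment> \<open>capped so that the bound also holds after zero steps, when the whole mass 1 survives\<close>
  define \<epsilon> where "\<epsilon> = min \<epsilon>' 1"
  have \<epsilon>: "0 < \<epsilon>" "\<epsilon> \<le> 1"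
    and low: "\<And>\<pi> V t h. proper \<pi> V \<Longrightarrow> V h \<Longrightarrow> last_state h \<in> B \<Longrightarrow> \<epsilon> \<le> surv \<pi> t h"
    using \<epsilon>'(1) by (auto simp: \<epsilon>_def intro: min.coboundedI1[OF \<epsilon>'(2)])
  obtain p where p: "0 < p" "p \<le> 1" "\<And>s a s'. s \<in> S \<Longrightarrow> a \<in> A s \<Longrightarrow> s' \<in> S \<Longrightarrow> 0 < K s a s' \<Longrightarrow> p \<le> K s a s'"
    using positive_bound by blast
  have p\<epsilon>: "0 < p * \<epsilon>" "p * \<epsilon> \<le> \<epsilon>" "p * \<epsilon> \<le> 1"
    using p(1,2) \<epsilon> by (auto simp: mult_le_one)
  have "p * \<epsilon> \<le> surv \<pi> t h" if V: "proper \<pi> V" and h: "V h" "last_state h \<in> Z" for \<pi> V t h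
    using h
  proof (induction t arbitrary: h)
    case 0
    then show ?case using p\<epsilon> by simp
  next
    case (Suc t)
    let ?s = "last_state h"
    have s: "?s \<in> S" "?s \<in> Z" and \<pi>: "set_pmf (\<pi> h) \<subseteq> A ?s"
      and V_Snoc: "\<And>a s. a \<in> A ?s \<Longrightarrow> s \<in> S \<Longrightarrow> 0 < K ?s a s \<Longrightarrow> V (Snoc h a s)"
      using V Suc.prems unfolding proper_def by auto
    have ge: "p * \<epsilon> \<le> (\<Sum>s\<in>S. K ?s a s * surv \<pi> t (Snoc h a s))" if a: "a \<in> A ?s" for a
      using step[OF s(2) a]
    proof
      assume "\<exists>s'\<in>B. 0 < K ?s a s'"
      then obtain s' where s': "s' \<in> B" "s' \<in> S" "0 < K ?s a s'" using B(2) by auto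
      have "p * \<epsilon> \<le> K ?s a s' * surv \<pi> t (Snoc h a s')"
        using low[OF V V_Snoc[OF a s'(2,3)]] s' p(1,3) a s \<epsilon> by (intro mult_mono) auto
      also have "\<dots> \<le> (\<Sum>s\<in>S. K ?s a s * surv \<pi> t (Snoc h a s))"
        using s s' a fin_S by (intro member_le_sum mult_nonneg_nonneg nonneg surv_nonneg) auto
      finally show ?thesis .
    next
      assume one: "1 \<le> sum (K ?s a) Z"
      have "p * \<epsilon> \<le> sum (K ?s a) Z * (p * \<epsilon>)" using mult_right_mono[OF one, of "p * \<epsilon>"] p\<epsilon>(1) by simp
      also have "\<dots> = (\<Sum>s\<in>Z. K ?s a s * (p * \<epsilon>))" by (rule sum_distrib_right)
      also have "\<dots> \<le> (\<Sum>s\<in>Z. K ?s a s * surv \<pi> t (Snoc h a s))"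
      proof (rule sum_mono)
        fix s' assume s': "s' \<in> Z"
        show "K ?s a s' * (p * \<epsilon>) \<le> K ?s a s' * surv \<pi> t (Snoc h a s')"
        proof (cases "K ?s a s' = 0")
          case False
          then have pos: "0 < K ?s a s'" using nonneg[OF s(1) a, of s'] s' Z by force
          then have "V (Snoc h a s')" using V_Snoc a s' Z by blast
          then show ?thesis using Suc.IH s' pos by simp
        qed simp
      qed
      also have "\<dots> \<le> (\<Sum>s\<in>S. K ?s a s * surv \<pi> t (Snoc h a s))"
        using s a Z fin_S by (intro sum_mono2 mult_nonneg_nonneg nonneg surv_nonneg) auto
      finally show ?thesis .
    qed
    have "p * \<epsilon> = (\<Sum>a\<in>A ?s. pmf (\<pi> h) a) * (p * \<epsilon>)"
      using sum_pmf_eq_1[OF fin_A[OF s(1)] \<pi>] by simp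
    also have "\<dots> \<le> surv \<pi> (Suc t) h"
      unfolding sum_distrib_right survival.simps using ge by (intro sum_mono mult_left_mono) auto
    finally show ?case .
  qed
  then have "p * \<epsilon> \<le> surv \<pi> t h"
    if "proper \<pi> V" "V h" "last_state h \<in> B \<union> Z" for \<pi> V t h
    using that low[OF that(1,2), of t] p\<epsilon> by fastforce
  then show ?thesis unfolding persistent_def using p\<epsilon>(1) by blast
qed

text \<open>
  Take \<open>G\<close> of least cardinality with a persistent complement. If some \<open>Z\<close> inside \<open>G\<close> violated the
  last property, then \<open>Z\<close> could be moved to the complement by \<open>persistent_extend\<close>.
\<close>

lemma extinction_core:
  obtains G where "G \<subseteq> S" "persistent (S - G)"
    "\<And>Z. Z \<subseteq> G \<Longrightarrow> Z \<noteq> {} \<Longrightarrow>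
       \<exists>s\<in>Z. \<exists>a\<in>A s. (\<forall>s'\<in>S. 0 < K s a s' \<longrightarrow> s' \<in> G) \<and> sum (K s a) Z < 1"
proof -
  \<comment> \<open>satisfied by \<open>S\<close>, since the empty set is persistent\<close>
  let ?P = "\<lambda>G. G \<subseteq> S \<and> persistent (S - G)"
  have "?P S" by (auto simp: persistent_def intro: exI[of _ 1])
  then obtain G where G: "?P G" "\<And>H. ?P H \<Longrightarrow> card G \<le> card H"
    using ex_has_least_nat[of ?P S card] by blast
  show thesis
  proof (rule that[of G])
    fix Z assume Z: "Z \<subseteq> G" "Z \<noteq> {}"
    show "\<exists>s\<in>Z. \<exists>a\<in>A s. (\<forall>s'\<in>S. 0 < K s a s' \<longrightarrow> s' \<in> G) \<and> sum (K s a) Z < 1"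
    proof (rule ccontr)
      assume *: "\<not> ?thesis"
      have "persistent ((S - G) \<union> Z)"
      proof (rule persistent_extend)
        fix s a assume "s \<in> Z" "a \<in> A s"
        then show "(\<exists>s'\<in>S - G. 0 < K s a s') \<or> 1 \<le> sum (K s a) Z"
          using * by (meson DiffI not_less)
      qed (use G Z in auto)
      moreover have "(S - G) \<union> Z = S - (G - Z)" using Z G by auto
      ultimately have "?P (G - Z)" using G(1) by auto
      then have "card G \<le> card (G - Z)" by (rule G(2))
      moreover have "card (G - Z) < card G"
        using Z G(1) fin_S by (intro psubset_card_mono) (auto dest: finite_subset)
      ultimately show False by simp
    qed
  qed (use G in auto)
qed

definition policy_step :: "('s \<Rightarrow> 'a pmf) \<Rightarrow> 's \<Rightarrow> 's \<Rightarrow> real" where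
  "policy_step \<nu> s s' = (\<Sum>a\<in>A s. pmf (\<nu> s) a * K s a s')"

text \<open>
  On histories where the policy depends on the last state only, survival is that of a chain on
  states. Closure of \<open>V\<close> is demanded only along transitions of positive probability, which suffices
  because all others contribute \<open>0\<close>.
\<close>

lemma survival_memoryless:
  assumes X: "X \<subseteq> S"
    and V: "\<And>h. V h \<Longrightarrow> last_state h \<in> X" "\<And>h. V h \<Longrightarrow> \<pi> h = \<nu> (last_state h)"
      "\<And>h a s. V h \<Longrightarrow> a \<in> A (last_state h) \<Longrightarrow> s \<in> S \<Longrightarrow> 0 < pmf (\<pi> h) a \<Longrightarrow>
        0 < K (last_state h) a s \<Longrightarrow> V (Snoc h a s)"
    and h: "V h"
  shows "surv \<pi> t h = iterate_mass (policy_step \<nu>) X t (last_state h)"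
  using h
proof (induction t arbitrary: h)
  case (Suc t)
  let ?s = "last_state h"
  have s: "?s \<in> S" using X V(1)[OF Suc.prems] by auto
  have zero: "pmf (\<pi> h) a * K ?s a s = 0" if "a \<in> A ?s" "s \<in> S" "\<not> V (Snoc h a s)" for a s
    using V(3)[OF Suc.prems that(1,2)] that(3) nonneg[OF s that(1,2)] pmf_nonneg[of "\<pi> h" a]
    by (metis mult_zero_left mult_zero_right order_le_less)
  have "surv \<pi> (Suc t) h = (\<Sum>a\<in>A ?s. \<Sum>s\<in>S. pmf (\<pi> h) a * K ?s a s * surv \<pi> t (Snoc h a s))"
    by (simp add: sum_distrib_left mult.assoc)
  also have "\<dots> = (\<Sum>a\<in>A ?s. \<Sum>s\<in>X. pmf (\<pi> h) a * K ?s a s * iterate_mass (policy_step \<nu>) X t s)"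
  proof (rule sum.cong[OF refl])
    fix a assume a: "a \<in> A ?s"
    have "(\<Sum>s\<in>S. pmf (\<pi> h) a * K ?s a s * surv \<pi> t (Snoc h a s)) =
        (\<Sum>s\<in>X. pmf (\<pi> h) a * K ?s a s * surv \<pi> t (Snoc h a s))"
    proof (rule sum.mono_neutral_right)
      show "\<forall>s\<in>S - X. pmf (\<pi> h) a * K ?s a s * surv \<pi> t (Snoc h a s) = 0"
        using zero[OF a] V(1) by (metis DiffE last_state.simps(2) mult_zero_left)
    qed (use fin_S X in auto)
    also have "\<dots> = (\<Sum>s\<in>X. pmf (\<pi> h) a * K ?s a s * iterate_mass (policy_step \<nu>) X t s)"
    proof (rule sum.cong)
      fix s assume "s \<in> X"
      then show "pmf (\<pi> h) a * K ?s a s * surv \<pi> t (Snoc h a s) =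
          pmf (\<pi> h) a * K ?s a s * iterate_mass (policy_step \<nu>) X t s"
        using zero[OF a, of s] Suc.IH[of "Snoc h a s"] X by (cases "V (Snoc h a s)") auto
    qed simp
    finally show "(\<Sum>s\<in>S. pmf (\<pi> h) a * K ?s a s * surv \<pi> t (Snoc h a s)) =
        (\<Sum>s\<in>X. pmf (\<pi> h) a * K ?s a s * iterate_mass (policy_step \<nu>) X t s)" .
  qed
  also have "\<dots> = (\<Sum>s\<in>X. policy_step \<nu> ?s s * iterate_mass (policy_step \<nu>) X t s)"
    unfolding policy_step_def sum_distrib_right V(2)[OF Suc.prems] by (rule sum.swap)
  finally show ?case by simp
qed simp

lemma policy_step_nonneg: "s \<in> S \<Longrightarrow> s' \<in> S \<Longrightarrow> 0 \<le> policy_step \<nu> s s'"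
  unfolding policy_step_def by (intro sum_nonneg mult_nonneg_nonneg nonneg) auto

lemma sum_policy_step:
  "sum (policy_step \<nu> s) Y = (\<Sum>a\<in>A s. pmf (\<nu> s) a * sum (K s a) Y)"
  unfolding policy_step_def by (simp add: sum_distrib_left) (rule sum.swap)

lemma sum_policy_step_le_1:
  assumes "s \<in> S" "Y \<subseteq> S"
  shows "sum (policy_step \<nu> s) Y \<le> 1"
proof -
  have "sum (K s a) Y \<le> 1" if "a \<in> A s" for a
    using sum_mono2[OF fin_S assms(2), of "K s a"] nonneg[OF assms(1) that] total[OF assms(1) that]
    by fastforce
  then have "sum (policy_step \<nu> s) Y \<le> (\<Sum>a\<in>A s. pmf (\<nu> s) a)"
    unfolding sum_policy_step by (intro sum_mono mult_left_le) auto
  also have "\<dots> \<le> 1" using assms by (intro sum_pmf_le_1 fin_A)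
  finally show ?thesis .
qed

lemma survival_memoryless_tendsto_0:
  assumes X: "X \<subseteq> S"
    and V: "\<And>h. V h \<Longrightarrow> last_state h \<in> X" "\<And>h. V h \<Longrightarrow> \<pi> h = \<nu> (last_state h)"
      "\<And>h a s. V h \<Longrightarrow> a \<in> A (last_state h) \<Longrightarrow> s \<in> S \<Longrightarrow> 0 < pmf (\<pi> h) a \<Longrightarrow>
        0 < K (last_state h) a s \<Longrightarrow> V (Snoc h a s)"
    and leak: "\<And>Y. Y \<subseteq> X \<Longrightarrow> Y \<noteq> {} \<Longrightarrow> \<exists>s\<in>Y. sum (policy_step \<nu> s) Y < 1"
    and h: "V h"
  shows "(\<lambda>t. surv \<pi> t h) \<longlonglongrightarrow> 0"
proof -
  have "(\<lambda>t. iterate_mass (policy_step \<nu>) X t (last_state h)) \<longlonglongrightarrow> 0"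
    using X fin_S V(1)[OF h] leak
    by (intro iterate_mass_tendsto_0 policy_step_nonneg sum_policy_step_le_1)
      (auto dest: finite_subset)
  moreover have "surv \<pi> t h = iterate_mass (policy_step \<nu>) X t (last_state h)" for t
    by (rule survival_memoryless[of X V]) (use X V h in auto)
  ultimately show ?thesis by simp
qed

end

section \<open>Almost sure reachability in finite MDPs\<close>

locale finite_mdp =
  fixes N :: "('s, 'a) mdp"
  assumes fin_states: "finite (states N)" and init_state: "init N \<in> states N"
    and fin_actions: "\<And>s. s \<in> states N \<Longrightarrow> finite (actions N s)"
    and actions_nonempty: "\<And>s. s \<in> states N \<Longrightarrow> actions N s \<noteq> {}"
    and supp: "\<And>s a. s \<in> states N \<Longrightarrow> a \<in> actions N s \<Longrightarrow> set_pmf (kernel N s a) \<subseteq> states N"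
begin

lemma is_history_last_state: "is_history N h \<Longrightarrow> last_state h \<in> states N"
  by (induction h) (use init_state supp in auto)

lemma histories_subset_paths: "histories N t \<subseteq> paths (states N) (actions N) (init N) t"
proof -
  have "is_history N h \<Longrightarrow> h \<in> paths (states N) (actions N) (init N) (steps h)" for h
  proof (induction h)
    case (Snoc h a s)
    then show ?case
      using is_history_last_state[OF Snoc.prems] by (simp only: steps.simps Snoc_in_paths_iff) simp
  qed simp
  then show ?thesis by (auto simp: histories_def)
qed

lemma finite_mdp_init: "s \<in> states N \<Longrightarrow> finite_mdp (N\<lparr>init := s\<rparr>)"
  by unfold_locales (use fin_states fin_actions actions_nonempty supp in auto)

text \<open>
  Mass that enters \<open>T\<close> is lost, so that survival is the probability of having avoided \<open>T\<close>.
\<close>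

definition kill :: "'s set \<Rightarrow> 's \<Rightarrow> 'a \<Rightarrow> 's \<Rightarrow> real" where
  "kill T s a s' = (if s' \<in> T then 0 else pmf (kernel N s a) s')"

lemma substochastic_kill: "substochastic (states N) (actions N) (kill T)"
proof
  fix s a
  assume "s \<in> states N" "a \<in> actions N s"
  have "sum (kill T s a) (states N) \<le> sum (pmf (kernel N s a)) (states N)"
    by (intro sum_mono) (simp add: kill_def)
  also have "\<dots> \<le> 1" using fin_states by (rule sum_pmf_le_1)
  finally show "sum (kill T s a) (states N) \<le> 1" .
qed (use fin_states fin_actions in \<open>auto simp: kill_def\<close>)

sublocale killed: substochastic "states N" "actions N" "kill T" for T
  by (rule substochastic_kill)

lemma hist_prob_nonneg: "0 \<le> hist_prob N \<pi> h"
  by (induction h) auto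

lemma hist_prob_eq_0: "\<not> is_history N h \<Longrightarrow> is_policy N \<pi> \<Longrightarrow> hist_prob N \<pi> h = 0"
  by (induction h) (auto simp: is_policy_def set_pmf_iff subset_iff)

lemma finite_histories: "finite (histories N t)"
  using histories_subset_paths killed.finite_paths[OF init_state] by (rule finite_subset)

lemma hist_prob_avoid:
  assumes "h \<in> paths (states N) (actions N) (init N) t" "init N \<notin> T"
  shows "weight (kill T) \<pi> h = (if visited h \<inter> T = {} then hist_prob N \<pi> h else 0)"
  using assms(1)
proof (induction t arbitrary: h)
  case (Suc t)
  then obtain h' a s where h: "h = Snoc h' a s" and h': "h' \<in> paths (states N) (actions N) (init N) t"
    by auto
  show ?case using Suc.IH[OF h'] by (auto simp: h kill_def)
qed (use assms(2) in auto)

lemma sum_hist_prob_avoid: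
  assumes "init N \<notin> T" "is_policy N \<pi>"
  shows "(\<Sum>h\<in>{h \<in> histories N t. visited h \<inter> T = {}}. hist_prob N \<pi> h) =
    survival (states N) (actions N) (kill T) \<pi> t (Start (init N))"
proof -
  let ?P = "paths (states N) (actions N) (init N) t"
  have "(\<Sum>h\<in>{h \<in> histories N t. visited h \<inter> T = {}}. hist_prob N \<pi> h) =
      (\<Sum>h\<in>{h \<in> ?P. visited h \<inter> T = {}}. hist_prob N \<pi> h)"
  proof (rule sum.mono_neutral_left)
    show "\<forall>h\<in>{h \<in> ?P. visited h \<inter> T = {}} - {h \<in> histories N t. visited h \<inter> T = {}}. hist_prob N \<pi> h = 0"
      using assms(2) by (auto simp: histories_def paths_steps intro!: hist_prob_eq_0)
  qed (use histories_subset_paths killed.finite_paths[OF init_state] in auto)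
  also have "\<dots> = (\<Sum>h\<in>?P. weight (kill T) \<pi> h)"
    using killed.finite_paths[OF init_state]
    by (simp add: hist_prob_avoid[OF _ assms(1)] sum.inter_filter)
  also have "\<dots> = survival (states N) (actions N) (kill T) \<pi> t (Start (init N))"
    by (rule killed.sum_weight[OF init_state])
  finally show ?thesis .
qed

text \<open>
  With no target nothing is ever lost. This is what makes history probabilities sum to one.
\<close>

lemma survival_kill_empty:
  assumes "is_policy N \<pi>" "is_history N h"
  shows "survival (states N) (actions N) (kill {}) \<pi> t h = 1"
  using assms(2)
proof (induction t arbitrary: h)
  case (Suc t)
  let ?s = "last_state h"
  have s: "?s \<in> states N" by (rule is_history_last_state[OF Suc.prems])
  have "(\<Sum>s\<in>states N. kill {} ?s a s * survival (states N) (actions N) (kill {}) \<pi> t (Snoc h a s)) = 1"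
    if a: "a \<in> actions N ?s" for a
  proof -
    have "(\<Sum>s\<in>states N. kill {} ?s a s * survival (states N) (actions N) (kill {}) \<pi> t (Snoc h a s)) =
        sum (pmf (kernel N ?s a)) (states N)"
    proof (rule sum.cong[OF refl])
      fix s
      show "kill {} ?s a s * survival (states N) (actions N) (kill {}) \<pi> t (Snoc h a s) =
          pmf (kernel N ?s a) s"
      proof (cases "s \<in> set_pmf (kernel N ?s a)")
        case True
        then have "survival (states N) (actions N) (kill {}) \<pi> t (Snoc h a s) = 1"
          using Suc.prems a by (intro Suc.IH) simp
        then show ?thesis by (simp only: kill_def) simp
      qed (simp add: kill_def set_pmf_iff)
    qed
    then show ?thesis using sum_pmf_eq_1[OF fin_states supp[OF s a]] by simp
  qed
  then have "survival (states N) (actions N) (kill {}) \<pi> (Suc t) h = (\<Sum>a\<in>actions N ?s. pmf (\<pi> h) a)"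
    by simp
  also have "\<dots> = 1"
    using assms(1) Suc.prems by (intro sum_pmf_eq_1 fin_actions s) (auto simp: is_policy_def)
  finally show ?case .
qed simp

lemma sum_hist_prob: "is_policy N \<pi> \<Longrightarrow> (\<Sum>h\<in>histories N t. hist_prob N \<pi> h) = 1"
  using sum_hist_prob_avoid[of "{}" \<pi> t] survival_kill_empty[of \<pi> "Start (init N)" t] by simp

lemma sum_reach_eq:
  assumes "is_policy N \<pi>"
  shows "(\<Sum>h\<in>{h \<in> histories N t. visited h \<inter> T \<noteq> {}}. hist_prob N \<pi> h) =
    1 - (\<Sum>h\<in>{h \<in> histories N t. visited h \<inter> T = {}}. hist_prob N \<pi> h)"
proof -
  have "(\<Sum>h\<in>histories N t. hist_prob N \<pi> h) =
    (\<Sum>h\<in>{h \<in> histories N t. visited h \<inter> T \<noteq> {}}. hist_prob N \<pi> h) +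
    (\<Sum>h\<in>{h \<in> histories N t. visited h \<inter> T = {}}. hist_prob N \<pi> h)"
    using finite_histories by (subst sum.union_disjoint[symmetric]) (auto intro!: sum.cong)
  then show ?thesis using sum_hist_prob[OF assms] by simp
qed

lemma sum_reach_le_1:
  assumes "is_policy N \<pi>"
  shows "(\<Sum>h\<in>{h \<in> histories N t. visited h \<inter> T \<noteq> {}}. hist_prob N \<pi> h) \<le> 1"
  unfolding sum_reach_eq[OF assms] by (simp add: sum_nonneg hist_prob_nonneg)

lemma reach_prob_le_1: "is_policy N \<pi> \<Longrightarrow> reach_prob N \<pi> T \<le> 1"
  unfolding reach_prob_def by (intro cSUP_least sum_reach_le_1) auto

lemma avoid_small:
  assumes "is_policy N \<pi>" "reach_prob N \<pi> T = 1" "0 < \<epsilon>"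
  shows "\<exists>t. (\<Sum>h\<in>{h \<in> histories N t. visited h \<inter> T = {}}. hist_prob N \<pi> h) < \<epsilon>"
proof (rule ccontr)
  assume "\<not> ?thesis"
  then have "(\<Sum>h\<in>{h \<in> histories N t. visited h \<inter> T \<noteq> {}}. hist_prob N \<pi> h) \<le> 1 - \<epsilon>" for t
    unfolding sum_reach_eq[OF assms(1)] by (simp add: not_less)
  then have "reach_prob N \<pi> T \<le> 1 - \<epsilon>"
    unfolding reach_prob_def by (intro cSUP_least) auto
  then show False using assms by simp
qed

lemma reach_prob_eq_1I:
  assumes "is_policy N \<pi>"
    and lim: "(\<lambda>t. \<Sum>h\<in>{h \<in> histories N t. visited h \<inter> T = {}}. hist_prob N \<pi> h) \<longlonglongrightarrow> 0"
  shows "reach_prob N \<pi> T = 1"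
proof (rule antisym)
  show "reach_prob N \<pi> T \<le> 1" by (rule reach_prob_le_1[OF assms(1)])
  have "(\<lambda>t. \<Sum>h\<in>{h \<in> histories N t. visited h \<inter> T \<noteq> {}}. hist_prob N \<pi> h) \<longlonglongrightarrow> 1 - 0"
    unfolding sum_reach_eq[OF assms(1)] by (intro tendsto_diff tendsto_const lim)
  moreover have "bdd_above (range (\<lambda>t. \<Sum>h\<in>{h \<in> histories N t. visited h \<inter> T \<noteq> {}}. hist_prob N \<pi> h))"
    using sum_reach_le_1[OF assms(1)] by (intro bdd_aboveI[of _ 1]) auto
  then have "(\<Sum>h\<in>{h \<in> histories N t. visited h \<inter> T \<noteq> {}}. hist_prob N \<pi> h) \<le> reach_prob N \<pi> T" for t
    unfolding reach_prob_def by (intro cSUP_upper) auto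
  ultimately show "1 \<le> reach_prob N \<pi> T" by (intro LIMSEQ_le_const2[of _ 1]) auto
qed

text \<open>
  A policy that reaches \<open>T\<close> almost surely makes the mass avoiding \<open>T\<close> arbitrarily small, so it
  cannot start where a positive fraction of mass always survives.
\<close>

lemma init_not_persistent:
  assumes B: "killed.persistent T B" and T: "init N \<notin> T"
    and \<pi>: "is_policy N \<pi>" "reach_prob N \<pi> T = 1"
  shows "init N \<notin> B"
proof
  assume i: "init N \<in> B"
  obtain \<epsilon> where \<epsilon>: "0 < \<epsilon>" and low: "\<And>\<pi> V t h. killed.proper T \<pi> V \<Longrightarrow> V h \<Longrightarrow> last_state h \<in> B \<Longrightarrow>
      \<epsilon> \<le> survival (states N) (actions N) (kill T) \<pi> t h"
    using B unfolding killed.persistent_def by blast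
  have V: "killed.proper T \<pi> (is_history N)"
    unfolding killed.proper_def using \<pi>(1) is_history_last_state
    by (auto simp: is_policy_def kill_def set_pmf_iff split: if_splits)
  obtain t where "(\<Sum>h\<in>{h \<in> histories N t. visited h \<inter> T = {}}. hist_prob N \<pi> h) < \<epsilon>"
    using avoid_small[OF \<pi> \<epsilon>] by blast
  then show False using low[OF V, of "Start (init N)" t] i by (simp add: sum_hist_prob_avoid[OF T \<pi>(1)])
qed

lemma can_reach_step:
  assumes "s \<in> R" "a \<in> actions N s" "set_pmf (kernel N s a) \<subseteq> R" "s' \<in> set_pmf (kernel N s a)"
    "can_reach N T R s'"
  shows "can_reach N T R s"
  using assms unfolding can_reach_def
  by (metis (mono_tags, lifting) case_prodI converse_rtrancl_into_rtrancl mem_Collect_eq staying_edges_def)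

text \<open>
  The pruning step. At a state of \<open>R\<close> that cannot reach \<open>T\<close> by staying actions, a staying action
  leads only to states of the same kind, so it never enters \<open>T\<close> and loses nothing; any other action
  moves with positive probability out of \<open>R\<close>, where mass survives already.
\<close>

lemma persistent_cannot_reach:
  assumes "T \<subseteq> R" "R \<subseteq> states N" "killed.persistent T (states N - R)"
  shows "killed.persistent T (states N - {s \<in> R. can_reach N T R s})"
proof -
  let ?Z = "{s \<in> R. \<not> can_reach N T R s}"
  have "killed.persistent T ((states N - R) \<union> ?Z)"
  proof (rule killed.persistent_extend)
    fix s a
    assume s: "s \<in> ?Z" and a: "a \<in> actions N s"
    show "(\<exists>s'\<in>states N - R. 0 < kill T s a s') \<or> 1 \<le> sum (kill T s a) ?Z"
    proof (cases "set_pmf (kernel N s a) \<subseteq> R")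
      case False
      then obtain s' where "s' \<in> set_pmf (kernel N s a)" "s' \<notin> R" by auto
      then show ?thesis using assms supp[of s a] s a
        by (intro disjI1 bexI[of _ s']) (auto simp: kill_def pmf_positive)
    next
      case True
      have "set_pmf (kernel N s a) \<subseteq> ?Z" using can_reach_step[OF _ a True] s True by auto
      moreover have "?Z \<inter> T = {}" by (auto simp: can_reach_def)
      ultimately have "sum (kill T s a) ?Z = sum (pmf (kernel N s a)) ?Z"
        by (intro sum.cong) (auto simp: kill_def)
      also have "\<dots> = 1"
        using \<open>set_pmf (kernel N s a) \<subseteq> ?Z\<close> assms(2) finite_subset[OF _ fin_states, of ?Z]
        by (intro sum_pmf_eq_1) auto
      finally show ?thesis by simp
    qed
  qed (use assms in auto)
  moreover have "(states N - R) \<union> ?Z = states N - {s \<in> R. can_reach N T R s}" using assms by auto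
  ultimately show ?thesis by simp
qed

text \<open>
  The states visited before \<open>T\<close> form a finite chain. Any set \<open>Y\<close> of them has a path to \<open>T\<close>, so mass
  leaves \<open>Y\<close>, and the surviving mass vanishes in the limit.
\<close>

lemma selector_reach_prob:
  assumes f: "\<And>s. s \<in> states N \<Longrightarrow> f s \<in> actions N s" and ok: "selector_ok N T f"
  shows "reach_prob N (\<lambda>h. return_pmf (f (last_state h))) T = 1"
proof (rule reach_prob_eq_1I)
  let ?\<pi> = "\<lambda>h. return_pmf (f (last_state h))"
  show \<pi>: "is_policy N ?\<pi>" using f is_history_last_state by (auto simp: is_policy_def)
  show "(\<lambda>t. \<Sum>h\<in>{h \<in> histories N t. visited h \<inter> T = {}}. hist_prob N ?\<pi> h) \<longlonglongrightarrow> 0"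
  proof (cases "init N \<in> T")
    case True
    have "is_history N h \<Longrightarrow> init N \<in> visited h" for h by (induction h) auto
    then have "{h \<in> histories N t. visited h \<inter> T = {}} = {}" for t
      using True by (auto simp: histories_def)
    then show ?thesis by (simp only: sum.empty tendsto_const)
  next
    case False
    define X where "X = {s \<in> states N - T. (init N, s) \<in> (selector_edges N T f)\<^sup>*}"
    have "(\<lambda>t. survival (states N) (actions N) (kill T) ?\<pi> t (Start (init N))) \<longlonglongrightarrow> 0"
    proof (rule killed.survival_memoryless_tendsto_0[where V = "\<lambda>h. last_state h \<in> X" and X = X
          and \<nu> = "\<lambda>s. return_pmf (f s)"])
      fix h :: "('s, 'a) hist" and a s
      assume *: "last_state h \<in> X" "s \<in> states N" "0 < pmf (return_pmf (f (last_state h))) a"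
        "0 < kill T (last_state h) a s"
      then have "a = f (last_state h)" by (simp add: indicator_def split: if_splits)
      then have "(last_state h, s) \<in> selector_edges N T f" "s \<notin> T"
        using * by (auto simp: selector_edges_def X_def kill_def set_pmf_iff split: if_splits)
      then show "last_state (Snoc h a s) \<in> X" using * by (auto simp: X_def)
    next
      fix Y assume Y: "Y \<subseteq> X" "Y \<noteq> {}"
      then obtain y where y: "y \<in> Y" by auto
      then have "(init N, y) \<in> (selector_edges N T f)\<^sup>*" using Y by (auto simp: X_def)
      then obtain z where "z \<in> T" "(y, z) \<in> (selector_edges N T f)\<^sup>*"
        using ok by (auto simp: selector_ok_def)
      moreover have "z \<notin> Y" using \<open>z \<in> T\<close> Y by (auto simp: X_def)
      ultimately obtain u v where uv: "(u, v) \<in> selector_edges N T f" "u \<in> Y" "v \<notin> Y"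
        using rtrancl_exit[of y z "selector_edges N T f" Y] y by auto
      have Yf: "finite Y" using Y fin_states by (auto simp: X_def dest: finite_subset)
      have u: "u \<in> states N" "f u \<in> actions N u" using uv Y f by (auto simp: X_def)
      have "sum (killed.policy_step T (\<lambda>s. return_pmf (f s)) u) Y = sum (kill T u (f u)) Y"
        unfolding killed.sum_policy_step using u fin_actions[OF u(1)]
        by (subst sum.remove[of _ "f u"]) (auto intro!: sum.neutral)
      also have "\<dots> \<le> sum (pmf (kernel N u (f u))) Y" by (intro sum_mono) (simp add: kill_def)
      also have "\<dots> < sum (pmf (kernel N u (f u))) (insert v Y)"
        using uv Yf by (simp add: selector_edges_def pmf_positive)
      also have "\<dots> \<le> 1" using Yf by (intro sum_pmf_le_1) auto
      finally show "\<exists>s\<in>Y. sum (killed.policy_step T (\<lambda>s. return_pmf (f s)) s) Y < 1" using uv by auto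
    qed (use False init_state in \<open>auto simp: X_def\<close>)
    then show ?thesis unfolding sum_hist_prob_avoid[OF False \<pi>] .
  qed
qed

text \<open>
  Choose in every state of \<open>R\<close> outside \<open>T\<close> a staying action with a successor closer to \<open>T\<close> in the
  graph of staying transitions. The choice does not depend on the initial state, so the same
  selector serves all of \<open>R\<close>.
\<close>

lemma selector_exists:
  assumes R: "R \<subseteq> states N" and reach: "\<And>s. s \<in> R \<Longrightarrow> can_reach N T R s"
  obtains f where "f \<in> selector_candidates N T R"
    "\<And>s. s \<in> R \<Longrightarrow> selector_ok (N\<lparr>init := s\<rparr>) T f"
proof -
  let ?E = "staying_edges N R"
  define dist where "dist s = (LEAST n. \<exists>t\<in>T. (s, t) \<in> ?E ^^ n)" for s
  have closer: "\<exists>a\<in>actions N s. set_pmf (kernel N s a) \<subseteq> R \<and> (\<exists>s'\<in>set_pmf (kernel N s a). dist s' < dist s)"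
    if s: "s \<in> R - T" for s
  proof -
    have "\<exists>n. \<exists>t\<in>T. (s, t) \<in> ?E ^^ n"
      using reach[of s] s by (auto simp: can_reach_def rtrancl_power)
    then have "\<exists>t\<in>T. (s, t) \<in> ?E ^^ dist s" unfolding dist_def by (rule LeastI_ex)
    then obtain t where t: "t \<in> T" "(s, t) \<in> ?E ^^ dist s" by blast
    then obtain n where n: "dist s = Suc n" using s by (cases "dist s") auto
    obtain s' where s': "(s, s') \<in> ?E" "(s', t) \<in> ?E ^^ n"
      using t(2) unfolding n by (meson relpow_Suc_D2)
    have "dist s' \<le> n" unfolding dist_def using t s' by (intro Least_le) auto
    then have "dist s' < dist s" using n by simp
    then show ?thesis using s'(1) unfolding staying_edges_def by blast
  qed
  define f where "f s = (if s \<notin> states N then undefined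
     else if s \<in> R - T then SOME a. a \<in> actions N s \<and> set_pmf (kernel N s a) \<subseteq> R \<and>
       (\<exists>s'\<in>set_pmf (kernel N s a). dist s' < dist s)
     else SOME a. a \<in> actions N s)" for s
  have fR: "f s \<in> actions N s \<and> set_pmf (kernel N s (f s)) \<subseteq> R \<and>
      (\<exists>s'\<in>set_pmf (kernel N s (f s)). dist s' < dist s)" if "s \<in> R - T" for s
  proof -
    have "f s = (SOME a. a \<in> actions N s \<and> set_pmf (kernel N s a) \<subseteq> R \<and>
       (\<exists>s'\<in>set_pmf (kernel N s a). dist s' < dist s))"
      using that R by (auto simp: f_def)
    moreover have "\<exists>a. a \<in> actions N s \<and> set_pmf (kernel N s a) \<subseteq> R \<and>
       (\<exists>s'\<in>set_pmf (kernel N s a). dist s' < dist s)"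
      using closer[OF that] by blast
    ultimately show ?thesis by (simp only:) (rule someI_ex)
  qed
  have fA: "f s \<in> actions N s" if "s \<in> states N" for s
    using fR[of s] actions_nonempty[OF that] that by (cases "s \<in> R - T") (auto simp: f_def some_in_eq)
  show thesis
  proof (rule that[of f])
    show "f \<in> selector_candidates N T R"
      using fA fR by (auto simp: selector_candidates_def PiE_def extensional_def f_def)
    fix s assume s: "s \<in> R"
    let ?F = "selector_edges N T f"
    have stay: "x \<in> R" if "(s, x) \<in> ?F\<^sup>*" for x
      using that by (induction rule: rtrancl_induct) (use s fR in \<open>auto simp: selector_edges_def\<close>)
    have hit: "\<exists>t\<in>T. (x, t) \<in> ?F\<^sup>*" if "x \<in> R" for x
      using that
    proof (induction "dist x" arbitrary: x rule: less_induct)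
      case less
      show ?case
      proof (cases "x \<in> T")
        case False
        then obtain y where y: "y \<in> set_pmf (kernel N x (f x))" "dist y < dist x" "y \<in> R"
          using fR[of x] less.prems by auto
        then have "(x, y) \<in> ?F" using False less.prems R by (auto simp: selector_edges_def)
        then show ?thesis using less.hyps[OF y(2,3)] by (meson converse_rtrancl_into_rtrancl)
      qed auto
    qed
    show "selector_ok (N\<lparr>init := s\<rparr>) T f"
      using stay hit by (simp add: selector_ok_def selector_edges_def)
  qed
qed

lemma subset_Rmax:
  assumes R: "R \<subseteq> states N" and reach: "\<And>s. s \<in> R \<Longrightarrow> can_reach N T R s"
  shows "R \<subseteq> Rmax N T"
proof
  fix s assume s: "s \<in> R"
  obtain f where f: "f \<in> selector_candidates N T R" "selector_ok (N\<lparr>init := s\<rparr>) T f"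
    using selector_exists[OF R reach] s by metis
  interpret N': finite_mdp "N\<lparr>init := s\<rparr>" using s R by (intro finite_mdp_init) auto
  have fA: "f s \<in> actions N s" if "s \<in> states N" for s
    using f(1) that by (auto simp: selector_candidates_def)
  let ?\<pi> = "\<lambda>h. return_pmf (f (last_state h))"
  have "is_policy (N\<lparr>init := s\<rparr>) ?\<pi>"
    using fA N'.is_history_last_state by (auto simp: is_policy_def)
  moreover have "reach_prob (N\<lparr>init := s\<rparr>) ?\<pi> T = 1"
    using fA f(2) by (intro N'.selector_reach_prob) auto
  ultimately show "s \<in> Rmax N T"
    using s R N'.reach_prob_le_1 unfolding Rmax_def is_maximum_def by (fastforce intro: exI[of _ ?\<pi>])
qed

lemma Rmax_disjoint_persistent:
  assumes "killed.persistent T B" "B \<inter> T = {}"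
  shows "B \<inter> Rmax N T = {}"
proof -
  have False if s: "s \<in> B" "s \<in> Rmax N T" for s
  proof -
    interpret N': finite_mdp "N\<lparr>init := s\<rparr>" using s by (intro finite_mdp_init) (simp add: Rmax_def)
    obtain \<pi> where \<pi>: "is_policy (N\<lparr>init := s\<rparr>) \<pi>" "reach_prob (N\<lparr>init := s\<rparr>) \<pi> T = 1"
      using s(2) by (auto simp: Rmax_def is_maximum_def)
    have "N'.kill T = kill T" by (intro ext) (simp add: N'.kill_def kill_def)
    then have "N'.killed.persistent T B" using assms(1) by simp
    then show False using N'.init_not_persistent[of T B \<pi>] \<pi> s assms(2) by auto
  qed
  then show ?thesis by auto
qed

text \<open>
  The certificate left behind by pruning: whatever was removed fails to reach \<open>T\<close>, and whatever is
  left succeeds.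
\<close>

lemma Rmax_eqI:
  assumes "T \<subseteq> R" "R \<subseteq> states N" "killed.persistent T (states N - R)"
    and "\<And>s. s \<in> R \<Longrightarrow> can_reach N T R s"
  shows "Rmax N T = R"
proof
  show "Rmax N T \<subseteq> R"
    using Rmax_disjoint_persistent[OF assms(3)] assms(1) by (auto simp: Rmax_def)
  show "R \<subseteq> Rmax N T" by (rule subset_Rmax[OF assms(2,4)])
qed

end

section \<open>End components\<close>

text \<open>
  The set of states reachable from \<open>x\<close>, with \<open>x\<close> chosen so that it is as small as possible: every
  state in it then reaches all of it.
\<close>

lemma bottom_class_exists:
  assumes "finite Z" "Z \<noteq> {}" and closed: "\<And>x y. x \<in> Z \<Longrightarrow> (x, y) \<in> E \<Longrightarrow> y \<in> Z"
  shows "\<exists>X\<subseteq>Z. X \<noteq> {} \<and> (\<forall>x\<in>X. \<forall>y. (x, y) \<in> E \<longrightarrow> y \<in> X) \<and>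
    (\<forall>x\<in>X. \<forall>y\<in>X. (x, y) \<in> E\<^sup>*)"
proof -
  let ?r = "\<lambda>x. {y. (x, y) \<in> E\<^sup>*}"
  have sub: "?r x \<subseteq> Z" if "x \<in> Z" for x
  proof
    fix y assume "y \<in> ?r x"
    then have "(x, y) \<in> E\<^sup>*" by simp
    then show "y \<in> Z" by (induction rule: rtrancl_induct) (use that closed in auto)
  qed
  obtain x where x: "x \<in> Z" "\<And>y. y \<in> Z \<Longrightarrow> card (?r x) \<le> card (?r y)"
    using ex_has_least_nat[of "\<lambda>x. x \<in> Z" _ "\<lambda>x. card (?r x)"] assms(2) by blast
  have eq: "?r y = ?r x" if "y \<in> ?r x" for y
  proof (rule card_subset_eq)
    show "finite (?r x)" using sub[OF x(1)] assms(1) by (rule finite_subset)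
    show le: "?r y \<subseteq> ?r x" using that by auto
    show "card (?r y) = card (?r x)"
      using card_mono[OF \<open>finite (?r x)\<close> le] x(2)[of y] that sub[OF x(1)] by fastforce
  qed
  have "(y, z) \<in> E\<^sup>*" if "y \<in> ?r x" "z \<in> ?r x" for y z
    using eq[OF that(1)] that(2) by blast
  then show ?thesis
    using sub[OF x(1)] by (intro exI[of _ "?r x"]) (auto intro: rtrancl_into_rtrancl)
qed

lemma component_edges_mono:
  "X \<subseteq> X' \<Longrightarrow> (\<And>s. s \<in> X \<Longrightarrow> U s \<subseteq> U' s) \<Longrightarrow>
    component_edges N (X, U) \<subseteq> component_edges N (X', U')"
  by (auto simp: component_edges_def)

lemma end_component_rtrancl:
  "end_component N (X, U) \<Longrightarrow> x \<in> X \<Longrightarrow> y \<in> X \<Longrightarrow> (x, y) \<in> (component_edges N (X, U))\<^sup>*"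
  by (cases "x = y") (auto simp: end_component_def intro: trancl_into_rtrancl)

text \<open>
  Two end components with a common state \<open>z\<close> are strongly connected through \<open>z\<close>.
\<close>

lemma end_component_union:
  assumes C: "end_component N (X, U)" "end_component N (X', U')" and z: "z \<in> X \<inter> X'"
  shows "end_component N (X \<union> X', \<lambda>s. U s \<union> U' s)"
proof -
  let ?E = "component_edges N (X \<union> X', \<lambda>s. U s \<union> U' s)"
  have cand: "(X, U) \<in> component_candidates N" "(X', U') \<in> component_candidates N"
    using C by (auto simp: end_component_def)
  have E: "component_edges N (X, U) \<subseteq> ?E" "component_edges N (X', U') \<subseteq> ?E"
    by (rule component_edges_mono; blast)+
  have "(x, z) \<in> ?E\<^sup>* \<and> (z, x) \<in> ?E\<^sup>*" if "x \<in> X \<union> X'" for x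
    using that z end_component_rtrancl[OF C(1)] end_component_rtrancl[OF C(2)]
      rtrancl_mono[OF E(1)] rtrancl_mono[OF E(2)] by blast
  then have path: "(x, y) \<in> ?E\<^sup>*" if "x \<in> X \<union> X'" "y \<in> X \<union> X'" for x y
    using that by (meson rtrancl_trans)
  have closed: "set_pmf (kernel N s u) \<subseteq> X \<union> X'" if "s \<in> X \<union> X'" "u \<in> U s \<union> U' s" for s u
  proof -
    have "s \<in> X \<and> u \<in> U s \<or> s \<in> X' \<and> u \<in> U' s"
      using that cand by (auto simp: component_candidates_def)
    moreover have "\<forall>s\<in>X. \<forall>u\<in>U s. set_pmf (kernel N s u) \<subseteq> X"
      "\<forall>s\<in>X'. \<forall>u\<in>U' s. set_pmf (kernel N s u) \<subseteq> X'"
      using C by (simp_all add: end_component_def)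
    ultimately show ?thesis by blast
  qed
  have "(x, y) \<in> ?E\<^sup>+" if "x \<in> X \<union> X'" "y \<in> X \<union> X'" "x \<noteq> y" for x y
    using path[OF that(1,2)] that(3) by (simp add: rtrancl_eq_or_trancl)
  moreover have "(X \<union> X', \<lambda>s. U s \<union> U' s) \<in> component_candidates N"
  proof -
    have "U s \<subseteq> actions N s" "U' s \<subseteq> actions N s" for s
      using cand unfolding component_candidates_def by (cases "s \<in> X"; cases "s \<in> X'"; auto)+
    then show ?thesis using cand by (auto simp: component_candidates_def)
  qed
  ultimately show ?thesis using closed z by (auto simp: end_component_def)
qed

text \<open>
  Hence the policy of a MEC is determined by any state of it, and policies attached to different
  MECs never conflict.
\<close>

lemma is_MEC_unique:
  assumes C: "is_MEC N (X, U)" "is_MEC N (X', U')" and z: "z \<in> X" "z \<in> X'"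
  shows "(X, U) = (X', U')"
proof -
  let ?C = "(X \<union> X', \<lambda>s. U s \<union> U' s)"
  have "end_component N ?C"
    using C z by (intro end_component_union[of _ _ _ _ _ z]) (auto simp: is_MEC_def)
  moreover from this have "?C = (X, U)" using C(1) unfolding is_MEC_def by fastforce
  moreover from calculation(1) have "?C = (X', U')" using C(2) unfolding is_MEC_def by fastforce
  ultimately show ?thesis by simp
qed

context finite_mdp
begin

lemma finite_component_candidates: "finite (component_candidates N)"
proof (rule finite_subset)
  let ?A = "\<Union>s\<in>states N. actions N s"
  show "component_candidates N \<subseteq>
    Pow (states N) \<times> {U. \<forall>s. (s \<in> states N \<longrightarrow> U s \<in> Pow ?A) \<and> (s \<notin> states N \<longrightarrow> U s = {})}"
    by (auto simp: component_candidates_def) blast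
  show "finite (Pow (states N) \<times>
      {U. \<forall>s. (s \<in> states N \<longrightarrow> U s \<in> Pow ?A) \<and> (s \<notin> states N \<longrightarrow> U s = {})})"
    using fin_states fin_actions
    by (intro finite_cartesian_product finite_set_of_finite_funs) auto
qed

lemma end_component_in_MEC:
  assumes "end_component N (X, U)"
  obtains X' U' where "is_MEC N (X', U')" "X \<subseteq> X'" "\<And>s. s \<in> X \<Longrightarrow> U s \<subseteq> U' s"
proof -
  \<comment> \<open>turns the order of components, states and actions together, into inclusion of finite sets\<close>
  define encode :: "('s, 'a) component \<Rightarrow> ('s + 's \<times> 'a) set"
    where "encode = (\<lambda>(X, U). X <+> (SIGMA s:X. U s))"
  let ?\<C> = "{C. end_component N C}"
  have "?\<C> \<subseteq> component_candidates N" by (auto simp: end_component_def)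
  then have "finite (encode ` ?\<C>)" using finite_component_candidates finite_subset by blast
  moreover have "encode (X, U) \<in> encode ` ?\<C>" using assms by simp
  ultimately obtain m where m: "m \<in> encode ` ?\<C>" "encode (X, U) \<subseteq> m" "\<And>c. c \<in> encode ` ?\<C> \<Longrightarrow> m \<subseteq> c \<Longrightarrow> m = c"
    using finite_has_maximal2[of "encode ` ?\<C>" "encode (X, U)"] by metis
  obtain X' U' where C': "end_component N (X', U')" "m = encode (X', U')"
    using m(1) by auto
  have le: "encode (X, U) \<subseteq> encode (X', U') \<longleftrightarrow> X \<subseteq> X' \<and> (\<forall>s\<in>X. U s \<subseteq> U' s)" for X U X' U'
    by (auto simp: encode_def)
  have "(X'', U'') = (X', U')"
    if "end_component N (X'', U'')" "X' \<subseteq> X''" "\<forall>s\<in>X'. U' s \<subseteq> U'' s" for X'' U''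
  proof -
    have "encode (X', U') = encode (X'', U'')"
      using m(3)[of "encode (X'', U'')"] that C' le[of X' U' X'' U''] by auto
    then have *: "X' = X''" "\<And>s. s \<in> X' \<Longrightarrow> U' s = U'' s"
      using le[of X' U' X'' U''] le[of X'' U'' X' U'] by blast+
    have "U' s = U'' s" for s
      using * that(1) C'(1) by (cases "s \<in> X'") (auto simp: end_component_def component_candidates_def)
    then show ?thesis using * by auto
  qed
  then have "is_MEC N (X', U')" using C'(1) unfolding is_MEC_def by auto
  then show thesis using that m(2) C' le by blast
qed

end

section \<open>Supports and components of the informative MDP\<close>

lemma mdp_of_simps [simp]:
  "states (mdp_of M i) = mstates M" "actions (mdp_of M i) = mactions M"
  "kernel (mdp_of M i) = mkernel M i" "init (mdp_of M i) = minit M"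
  by (simp_all add: mdp_of_def)

lemma mhistories_iff: "h \<in> mhistories M t \<longleftrightarrow> (\<exists>i. is_history (mdp_of M i) h) \<and> steps h = t"
proof -
  have "(\<exists>i. Q i) \<longleftrightarrow> Q One \<or> Q Two" for Q by (metis model.exhaust)
  then show ?thesis by (auto simp: mhistories_def histories_def)
qed

lemma finite_mdp_of: "binary_mmdp M \<Longrightarrow> finite_mdp (mdp_of M i)"
  by unfold_locales (auto simp: binary_mmdp_def mdp_of_def)

lemma is_policy_mdp_of: "is_mpolicy M \<pi> \<Longrightarrow> is_policy (mdp_of M i) \<pi>"
  by (cases i) (auto simp: is_mpolicy_def is_policy_def mhistories_def histories_def mdp_of_def)

lemma set_pmf_mixture:
  assumes "0 < \<gamma>" "\<gamma> < 1"
  shows "set_pmf (mixture \<gamma> p q) = set_pmf p \<union> set_pmf q"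
  using assms by (auto simp: mixture_def set_pmf_bernoulli split: if_splits)

text \<open>
  The choices made when an informative MDP is constructed.
\<close>

locale biapd_input =
  fixes M :: "('s, 'a) mmdp" and \<alpha> :: "'s \<Rightarrow> 'a" and \<gamma> :: real
  assumes M: "binary_mmdp M" and \<alpha>: "action_choice M \<alpha>" and \<gamma>: "0 < \<gamma>" "\<gamma> < 1"
begin

abbreviation "MI \<equiv> informative_mdp M \<alpha> \<gamma>"
abbreviation "T \<equiv> covered (informative_MECs M \<alpha> \<gamma>)"

lemma MI_simps [simp]:
  "states MI = Orig ` mstates M \<union> {Bot One, Bot Two}"
  "actions MI = pre_actions M \<alpha>"
  "init MI = Orig (minit M)"
  "kernel MI x u = mixture \<gamma> (pre_kernel M One x u) (pre_kernel M Two x u)"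
  by (simp_all add: informative_mdp_def preprocessed_def Let_def)

lemma finM: "finite (mstates M)" "s \<in> mstates M \<Longrightarrow> finite (mactions M s)"
  "s \<in> mstates M \<Longrightarrow> mactions M s \<noteq> {}" "minit M \<in> mstates M"
  "s \<in> mstates M \<Longrightarrow> a \<in> mactions M s \<Longrightarrow> set_pmf (mkernel M i s a) \<subseteq> mstates M"
  using M by (auto simp: binary_mmdp_def)

lemma supp_common: "common_support M s a \<subseteq> set_pmf (mkernel M i s a)"
  by (cases i) (auto simp: common_support_def)

lemma pre_actions_Orig:
  assumes "s \<in> mstates M" "u \<in> pre_actions M \<alpha> (Orig s)"
  obtains a where "u = Orig a" "a \<in> mactions M s" "revealing_state M s \<Longrightarrow> a = \<alpha> s"
proof -
  have "revealing_state M s \<Longrightarrow> \<alpha> s \<in> mactions M s"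
    using \<alpha> by (auto simp: action_choice_def revealing_pair_def)
  then show thesis using assms that by (auto split: if_splits)
qed

lemma common_nonempty:
  "\<not> revealing_state M s \<Longrightarrow> s \<in> mstates M \<Longrightarrow> a \<in> mactions M s \<Longrightarrow> common_support M s a \<noteq> {}"
  by (auto simp: revealing_state_def revealing_pair_def)

lemma kernels_eq:
  assumes "\<not> revealing_state M s" "s \<in> mstates M" "a \<in> mactions M s" "(s, a) \<notin> ISA M"
  shows "mkernel M i s a = mkernel M j s a"
proof -
  have "mkernel M One s a = mkernel M Two s a"
    using assms common_nonempty[OF assms(1-3)] by (auto simp: ISA_def)
  then show ?thesis by (cases i; cases j) auto
qed

text \<open>
  The preprocessed kernels of both models agree on which original successors are possible: exactly
  those in the common support, and none at a revealing state. All mass that reveals the model goes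
  to an absorbing state.
\<close>

lemma supp_pre_kernel:
  assumes "s \<in> mstates M" "a \<in> mactions M s"
  shows "set_pmf (pre_kernel M i (Orig s) (Orig a)) \<subseteq>
    (if revealing_state M s then {} else Orig ` common_support M s a) \<union> {Bot i}"
    "\<not> revealing_state M s \<Longrightarrow> Orig ` common_support M s a \<subseteq> set_pmf (pre_kernel M i (Orig s) (Orig a))"
proof -
  have eq: "set_pmf (mkernel M i s a) = common_support M s a"
    if "\<not> revealing_state M s" "(s, a) \<notin> ISA M"
    using kernels_eq[OF that(1) assms that(2), of One Two] kernels_eq[OF that(1) assms that(2), of i One]
    by (simp add: common_support_def)
  show "set_pmf (pre_kernel M i (Orig s) (Orig a)) \<subseteq>
    (if revealing_state M s then {} else Orig ` common_support M s a) \<union> {Bot i}"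
    using eq by auto
  show "Orig ` common_support M s a \<subseteq> set_pmf (pre_kernel M i (Orig s) (Orig a))"
    if "\<not> revealing_state M s"
    using eq[OF that] that supp_common[of s a i] by (auto simp: image_iff)
qed

lemma supp_MI_revealing:
  "revealing_state M s \<Longrightarrow> set_pmf (kernel MI (Orig s) (Orig a)) = {Bot One, Bot Two}"
  using \<gamma> by (auto simp: set_pmf_mixture)

lemma supp_MI_Bot: "set_pmf (kernel MI (Bot i) u) = {Bot i}"
  using \<gamma> by (auto simp: set_pmf_mixture)

lemma supp_MI_subset:
  "s \<in> mstates M \<Longrightarrow> a \<in> mactions M s \<Longrightarrow>
    set_pmf (kernel MI (Orig s) (Orig a)) \<subseteq> Orig ` common_support M s a \<union> {Bot One, Bot Two}"
  using supp_pre_kernel(1)[of s a] \<gamma> by (fastforce simp: set_pmf_mixture split: if_splits)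

lemma Orig_in_supp_MI_iff:
  assumes "s \<in> mstates M" "a \<in> mactions M s"
  shows "Orig s' \<in> set_pmf (kernel MI (Orig s) (Orig a)) \<longleftrightarrow>
    \<not> revealing_state M s \<and> s' \<in> common_support M s a"
proof (cases "revealing_state M s")
  case True
  then show ?thesis using supp_MI_revealing[OF True, of a] by (auto simp del: MI_simps(4))
next
  case False
  then have "Orig ` common_support M s a \<subseteq> set_pmf (kernel MI (Orig s) (Orig a))"
    using supp_pre_kernel(2)[OF assms False, of One] \<gamma> by (auto simp: set_pmf_mixture)
  then show ?thesis using False supp_MI_subset[OF assms] by (auto simp del: MI_simps(4))
qed

lemma pmf_pre_kernel_common:
  assumes "\<not> revealing_state M s" "s' \<in> common_support M s a"
  shows "pmf (pre_kernel M i (Orig s) (Orig a)) (Orig s') = pmf (mkernel M i s a) s'"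
proof (cases "(s, a) \<in> ISA M")
  case True
  then show ?thesis by (rule pmf_pre_kernel_informative(1)[OF assms(1) _ assms(2)])
next
  case False
  have "pmf (map_pmf Orig (mkernel M i s a)) (Orig s') = pmf (mkernel M i s a) s'"
    by (rule pmf_map_inj') (simp add: inj_def)
  then show ?thesis using False assms by simp
qed

lemma pmf_MI_common:
  assumes "\<not> revealing_state M s" "s' \<in> common_support M s a"
  shows "pmf (kernel MI (Orig s) (Orig a)) (Orig s') =
    \<gamma> * pmf (mkernel M One s a) s' + (1 - \<gamma>) * pmf (mkernel M Two s a) s'"
  using \<gamma> by (simp add: pmf_mixture pmf_pre_kernel_common[OF assms] del: pre_kernel.simps)

sublocale MI: finite_mdp MI
proof
  fix x assume x: "x \<in> states MI"
  show "finite (actions MI x)" using x finM by auto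
  show "actions MI x \<noteq> {}" using x finM(3) by (auto split: if_splits)
  fix u assume u: "u \<in> actions MI x"
  show "set_pmf (kernel MI x u) \<subseteq> states MI"
  proof (cases x)
    case (Orig s)
    then have s: "s \<in> mstates M" using x by auto
    obtain a where a: "u = Orig a" "a \<in> mactions M s"
      using u Orig s pre_actions_Orig[OF s, of u] by auto
    show ?thesis
      using supp_MI_subset[OF s a(2)] supp_common[of s a One] finM(5)[OF s a(2), of One]
      unfolding Orig a(1) by (auto simp del: MI_simps(4) simp: subset_iff)
  next
    case (Bot i)
    then show ?thesis using supp_MI_Bot[of i u] by (cases i) auto
  qed
qed (use finM in auto)

text \<open>
  Maximality adds actions but removes none, so the informative pair survives in the enclosing MEC.
\<close>

lemma informative_component_in_T:
  assumes "end_component MI (X, U)" "informative_component M (X, U)"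
  shows "X \<subseteq> T"
proof -
  obtain X' U' where C': "is_MEC MI (X', U')" "X \<subseteq> X'" "\<And>s. s \<in> X \<Longrightarrow> U s \<subseteq> U' s"
    using MI.end_component_in_MEC[OF assms(1)] by blast
  moreover have "informative_component M (X', U')"
    using assms(2) C'(2,3) by (fastforce simp: informative_component_def)
  ultimately have "(X', U') \<in> informative_MECs M \<alpha> \<gamma>"
    by (simp add: informative_MECs_def)
  then show ?thesis using C'(2) by (auto simp: covered_def)
qed

lemma Bot_in_T: "Bot i \<in> T"
proof -
  let ?C = "({Bot i}, \<lambda>x. if x = Bot i then {Bot i} else {})"
  have "end_component MI ?C"
    using supp_MI_Bot[of i] by (cases i) (auto simp: end_component_def component_candidates_def)
  moreover have "informative_component M ?C"
    by (cases i) (auto simp: informative_component_def ISAp_def)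
  ultimately have "{Bot i} \<subseteq> T" by (rule informative_component_in_T)
  then show ?thesis by simp
qed

lemma T_states: "T \<subseteq> states MI"
  by (auto simp: covered_def informative_MECs_def is_MEC_def end_component_def
      component_candidates_def simp del: MI_simps)

section \<open>The overlap of the two models\<close>

text \<open>
  Together with the probabilities of the chosen actions, the product of the overlaps along a
  history bounds both history probabilities from below. A pair
  loses mass here exactly when the kernels differ, and all of it when the pair is revealing.
\<close>

definition overlap :: "'s \<Rightarrow> 'a \<Rightarrow> 's \<Rightarrow> real" where
  "overlap s a s' = min (pmf (mkernel M One s a) s') (pmf (mkernel M Two s a) s')"

lemma overlap_pos_iff: "0 < overlap s a s' \<longleftrightarrow> s' \<in> common_support M s a"
  by (auto simp: overlap_def common_support_def pmf_positive_iff)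

sublocale ov: substochastic "mstates M" "mactions M" overlap
proof
  fix s a
  assume "s \<in> mstates M" "a \<in> mactions M s"
  have "sum (overlap s a) (mstates M) \<le> sum (pmf (mkernel M One s a)) (mstates M)"
    by (intro sum_mono) (simp add: overlap_def)
  also have "\<dots> \<le> 1" using finM by (intro sum_pmf_le_1)
  finally show "sum (overlap s a) (mstates M) \<le> 1" .
qed (use finM in \<open>auto simp: overlap_def\<close>)

lemma sum_overlap_eq_1:
  assumes "s \<in> mstates M" "a \<in> mactions M s" "common_support M s a \<subseteq> X" "X \<subseteq> mstates M"
    and "mkernel M One s a = mkernel M Two s a"
  shows "sum (overlap s a) X = 1"
proof -
  have "sum (overlap s a) X = sum (pmf (mkernel M One s a)) X"
    using assms(5) by (simp add: overlap_def)
  also have "\<dots> = 1"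
    using assms finite_subset[OF assms(4) finM(1)] by (intro sum_pmf_eq_1) (auto simp: common_support_def)
  finally show ?thesis .
qed

text \<open>
  Otherwise some bottom class \<open>X\<close> of staying transitions misses \<open>T\<close>, and with it both absorbing
  states. Applying the core property to \<open>X\<close> yields a pair that stays in \<open>G\<close>, hence in \<open>X\<close>, and loses
  overlap. Its state is not revealing, since a revealing action leads to the absorbing states;
  so the pair is informative and \<open>X\<close>, with all staying actions, is an informative end component.
\<close>

lemma core_can_reach:
  assumes G: "G \<subseteq> mstates M"
    and core: "\<And>Z. Z \<subseteq> G \<Longrightarrow> Z \<noteq> {} \<Longrightarrow> \<exists>s\<in>Z. \<exists>a\<in>mactions M s.
       (\<forall>s'\<in>mstates M. 0 < overlap s a s' \<longrightarrow> s' \<in> G) \<and> sum (overlap s a) Z < 1"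
    and x: "x \<in> Orig ` G \<union> {Bot One, Bot Two}"
  shows "can_reach MI T (Orig ` G \<union> {Bot One, Bot Two}) x"
proof (rule ccontr)
  let ?G = "Orig ` G \<union> {Bot One, Bot Two}"
  let ?E = "staying_edges MI ?G"
  assume nx: "\<not> can_reach MI T ?G x"
  define Z where "Z = {y \<in> ?G. \<not> can_reach MI T ?G y}"
  have "Z \<subseteq> states MI" using G by (auto simp: Z_def)
  then have "finite Z" using MI.fin_states by (rule finite_subset)
  moreover have "Z \<noteq> {}" using nx x by (auto simp: Z_def)
  moreover have "y' \<in> Z" if "y \<in> Z" "(y, y') \<in> ?E" for y y'
    using that MI.can_reach_step[of y ?G _ y' T] by (auto simp: Z_def staying_edges_def simp del: MI_simps)
  ultimately have "\<exists>X\<subseteq>Z. X \<noteq> {} \<and> (\<forall>y\<in>X. \<forall>y'. (y, y') \<in> ?E \<longrightarrow> y' \<in> X) \<and>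
      (\<forall>y\<in>X. \<forall>y'\<in>X. (y, y') \<in> ?E\<^sup>*)"
    by (rule bottom_class_exists)
  then obtain X where X: "X \<subseteq> Z" "X \<noteq> {}" "\<And>y y'. y \<in> X \<Longrightarrow> (y, y') \<in> ?E \<Longrightarrow> y' \<in> X"
    "\<And>y y'. y \<in> X \<Longrightarrow> y' \<in> X \<Longrightarrow> (y, y') \<in> ?E\<^sup>*"
    by blast
  have "T \<inter> X = {}" using X(1) by (auto simp: Z_def can_reach_def)
  then have noBot: "Bot i \<notin> X" for i using Bot_in_T[of i] by auto
  have XG: "X \<subseteq> ?G" using X(1) by (auto simp: Z_def)
  define X' where "X' = {s. Orig s \<in> X}"
  have X'G: "X' \<subseteq> G" using XG by (auto simp: X'_def)
  have X_eq: "X = Orig ` X'"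
  proof -
    have "y \<in> Orig ` X'" if "y \<in> X" for y
      using that noBot by (cases y) (auto simp: X'_def)
    then show ?thesis by (auto simp: X'_def)
  qed
  then have "X' \<noteq> {}" using X(2) by auto
  then obtain s a where s: "s \<in> X'" and a: "a \<in> mactions M s"
    and stay: "\<forall>s'\<in>mstates M. 0 < overlap s a s' \<longrightarrow> s' \<in> G" and lossy: "sum (overlap s a) X' < 1"
    using core[OF X'G] by blast
  have sX: "Orig s \<in> X" "Orig s \<in> ?G" and sM: "s \<in> mstates M" using s G X'G by (auto simp: X'_def)
  have closed: "set_pmf (kernel MI y u) \<subseteq> X"
    if "y \<in> X" "u \<in> actions MI y" "set_pmf (kernel MI y u) \<subseteq> ?G" for y u
  proof
    fix y' assume "y' \<in> set_pmf (kernel MI y u)"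
    then have "(y, y') \<in> ?E" using that XG by (auto simp: staying_edges_def simp del: MI_simps)
    then show "y' \<in> X" using X(3) that(1) by blast
  qed
  have nrev: "\<not> revealing_state M s"
  proof
    assume rev: "revealing_state M s"
    then have "set_pmf (kernel MI (Orig s) (Orig (\<alpha> s))) = {Bot One, Bot Two}"
      by (rule supp_MI_revealing)
    then have "Bot One \<in> X" using closed[OF sX(1), of "Orig (\<alpha> s)"] rev by (auto simp del: MI_simps(4))
    then show False using noBot by simp
  qed
  have aMI: "Orig a \<in> actions MI (Orig s)" using nrev a by simp
  have commonG: "common_support M s a \<subseteq> G"
    using stay finM(5)[OF sM a, of One] supp_common[of s a One] unfolding overlap_pos_iff by blast
  have suppG: "set_pmf (kernel MI (Orig s) (Orig a)) \<subseteq> ?G"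
    using supp_MI_subset[OF sM a] commonG by (auto simp del: MI_simps(4))
  have suppX: "set_pmf (kernel MI (Orig s) (Orig a)) \<subseteq> X"
    by (rule closed[OF sX(1) aMI suppG])
  have "common_support M s a \<subseteq> X'"
    using suppX nrev Orig_in_supp_MI_iff[OF sM a] by (auto simp: X'_def simp del: MI_simps(4))
  then have "mkernel M One s a \<noteq> mkernel M Two s a"
    using sum_overlap_eq_1[OF sM a] lossy X'G G by fastforce
  then have isa: "(s, a) \<in> ISA M"
    using common_nonempty[OF nrev sM a] sM a by (auto simp: ISA_def)
  \<comment> \<open>all staying actions: closed on \<open>X\<close> because \<open>X\<close> is closed under staying transitions\<close>
  define U where "U y = (if y \<in> X then {u \<in> actions MI y. set_pmf (kernel MI y u) \<subseteq> ?G} else {})" for y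
  have edges: "(y, y') \<in> component_edges MI (X, U)" if "y \<in> X" "(y, y') \<in> ?E" for y y'
    using that by (auto simp: component_edges_def staying_edges_def U_def simp del: MI_simps)
  have path: "(y, y') \<in> (component_edges MI (X, U))\<^sup>* \<and> y' \<in> X" if "y \<in> X" "(y, y') \<in> ?E\<^sup>*" for y y'
    using that(2)
  proof (induction rule: rtrancl_induct)
    case (step u v)
    then show ?case using edges X(3) by (meson rtrancl.rtrancl_into_rtrancl)
  qed (use that in auto)
  have "end_component MI (X, U)"
    unfolding end_component_def prod.case
  proof (intro conjI ballI impI)
    show "(X, U) \<in> component_candidates MI"
      using \<open>Z \<subseteq> states MI\<close> X(1) by (auto simp: component_candidates_def U_def simp del: MI_simps)
    show "set_pmf (kernel MI y u) \<subseteq> X" if "y \<in> X" "u \<in> U y" for y u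
      using closed[of y u] that by (simp add: U_def del: MI_simps)
    show "(y, y') \<in> (component_edges MI (X, U))\<^sup>+" if "y \<in> X" "y' \<in> X" "y \<noteq> y'" for y y'
      using path[of y y'] X(4)[of y y'] that by (auto simp: rtrancl_eq_or_trancl)
  qed (rule X(2))
  moreover have "informative_component M (X, U)"
    unfolding informative_component_def ISAp_def prod.case
    using isa sX(1) aMI suppG by (intro bexI[of _ "(Orig s, Orig a)"]) (auto simp: U_def simp del: MI_simps)
  ultimately have "X \<subseteq> T" by (rule informative_component_in_T)
  then show False using \<open>T \<inter> X = {}\<close> X(2) by auto
qed

end

section \<open>Necessity: detection forces reachability\<close>

context biapd_input
begin

abbreviation "hists \<equiv> paths (mstates M) (mactions M) (minit M)"

lemma mhistories_subset: "mhistories M t \<subseteq> hists t"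
  using finite_mdp.histories_subset_paths[OF finite_mdp_of[OF M], of _ t] by (auto simp: mhistories_def)

lemma finite_hists: "finite (hists t)"
  using ov.finite_paths finM by blast

lemma finite_mhistories: "finite (mhistories M t)"
  using mhistories_subset finite_hists by (rule finite_subset)

lemma mprob_nonneg: "0 \<le> mprob M i \<pi> h"
  by (rule finite_mdp.hist_prob_nonneg[OF finite_mdp_of[OF M]])

lemma mprob_eq_0:
  assumes "is_mpolicy M \<pi>" "h \<in> hists t" "h \<notin> mhistories M t"
  shows "mprob M i \<pi> h = 0"
proof (rule finite_mdp.hist_prob_eq_0[OF finite_mdp_of[OF M]])
  show "\<not> is_history (mdp_of M i) h"
    using assms paths_steps[OF assms(2)] by (cases i) (auto simp: mhistories_def histories_def)
qed (rule is_policy_mdp_of[OF assms(1)])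

lemma sum_mhistories:
  assumes "is_mpolicy M \<pi>" "\<And>h. mprob M One \<pi> h = 0 \<Longrightarrow> mprob M Two \<pi> h = 0 \<Longrightarrow> f h = 0"
  shows "sum f (mhistories M t) = sum f (hists t)"
  using mprob_eq_0[OF assms(1)] assms(2) mhistories_subset finite_hists
  by (intro sum.mono_neutral_left) auto

text \<open>
  For the uniform prior the decision rule errs on each history with at least the smaller of
  the two probabilities; with both, in case of a tie.
\<close>

lemma sum_min_le_P_error:
  "(\<Sum>h\<in>mhistories M t. min (mprob M One \<pi> h) (mprob M Two \<pi> h)) \<le> 2 * P_error M \<pi> t (1/2) (1/2)"
proof -
  let ?p = "mprob M One \<pi>" and ?q = "mprob M Two \<pi>"
  let ?A = "{h \<in> mhistories M t. ?p h \<le> ?q h}" and ?B = "{h \<in> mhistories M t. ?p h \<ge> ?q h}"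
  have "(\<Sum>h\<in>mhistories M t. min (?p h) (?q h)) \<le> (\<Sum>h\<in>?A \<union> ?B. min (?p h) (?q h))"
    by (intro sum_mono2) (auto simp: finite_mhistories mprob_nonneg)
  also have "\<dots> \<le> (\<Sum>h\<in>?A. min (?p h) (?q h)) + (\<Sum>h\<in>?B. min (?p h) (?q h))"
    using finite_mhistories by (subst sum.union_inter[symmetric]) (auto intro!: sum_nonneg mprob_nonneg)
  also have "\<dots> \<le> (\<Sum>h\<in>?A. ?p h) + (\<Sum>h\<in>?B. ?q h)"
    by (intro add_mono sum_mono) auto
  also have "\<dots> = 2 * P_error M \<pi> t (1/2) (1/2)" by (simp add: P_error_def)
  finally show ?thesis .
qed

lemma weight_overlap_le:
  assumes "h \<in> hists t"
  shows "weight overlap \<pi> h \<le> mprob M i \<pi> h"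
  using assms
proof (induction t arbitrary: h)
  case (Suc t)
  then obtain h' a s where h: "h = Snoc h' a s" and h': "h' \<in> hists t" by auto
  have "overlap (last_state h') a s \<le> pmf (mkernel M i (last_state h') a) s"
    by (cases i) (auto simp: overlap_def)
  then show ?case
    unfolding h using Suc.IH[OF h'] mprob_nonneg
    by (auto simp: overlap_def intro!: mult_mono mult_nonneg_nonneg)
qed simp

text \<open>
  Where overlap survives, the sum of the minima of the two history probabilities stays positive,
  and with it the error for the uniform prior. Overlap follows only histories that are possible in
  both models, on which a policy is constrained by either of them.
\<close>

lemma APD_init_not_persistent:
  assumes \<pi>: "is_mpolicy M \<pi>" "achieves_APD M \<pi>" and B: "ov.persistent B"
  shows "minit M \<notin> B"
proof
  assume i: "minit M \<in> B"
  obtain \<epsilon> where \<epsilon>: "0 < \<epsilon>" and low: "\<And>\<pi> V t h. ov.proper \<pi> V \<Longrightarrow> V h \<Longrightarrow> last_state h \<in> B \<Longrightarrow>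
      \<epsilon> \<le> ov.surv \<pi> t h"
    using B unfolding ov.persistent_def by blast
  let ?V = "\<lambda>h. is_history (mdp_of M One) h \<and> is_history (mdp_of M Two) h"
  have V: "ov.proper \<pi> ?V"
    unfolding ov.proper_def overlap_pos_iff
    using is_policy_mdp_of[OF \<pi>(1), of One] finite_mdp.is_history_last_state[OF finite_mdp_of[OF M], of One]
    by (auto simp: is_policy_def common_support_def)
  have ge: "\<epsilon> \<le> 2 * P_error M \<pi> t (1/2) (1/2)" for t
  proof -
    have "\<epsilon> \<le> ov.surv \<pi> t (Start (minit M))" using low[OF V] i by simp
    also have "\<dots> = (\<Sum>h\<in>hists t. weight overlap \<pi> h)" using ov.sum_weight finM by simp
    also have "\<dots> \<le> (\<Sum>h\<in>hists t. min (mprob M One \<pi> h) (mprob M Two \<pi> h))"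
      by (intro sum_mono) (simp add: weight_overlap_le)
    also have "\<dots> = (\<Sum>h\<in>mhistories M t. min (mprob M One \<pi> h) (mprob M Two \<pi> h))"
      by (intro sum_mhistories[OF \<pi>(1), symmetric]) simp
    also have "\<dots> \<le> 2 * P_error M \<pi> t (1/2) (1/2)" by (rule sum_min_le_P_error)
    finally show ?thesis .
  qed
  have lim: "(\<lambda>t. 2 * P_error M \<pi> t (1/2) (1/2)) \<longlonglongrightarrow> 2 * 0"
    using \<pi>(2) by (intro tendsto_mult_left) (auto simp: achieves_APD_def)
  have "\<epsilon> \<le> 2 * 0" by (rule LIMSEQ_le_const[OF lim]) (use ge in blast)
  then show False using \<epsilon> by simp
qed

lemma APD_imp_init_Rmax:
  assumes "is_mpolicy M \<pi>" "achieves_APD M \<pi>"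
  shows "init MI \<in> Rmax MI T"
proof -
  obtain G where G: "G \<subseteq> mstates M" "ov.persistent (mstates M - G)"
    "\<And>Z. Z \<subseteq> G \<Longrightarrow> Z \<noteq> {} \<Longrightarrow> \<exists>s\<in>Z. \<exists>a\<in>mactions M s.
       (\<forall>s'\<in>mstates M. 0 < overlap s a s' \<longrightarrow> s' \<in> G) \<and> sum (overlap s a) Z < 1"
    using ov.extinction_core by blast
  have "minit M \<in> G" using APD_init_not_persistent[OF assms G(2)] finM by auto
  moreover have "Orig ` G \<union> {Bot One, Bot Two} \<subseteq> Rmax MI T"
    using G(1) core_can_reach[OF G(1,3)] by (intro MI.subset_Rmax) auto
  ultimately show ?thesis by auto
qed

section \<open>Affinity bounds the error probability\<close>

text \<open>
  Geometric means are multiplicative, so the products of affinities along a history, together with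
  the probabilities of the chosen actions, give exactly the geometric mean of its two probabilities,
  which bounds their minimum from above. The exponent is the weight of the mixture, so that on the
  common support the affinity is dominated by the kernel of the informative MDP.
\<close>

definition affinity :: "'s \<Rightarrow> 'a \<Rightarrow> 's \<Rightarrow> real" where
  "affinity s a s' = geo \<gamma> (pmf (mkernel M One s a) s') (pmf (mkernel M Two s a) s')"

lemma affinity_pos_iff: "0 < affinity s a s' \<longleftrightarrow> s' \<in> common_support M s a"
  by (auto simp: affinity_def geo_pos_iff common_support_def set_pmf_iff)

lemma affinity_nonneg: "0 \<le> affinity s a s'"
  by (simp add: affinity_def)

lemma sum_affinity_le_1: "finite Y \<Longrightarrow> sum (affinity s a) Y \<le> 1"
  unfolding affinity_def using \<gamma> by (intro sum_geo_pmf_le)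

sublocale af: substochastic "mstates M" "mactions M" affinity
  by unfold_locales (use finM affinity_nonneg sum_affinity_le_1 in auto)

lemma weight_affinity:
  assumes "h \<in> hists t"
  shows "weight affinity \<pi> h = geo \<gamma> (mprob M One \<pi> h) (mprob M Two \<pi> h)"
  using assms
proof (induction t arbitrary: h)
  case 0
  then show ?case by (simp add: geo_self)
next
  case (Suc t)
  then obtain h' a s where h: "h = Snoc h' a s" and h': "h' \<in> hists t" by auto
  show ?case
    unfolding h using Suc.IH[OF h']
    by (simp add: affinity_def geo_mult geo_self mprob_nonneg)
qed

text \<open>
  On the histories counted by the first sum \<open>q * P\<^sub>1\<close> is at most both \<open>P\<^sub>1\<close> and \<open>P\<^sub>2\<close>, hence at most
  their geometric mean; symmetrically for the second sum with \<open>1 - q\<close>.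
\<close>

lemma P_error_le:
  assumes \<pi>: "is_mpolicy M \<pi>" and q: "0 < q" "q < 1" and \<theta>: "0 < \<theta>" "\<theta> < 1"
  shows "P_error M \<pi> t q \<theta> \<le> (\<theta> / q + (1 - \<theta>) / (1 - q)) * af.surv \<pi> t (Start (minit M))"
proof -
  let ?p = "mprob M One \<pi>" and ?q = "mprob M Two \<pi>"
  let ?W = "\<Sum>h\<in>mhistories M t. geo \<gamma> (?p h) (?q h)"
  have W: "?W = af.surv \<pi> t (Start (minit M))"
  proof -
    have "?W = (\<Sum>h\<in>hists t. geo \<gamma> (?p h) (?q h))"
      by (rule sum_mhistories[OF \<pi>]) simp
    also have "\<dots> = af.surv \<pi> t (Start (minit M))"
      using af.sum_weight[of "minit M" \<pi> t] finM by (simp add: weight_affinity)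
    finally show ?thesis .
  qed
  have low: "min (?p h) (?q h) \<le> geo \<gamma> (?p h) (?q h)" for h
    using min_le_geo[OF \<gamma>] mprob_nonneg by auto
  have 1: "(\<Sum>h\<in>{h \<in> mhistories M t. q * ?p h \<le> (1 - q) * ?q h}. ?p h) \<le> 1 / q * ?W"
  proof -
    have "?p h \<le> 1 / q * geo \<gamma> (?p h) (?q h)" if "q * ?p h \<le> (1 - q) * ?q h" for h
    proof -
      have "q * ?p h \<le> ?p h" "(1 - q) * ?q h \<le> ?q h"
        using q mprob_nonneg[of _ \<pi> h] by (auto intro!: mult_left_le_one_le)
      then have "q * ?p h \<le> min (?p h) (?q h)" using that by simp
      then have "q * ?p h \<le> geo \<gamma> (?p h) (?q h)" using low[of h] by linarith
      then show ?thesis using q by (simp add: pos_le_divide_eq mult.commute)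
    qed
    then have "(\<Sum>h\<in>{h \<in> mhistories M t. q * ?p h \<le> (1 - q) * ?q h}. ?p h) \<le>
        (\<Sum>h\<in>{h \<in> mhistories M t. q * ?p h \<le> (1 - q) * ?q h}. 1 / q * geo \<gamma> (?p h) (?q h))"
      by (intro sum_mono) auto
    also have "\<dots> \<le> (\<Sum>h\<in>mhistories M t. 1 / q * geo \<gamma> (?p h) (?q h))"
      using finite_mhistories q by (intro sum_mono2) auto
    finally show ?thesis by (simp add: sum_distrib_left)
  qed
  have 2: "(\<Sum>h\<in>{h \<in> mhistories M t. q * ?p h \<ge> (1 - q) * ?q h}. ?q h) \<le> 1 / (1 - q) * ?W"
  proof -
    have "?q h \<le> 1 / (1 - q) * geo \<gamma> (?p h) (?q h)" if "q * ?p h \<ge> (1 - q) * ?q h" for h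
    proof -
      have "q * ?p h \<le> ?p h" "(1 - q) * ?q h \<le> ?q h"
        using q mprob_nonneg[of _ \<pi> h] by (auto intro!: mult_left_le_one_le)
      then have "(1 - q) * ?q h \<le> min (?p h) (?q h)" using that by simp
      then have "(1 - q) * ?q h \<le> geo \<gamma> (?p h) (?q h)" using low[of h] by linarith
      then show ?thesis using q by (simp add: pos_le_divide_eq mult.commute)
    qed
    then have "(\<Sum>h\<in>{h \<in> mhistories M t. q * ?p h \<ge> (1 - q) * ?q h}. ?q h) \<le>
        (\<Sum>h\<in>{h \<in> mhistories M t. q * ?p h \<ge> (1 - q) * ?q h}. 1 / (1 - q) * geo \<gamma> (?p h) (?q h))"
      by (intro sum_mono) auto
    also have "\<dots> \<le> (\<Sum>h\<in>mhistories M t. 1 / (1 - q) * geo \<gamma> (?p h) (?q h))"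
      using finite_mhistories q by (intro sum_mono2) auto
    finally show ?thesis by (simp add: sum_distrib_left)
  qed
  have "P_error M \<pi> t q \<theta> \<le> \<theta> * (1 / q * ?W) + (1 - \<theta>) * (1 / (1 - q) * ?W)"
    unfolding P_error_def using 1 2 \<theta> by (intro add_mono mult_left_mono) auto
  then show ?thesis unfolding W by (simp add: algebra_simps)
qed

lemma P_error_nonneg: "0 < \<theta> \<Longrightarrow> \<theta> < 1 \<Longrightarrow> 0 \<le> P_error M \<pi> t q \<theta>"
  unfolding P_error_def
  by (intro add_nonneg_nonneg mult_nonneg_nonneg sum_nonneg mprob_nonneg) auto

lemma achieves_APD_I:
  assumes \<pi>: "is_mpolicy M \<pi>" and lim: "(\<lambda>t. af.surv \<pi> t (Start (minit M))) \<longlonglongrightarrow> 0"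
  shows "achieves_APD M \<pi>"
  unfolding achieves_APD_def
proof (intro ballI)
  fix q \<theta> :: real assume q: "q \<in> {0<..<1}" and \<theta>: "\<theta> \<in> {0<..<1}"
  have "(\<lambda>t. (\<theta> / q + (1 - \<theta>) / (1 - q)) * af.surv \<pi> t (Start (minit M))) \<longlonglongrightarrow> (\<theta> / q + (1 - \<theta>) / (1 - q)) * 0"
    by (intro tendsto_mult_left lim)
  then have "(\<lambda>t. (\<theta> / q + (1 - \<theta>) / (1 - q)) * af.surv \<pi> t (Start (minit M))) \<longlonglongrightarrow> 0"
    by simp
  then show "(\<lambda>t. P_error M \<pi> t q \<theta>) \<longlonglongrightarrow> 0"
  proof (rule tendsto_sandwich[OF always_eventually always_eventually tendsto_const, rotated 2])
    show "\<forall>t. 0 \<le> P_error M \<pi> t q \<theta>"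
      using \<theta> by (simp add: P_error_nonneg)
    show "\<forall>t. P_error M \<pi> t q \<theta> \<le> (\<theta> / q + (1 - \<theta>) / (1 - q)) * af.surv \<pi> t (Start (minit M))"
      using P_error_le[OF \<pi>, of q \<theta>] q \<theta> by simp
  qed
qed

end

section \<open>Sufficiency: the returned policies detect\<close>

lemma entry_None_iff: "entry T h = None \<longleftrightarrow> visited h \<inter> T = {}"
  by (induction h) (auto split: option.splits)

lemma entry_in: "entry T h = Some x \<Longrightarrow> x \<in> T"
  by (induction h) (auto split: option.splits if_splits)

lemma follows_before_entry:
  assumes "follows Q \<Psi> \<rho>" "h \<in> mhistories Q t" "(None, p) \<in> \<Psi>"
    and "entry (covered {C. \<exists>p. (Some C, p) \<in> \<Psi>}) h = None"
  shows "\<rho> h = p (last_state h)"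
  using assms unfolding follows_def Let_def by simp

lemma follows_after_entry:
  assumes "follows Q \<Psi> \<rho>" "h \<in> mhistories Q t" "(Some (X, U), p) \<in> \<Psi>"
    and "entry (covered {C. \<exists>p. (Some C, p) \<in> \<Psi>}) h = Some x" "x \<in> X" "last_state h \<in> X"
  shows "\<rho> h = p (last_state h)"
  using assms unfolding follows_def Let_def by simp

abbreviation lift_hist :: "('s, 'a) hist \<Rightarrow> ('s ext, 'a ext) hist" where
  "lift_hist \<equiv> map_hist Orig Orig"

lemma last_state_lift [simp]: "last_state (lift_hist h) = Orig (last_state h)"
  by (cases h) auto

lemma steps_lift [simp]: "steps (lift_hist h) = steps h"
  by (induction h) auto

lemma inj_lift_hist: "inj lift_hist"
  by (rule hist.inj_map) (auto simp: inj_def)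

context biapd_input
begin

abbreviation "P \<equiv> preprocessed M \<alpha>"

lemma P_simps [simp]:
  "mstates P = Orig ` mstates M \<union> {Bot One, Bot Two}" "mactions P = pre_actions M \<alpha>"
  "mkernel P = pre_kernel M" "minit P = Orig (minit M)"
  by (simp_all add: preprocessed_def)

text \<open>
  A history that has not revealed the model and whose copy is a history of the preprocessed
  models. These are the histories on which a policy taken over from the preprocessed models is
  determined, and under such a policy they carry all of the affinity.
\<close>

definition alive :: "('s, 'a) hist \<Rightarrow> bool" where
  "alive h \<longleftrightarrow> no_identity_revealing M h \<and> (\<exists>i. is_history (mdp_of M i) h) \<and>
     (\<exists>i. is_history (mdp_of P i) (lift_hist h))"

lemma alive_last_state: "alive h \<Longrightarrow> last_state h \<in> mstates M"
  using finite_mdp.is_history_last_state[OF finite_mdp_of[OF M]] by (auto simp: alive_def)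

lemma alive_Start: "alive (Start (minit M))"
  by (simp add: alive_def)

text \<open>
  At a revealing state the only action of the preprocessed models has an empty common support, so
  a step into the common support starts from a state that is not revealing.
\<close>

lemma alive_Snoc:
  assumes h: "alive h" and a: "a \<in> mactions M (last_state h)" "Orig a \<in> pre_actions M \<alpha> (Orig (last_state h))"
    and s: "s \<in> common_support M (last_state h) a"
  shows "\<not> revealing_state M (last_state h)" "alive (Snoc h a s)"
proof -
  show nrev: "\<not> revealing_state M (last_state h)"
  proof
    assume rev: "revealing_state M (last_state h)"
    then have "a = \<alpha> (last_state h)" using a(2) by simp
    then show False using \<alpha> rev s by (auto simp: action_choice_def revealing_pair_def)
  qed
  have "Orig s \<in> set_pmf (pre_kernel M i (Orig (last_state h)) (Orig a))" for i
    using supp_pre_kernel(2)[OF alive_last_state[OF h] a(1) nrev] s by blast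
  moreover have "\<not> identity_revealing M (last_state h) a s"
    using s by (auto simp: identity_revealing_def common_support_def pmf_positive_iff)
  ultimately show "alive (Snoc h a s)"
    using h a s supp_common[of "last_state h" a] unfolding alive_def
    by (auto simp del: pre_kernel.simps pre_actions.simps)
qed

lemma is_history_preprocessed_MI:
  "is_history (mdp_of P i) h \<Longrightarrow> is_history MI h"
  using \<gamma> by (induction h) (cases i; auto simp: set_pmf_mixture)+

lemma alive_history_MI: "alive h \<Longrightarrow> is_history MI (lift_hist h)"
  using is_history_preprocessed_MI by (auto simp: alive_def)

abbreviation "\<C> \<equiv> informative_MECs M \<alpha> \<gamma>"

text \<open>
  An absorbing state reaches no other state, so a component containing an original state contains
  only original states.
\<close>

lemma MEC_Orig:
  assumes C: "(X, U) \<in> \<C>" and s0: "Orig s0 \<in> X"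
  shows "X \<subseteq> Orig ` mstates M"
proof -
  have ec: "end_component MI (X, U)" using C by (auto simp: informative_MECs_def is_MEC_def)
  have "Bot i \<notin> X" for i
  proof
    assume "Bot i \<in> X"
    then have "(Bot i, Orig s0) \<in> (component_edges MI (X, U))\<^sup>*"
      using s0 by (rule end_component_rtrancl[OF ec])
    then have "Orig s0 = Bot i"
    proof (induction rule: rtrancl_induct)
      case (step y z)
      then show ?case using supp_MI_Bot by (auto simp: component_edges_def simp del: MI_simps)
    qed simp
    then show False by simp
  qed
  moreover have "X \<subseteq> states MI" using ec by (auto simp: end_component_def component_candidates_def)
  ultimately show ?thesis by auto
qed

lemma MEC_actions:
  assumes C: "(X, U) \<in> \<C>" and s0: "Orig s \<in> X" and u: "u \<in> U (Orig s)"
  obtains a where "u = Orig a" "a \<in> mactions M s" "s \<in> mstates M"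
    "set_pmf (kernel MI (Orig s) (Orig a)) \<subseteq> X"
proof -
  have s: "s \<in> mstates M" using MEC_Orig[OF C s0] s0 by auto
  have ec: "end_component MI (X, U)" using C by (auto simp: informative_MECs_def is_MEC_def)
  then have "u \<in> pre_actions M \<alpha> (Orig s)" "set_pmf (kernel MI (Orig s) u) \<subseteq> X"
    using u s0 by (auto simp: end_component_def component_candidates_def simp del: MI_simps(4) pre_actions.simps)
  then show thesis using pre_actions_Orig[OF s] that s by metis
qed

text \<open>
  A state without actions is possible only in a component with one state, and then there is no
  informative pair.
\<close>

lemma MEC_actions_nonempty:
  assumes C: "(X, U) \<in> \<C>" and x: "x \<in> X"
  shows "U x \<noteq> {}"
proof -
  have ec: "end_component MI (X, U)" and inf: "informative_component M (X, U)"
    using C by (auto simp: informative_MECs_def is_MEC_def)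
  obtain s a where sa: "s \<in> X" "a \<in> U s" using inf by (auto simp: informative_component_def)
  show ?thesis
  proof (cases "x = s")
    case False
    then have "(x, s) \<in> (component_edges MI (X, U))\<^sup>+" using ec x sa(1) by (auto simp: end_component_def)
    then obtain y where "(x, y) \<in> component_edges MI (X, U)" by (meson tranclD)
    then show ?thesis by (auto simp: component_edges_def)
  qed (use sa in auto)
qed

lemma MEC_finite_actions:
  assumes C: "(X, U) \<in> \<C>" and x: "x \<in> X"
  shows "finite (U x)"
proof -
  have "X \<subseteq> states MI" "U x \<subseteq> actions MI x"
    using C x by (auto simp: informative_MECs_def is_MEC_def end_component_def component_candidates_def simp del: MI_simps)
  then show ?thesis using MI.fin_actions[of x] x finite_subset by blast
qed

end

text \<open>
  A result with flag \<open>1\<close> and an arbitrary policy \<open>\<pi>\<close> that makes use of it.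
\<close>

locale biapd_success = biapd_input M \<alpha> \<gamma>
  for M :: "('s, 'a) mmdp" and \<alpha> :: "'s \<Rightarrow> 'a" and \<gamma> :: real +
  fixes \<pi>0 :: "('s ext, 'a ext) mless" and \<rho> :: "('s ext, 'a ext) policy" and \<pi> :: "('s, 'a) policy"
  assumes \<pi>0: "reaching_policy MI T (Rmax MI T) \<pi>0"
    and \<rho>: "follows P (assemble \<pi>0 (informative_MECs M \<alpha> \<gamma>)) \<rho>"
    and \<pi>: "used_on M \<alpha> \<rho> \<pi>"
begin

lemma mpolicy_\<pi>: "is_mpolicy M \<pi>"
  using \<pi> by (simp add: used_on_def)

lemma covered_assemble: "covered {C. \<exists>p. (Some C, p) \<in> assemble \<pi>0 \<C>} = T"
  by (rule arg_cong[of _ _ covered]) (auto simp: assemble_def)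

lemma \<pi>_eq: "alive h \<Longrightarrow> map_pmf Orig (\<pi> h) = \<rho> (lift_hist h)"
  using \<pi> unfolding used_on_def by (auto simp: alive_def mhistories_iff)

lemma \<rho>_before_entry:
  assumes "h \<in> mhistories P t" "entry T h = None"
  shows "\<rho> h = \<pi>0 (last_state h)"
  using follows_before_entry[OF \<rho> assms(1), unfolded covered_assemble, of \<pi>0] assms(2)
  by (simp add: assemble_def)

lemma \<rho>_after_entry:
  assumes "h \<in> mhistories P t" "(X, U) \<in> \<C>" "entry T h = Some x" "x \<in> X" "last_state h \<in> X"
  shows "\<rho> h = pmf_of_set (U (last_state h))"
proof -
  have "(Some (X, U), MEC_policy (X, U)) \<in> assemble \<pi>0 \<C>" using assms(2) by (auto simp: assemble_def)
  then have "\<rho> h = MEC_policy (X, U) (last_state h)"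
    using follows_after_entry[OF \<rho> assms(1), unfolded covered_assemble] assms by simp
  then show ?thesis by (simp add: MEC_policy_def)
qed

lemma alive_lift: "alive h \<Longrightarrow> lift_hist h \<in> mhistories P (steps h)"
  by (auto simp: alive_def mhistories_iff)

lemma \<pi>_before_entry: "alive h \<Longrightarrow> entry T (lift_hist h) = None \<Longrightarrow> map_pmf Orig (\<pi> h) = \<pi>0 (Orig (last_state h))"
  using \<pi>_eq[of h] \<rho>_before_entry[OF alive_lift, of h] by simp

lemma \<pi>_after_entry:
  "alive h \<Longrightarrow> (X, U) \<in> \<C> \<Longrightarrow> entry T (lift_hist h) = Some x \<Longrightarrow> x \<in> X \<Longrightarrow> Orig (last_state h) \<in> X \<Longrightarrow>
    map_pmf Orig (\<pi> h) = pmf_of_set (U (Orig (last_state h)))"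
  using \<pi>_eq[of h] \<rho>_after_entry[OF alive_lift, of h X U x] by simp

lemma pmf_\<pi>: "pmf (map_pmf Orig (\<pi> h)) (Orig a) = pmf (\<pi> h) a"
  by (rule pmf_map_inj') (simp add: inj_def)

lemma \<pi>_pre_actions:
  assumes "alive h" "0 < pmf (\<pi> h) a"
  shows "Orig a \<in> pre_actions M \<alpha> (Orig (last_state h))"
proof -
  have "set_pmf (\<rho> (lift_hist h)) \<subseteq> pre_actions M \<alpha> (Orig (last_state h))"
    using \<rho> alive_lift[OF assms(1)] unfolding follows_def is_mpolicy_def by fastforce
  moreover have "Orig a \<in> set_pmf (\<rho> (lift_hist h))"
    using assms by (auto simp: set_pmf_iff simp flip: \<pi>_eq)
  ultimately show ?thesis by blast
qed

lemma alive_step: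
  assumes "alive h" "a \<in> mactions M (last_state h)" "0 < pmf (\<pi> h) a" "0 < affinity (last_state h) a s"
  shows "alive (Snoc h a s)" "\<not> revealing_state M (last_state h)"
    "Orig s \<in> set_pmf (kernel MI (Orig (last_state h)) (Orig a))"
  using alive_Snoc[OF assms(1,2) \<pi>_pre_actions[OF assms(1,3)], of s] assms
    Orig_in_supp_MI_iff[OF alive_last_state[OF assms(1)] assms(2)]
  by (auto simp: affinity_pos_iff simp del: MI_simps)

text \<open>
  Histories of positive affinity extend each other by steps into the common support that are taken
  with positive probability. They are all alive, so the policy is known at each of them.
\<close>

lemma positive_weight_induct [consumes 2, case_names Start Snoc]:
  assumes "h \<in> hists n" "weight affinity \<pi> h \<noteq> 0"
    and "Q (Start (minit M))"
    and step: "\<And>h n a s. h \<in> hists n \<Longrightarrow> weight affinity \<pi> h \<noteq> 0 \<Longrightarrow> alive h \<Longrightarrow> Q h \<Longrightarrow>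
      a \<in> mactions M (last_state h) \<Longrightarrow> s \<in> mstates M \<Longrightarrow>
      0 < pmf (\<pi> h) a \<Longrightarrow> 0 < affinity (last_state h) a s \<Longrightarrow> Q (Snoc h a s)"
  shows "alive h \<and> Q h"
  using assms(1,2)
proof (induction n arbitrary: h)
  case 0
  then show ?case using assms(3) alive_Start by simp
next
  case (Suc n)
  then obtain h' a s where h: "h = Snoc h' a s" and h': "h' \<in> hists n"
    and as: "a \<in> mactions M (last_state h')" "s \<in> mstates M" by auto
  have w: "weight affinity \<pi> h' \<noteq> 0" and pos: "0 < pmf (\<pi> h') a" "0 < affinity (last_state h') a s"
    using Suc.prems(2) affinity_nonneg[of "last_state h'" a s] pmf_nonneg[of "\<pi> h'" a]
    unfolding h by (auto simp: order_less_le)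
  have IH: "alive h'" "Q h'" using Suc.IH[OF h' w] by auto
  then show ?case
    unfolding h using alive_step(1)[OF IH(1) as(1) pos] step[OF h' w IH as pos] by simp
qed

definition \<rho>0 :: "('s ext, 'a ext) policy" where
  "\<rho>0 h = \<pi>0 (last_state h)"

lemma policy_\<rho>0: "is_policy MI \<rho>0"
  using \<pi>0 MI.is_history_last_state unfolding is_policy_def reaching_policy_def \<rho>0_def by blast

text \<open>
  Each step before entry is taken with the same probability as in the informative MDP, and its
  affinity is at most the mixed kernel by the inequality between geometric and arithmetic means.
\<close>

lemma weight_before_entry:
  assumes "h \<in> hists n" "weight affinity \<pi> h \<noteq> 0"
  shows "entry T (lift_hist h) = None \<longrightarrow> weight affinity \<pi> h \<le> hist_prob MI \<rho>0 (lift_hist h)"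
proof -
  have "alive h \<and> (entry T (lift_hist h) = None \<longrightarrow> weight affinity \<pi> h \<le> hist_prob MI \<rho>0 (lift_hist h))"
    using assms
  proof (induction rule: positive_weight_induct)
    case Start
    then show ?case by simp
  next
    case (Snoc h n a s)
    let ?s = "last_state h"
    have al: "alive h" and a: "a \<in> mactions M ?s" and pos: "0 < pmf (\<pi> h) a" "0 < affinity ?s a s"
      and hh: "h \<in> hists n" by fact+
    have nrev: "\<not> revealing_state M ?s" by (rule alive_step(2)[OF al a pos])
    have cs: "s \<in> common_support M ?s a" using pos(2) by (simp add: affinity_pos_iff)
    have "affinity ?s a s \<le> pmf (kernel MI (Orig ?s) (Orig a)) (Orig s)"
      unfolding pmf_MI_common[OF nrev cs] affinity_def using \<gamma> by (intro geo_le_mix) auto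
    moreover have "pmf (\<pi> h) a = pmf (\<rho>0 (lift_hist h)) (Orig a)" if "entry T (lift_hist h) = None"
      using \<pi>_before_entry[OF al that] by (simp add: \<rho>0_def flip: pmf_\<pi>)
    moreover have "0 \<le> weight affinity \<pi> h" using af.weight_nonneg[OF _ hh] finM by simp
    ultimately show ?case
      using Snoc.IH affinity_nonneg[of ?s a s] MI.hist_prob_nonneg[of \<rho>0 "lift_hist h"]
      by (auto split: option.splits if_splits intro!: mult_mono mult_nonneg_nonneg simp del: MI_simps)
  qed
  then show ?thesis by blast
qed

lemma sum_weight_before_entry:
  "(\<Sum>h\<in>{h \<in> hists n. entry T (lift_hist h) = None}. weight affinity \<pi> h) \<le>
    (\<Sum>h\<in>{h \<in> histories MI n. visited h \<inter> T = {}}. hist_prob MI \<rho>0 h)"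
proof -
  let ?H = "{h \<in> hists n. entry T (lift_hist h) = None \<and> weight affinity \<pi> h \<noteq> 0}"
  have "(\<Sum>h\<in>{h \<in> hists n. entry T (lift_hist h) = None}. weight affinity \<pi> h) = (\<Sum>h\<in>?H. weight affinity \<pi> h)"
    using finite_hists by (intro sum.mono_neutral_right) auto
  also have "\<dots> \<le> (\<Sum>h\<in>?H. hist_prob MI \<rho>0 (lift_hist h))"
    using weight_before_entry by (intro sum_mono) auto
  also have "\<dots> = (\<Sum>h\<in>lift_hist ` ?H. hist_prob MI \<rho>0 h)"
    using inj_lift_hist by (subst sum.reindex) (auto simp: inj_on_def inj_def)
  also have "\<dots> \<le> (\<Sum>h\<in>{h \<in> histories MI n. visited h \<inter> T = {}}. hist_prob MI \<rho>0 h)"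
  proof (rule sum_mono2)
    have "alive h" if "h \<in> ?H" for h
      using positive_weight_induct[of h n "\<lambda>_. True"] that by simp
    then show "lift_hist ` ?H \<subseteq> {h \<in> histories MI n. visited h \<inter> T = {}}"
      using alive_history_MI by (auto simp: histories_def entry_None_iff paths_steps)
  qed (use MI.finite_histories MI.hist_prob_nonneg in auto)
  finally show ?thesis .
qed

text \<open>
  After entry the policy is memoryless and stays in the component. Every nonempty proper subset of the
  component is left by strong connectedness, and the whole component loses affinity at its
  informative pair.
\<close>

lemma survival_in_MEC:
  assumes C: "(X, U) \<in> \<C>" and h: "alive h" "entry T (lift_hist h) = Some x" "x \<in> X" "Orig (last_state h) \<in> X"
  shows "(\<lambda>t. af.surv \<pi> t h) \<longlonglongrightarrow> 0"
proof -
  have ec: "end_component MI (X, U)" and inf: "informative_component M (X, U)"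
    using C by (auto simp: informative_MECs_def is_MEC_def)
  define Y0 where "Y0 = {s. Orig s \<in> X}"
  define \<nu> where "\<nu> s = map_pmf (inv Orig) (pmf_of_set (U (Orig s)))" for s
  let ?V = "\<lambda>h. alive h \<and> entry T (lift_hist h) = Some x \<and> Orig (last_state h) \<in> X"
  have XM: "X \<subseteq> Orig ` mstates M" using MEC_Orig[OF C h(4)] .
  have Y0M: "Y0 \<subseteq> mstates M" using XM by (auto simp: Y0_def)
  have \<nu>: "\<pi> h = \<nu> (last_state h)" if "?V h" for h
  proof -
    have "map_pmf Orig (\<pi> h) = pmf_of_set (U (Orig (last_state h)))"
      using \<pi>_after_entry[OF _ C _ h(3)] that by blast
    then have "map_pmf (inv Orig) (map_pmf Orig (\<pi> h)) = \<nu> (last_state h)" by (simp add: \<nu>_def)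
    moreover have "map_pmf (inv Orig) (map_pmf Orig (\<pi> h)) = \<pi> h"
      unfolding pmf.map_comp by (subst inv_o_cancel) (simp_all add: inj_def pmf.map_id)
    ultimately show ?thesis by simp
  qed
  have \<nu>_pos: "0 < pmf (\<nu> s) a" if "Orig s \<in> X" "Orig a \<in> U (Orig s)" for s a
  proof -
    have "Orig a \<in> set_pmf (pmf_of_set (U (Orig s)))"
      using that MEC_finite_actions[OF C that(1)] by (subst set_pmf_of_set) auto
    moreover have "inv Orig (Orig a) = a" by (rule inv_f_f) (simp add: inj_def)
    ultimately show ?thesis by (force simp: \<nu>_def pmf_positive_iff)
  qed
  have closed: "Orig s' \<in> X"
    if "Orig s \<in> X" "0 < pmf (\<nu> s) a" "Orig s' \<in> set_pmf (kernel MI (Orig s) (Orig a))" for s a s'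
  proof -
    have sX: "Orig s \<in> X" by fact
    have "a \<in> set_pmf (\<nu> s)" using that(2) by (simp add: pmf_positive_iff)
    then have "a \<in> inv Orig ` U (Orig s)"
      unfolding \<nu>_def using MEC_finite_actions[OF C that(1)] MEC_actions_nonempty[OF C that(1)]
      by (simp add: set_pmf_of_set)
    then obtain u where u: "u \<in> U (Orig s)" "a = inv Orig u" by auto
    obtain b where b: "u = Orig b" "set_pmf (kernel MI (Orig s) (Orig b)) \<subseteq> X"
      using MEC_actions[OF C sX u(1)] by metis
    have "a = b" using u(2) b(1) by (simp add: inv_f_f inj_def)
    then show ?thesis using b(2) that(3) by blast
  qed
  \<comment> \<open>a single action with a loss suffices, since the uniform policy takes it with positive
    probability\<close>
  have drop: "sum (af.policy_step \<nu> s) Y < 1"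
    if Y: "Y \<subseteq> Y0" and s: "Orig s \<in> X" and a: "a \<in> mactions M s" "Orig a \<in> U (Orig s)"
      and less: "sum (affinity s a) Y < 1" for Y s a
  proof -
    have sM: "s \<in> mstates M" using s Y0M by (auto simp: Y0_def)
    have finY: "finite Y" using Y Y0M finM(1) by (meson finite_subset)
    have "sum (af.policy_step \<nu> s) Y < (\<Sum>a\<in>mactions M s. pmf (\<nu> s) a)"
      unfolding af.sum_policy_step
    proof (rule sum_strict_mono_ex1)
      show "\<forall>b\<in>mactions M s. pmf (\<nu> s) b * sum (affinity s b) Y \<le> pmf (\<nu> s) b"
        using sum_affinity_le_1[OF finY] by (intro ballI mult_left_le) auto
      show "\<exists>b\<in>mactions M s. pmf (\<nu> s) b * sum (affinity s b) Y < pmf (\<nu> s) b"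
        using a(1) less \<nu>_pos[OF s a(2)] by (intro bexI[of _ a]) auto
    qed (rule finM(2)[OF sM])
    also have "\<dots> \<le> 1" by (intro sum_pmf_le_1 finM(2) sM)
    finally show ?thesis .
  qed
  show ?thesis
  proof (rule af.survival_memoryless_tendsto_0[where V = ?V and X = Y0 and \<nu> = \<nu>])
    fix h :: "('s, 'a) hist" and a s
    assume *: "?V h" "a \<in> mactions M (last_state h)" "0 < pmf (\<pi> h) a" "0 < affinity (last_state h) a s"
    have step: "alive (Snoc h a s)" "Orig s \<in> set_pmf (kernel MI (Orig (last_state h)) (Orig a))"
      using alive_step[of h a s] * by blast+
    then have "Orig s \<in> X" using closed[of "last_state h" a s] * \<nu>[of h] by auto
    then show "?V (Snoc h a s)" using * step by simp
  next
    fix Y assume Y: "Y \<subseteq> Y0" "Y \<noteq> {}"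
    show "\<exists>s\<in>Y. sum (af.policy_step \<nu> s) Y < 1"
    proof (cases "Y = Y0")
      case True
      obtain z u where zu: "(z, u) \<in> ISAp M" "z \<in> X" "u \<in> U z"
        using inf by (auto simp: informative_component_def)
      \<comment> \<open>not one of the absorbing pairs, which are the other informative pairs\<close>
      then obtain s a where sa: "z = Orig s" "u = Orig a" "(s, a) \<in> ISA M"
        using XM by (auto simp: ISAp_def)
      have a: "a \<in> mactions M s" "s \<in> mstates M" "mkernel M One s a \<noteq> mkernel M Two s a"
        using sa(3) by (auto simp: ISA_def)
      have "sum (affinity s a) Y \<le> sum (affinity s a) (mstates M)"
        using Y Y0M finM(1) by (intro sum_mono2) (auto simp: affinity_nonneg)
      also have "\<dots> < 1"
        unfolding affinity_def using a finM by (intro sum_geo_pmf_less \<gamma>) auto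
      finally show ?thesis
        using drop[OF Y(1), of s a] sa zu a True by (auto simp: Y0_def)
    next
      case False
      then obtain y z where yz: "y \<in> Y" "z \<in> Y0" "z \<notin> Y" using Y by auto
      have "(Orig y, Orig z) \<in> (component_edges MI (X, U))\<^sup>*"
        using yz Y by (intro end_component_rtrancl[OF ec]) (auto simp: Y0_def)
      then obtain p r where pr: "(p, r) \<in> component_edges MI (X, U)" "p \<in> Orig ` Y" "r \<notin> Orig ` Y"
        using rtrancl_exit[of "Orig y" "Orig z" "component_edges MI (X, U)" "Orig ` Y"] yz by auto
      obtain s where s: "p = Orig s" "s \<in> Y" using pr(2) by auto
      then have sX: "Orig s \<in> X" using Y by (auto simp: Y0_def)
      obtain u where u: "u \<in> U (Orig s)" "r \<in> set_pmf (kernel MI (Orig s) u)"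
        using pr(1) s by (auto simp: component_edges_def simp del: MI_simps)
      obtain a where a: "u = Orig a" "a \<in> mactions M s" "s \<in> mstates M"
        "set_pmf (kernel MI (Orig s) (Orig a)) \<subseteq> X"
        using MEC_actions[OF C sX u(1)] .
      have "r \<in> X" using u(2) a by auto
      then obtain s' where s': "r = Orig s'" using XM by auto
      have "s' \<in> common_support M s a"
        using Orig_in_supp_MI_iff[OF a(3,2), of s'] u(2) s' a(1) by simp
      then have pos: "0 < affinity s a s'" by (simp add: affinity_pos_iff)
      have finY: "finite Y" using Y Y0M finM(1) by (meson finite_subset)
      have "sum (affinity s a) Y < sum (affinity s a) (insert s' Y)"
        using pr(3) s' pos finY by (subst sum.insert) auto
      also have "\<dots> \<le> 1" using finY by (intro sum_affinity_le_1) auto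
      finally show ?thesis using drop[OF Y(1) sX a(2)] u(1) a(1) s(2) by auto
    qed
  qed (use Y0M h \<nu> in \<open>auto simp: Y0_def\<close>)
qed

lemma entered_in_MEC:
  assumes "h \<in> hists n" "weight affinity \<pi> h \<noteq> 0"
  shows "alive h \<and> (\<forall>x. entry T (lift_hist h) = Some x \<longrightarrow>
    (\<exists>(X, U)\<in>\<C>. x \<in> X \<and> Orig (last_state h) \<in> X))"
  using assms
proof (induction rule: positive_weight_induct)
  case Start
  then show ?case by (auto simp: covered_def)
next
  case (Snoc h n a s)
  have al: "alive h" and act: "a \<in> mactions M (last_state h)"
    and pos: "0 < pmf (\<pi> h) a" "0 < affinity (last_state h) a s" by fact+
  show ?case
  proof (intro allI impI)
    fix x assume x: "entry T (lift_hist (Snoc h a s)) = Some x"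
    show "\<exists>(X, U)\<in>\<C>. x \<in> X \<and> Orig (last_state (Snoc h a s)) \<in> X"
    proof (cases "entry T (lift_hist h)")
      case None
      then show ?thesis using x by (auto simp: covered_def split: if_splits)
    next
      case (Some y)
      then have y: "entry T (lift_hist h) = Some x" using x by simp
      then obtain X U where C: "(X, U) \<in> \<C>" "x \<in> X" "Orig (last_state h) \<in> X"
        using Snoc.IH by auto
      have "a \<in> set_pmf (\<pi> h)" using pos(1) by (simp add: pmf_positive_iff)
      then have "Orig a \<in> set_pmf (map_pmf Orig (\<pi> h))" by simp
      then have "Orig a \<in> U (Orig (last_state h))"
        unfolding \<pi>_after_entry[OF al C(1) y C(2,3)]
        using MEC_finite_actions[OF C(1,3)] MEC_actions_nonempty[OF C(1,3)] by (simp add: set_pmf_of_set)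
      then have "set_pmf (kernel MI (Orig (last_state h)) (Orig a)) \<subseteq> X"
        using MEC_actions[OF C(1,3)] by (metis ext.inject(1))
      then have "Orig s \<in> X" using alive_step(3)[OF al act pos] by blast
      then show ?thesis using C by auto
    qed
  qed
qed

text \<open>
  Split the affinity at a time \<open>n\<close> by which \<open>\<pi>\<^sup>0\<close> has entered \<open>T\<close> with probability almost \<open>1\<close>: the
  histories not yet in \<open>T\<close> contribute little, and the finitely many others die out one by one.
\<close>

lemma follower_achieves_APD: "achieves_APD M \<pi>"
proof (rule achieves_APD_I[OF mpolicy_\<pi>])
  let ?v = "\<lambda>t. af.surv \<pi> t (Start (minit M))"
  have v0: "0 \<le> ?v t" for t using finM by (intro af.surv_nonneg) simp
  show "?v \<longlonglongrightarrow> 0"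
  proof (rule LIMSEQ_I)
    fix \<epsilon> :: real assume \<epsilon>: "0 < \<epsilon>"
    have "reach_prob MI \<rho>0 T = 1" using \<pi>0 by (simp add: reaching_policy_def \<rho>0_def[abs_def])
    then obtain n where n: "(\<Sum>h\<in>{h \<in> histories MI n. visited h \<inter> T = {}}. hist_prob MI \<rho>0 h) < \<epsilon> / 2"
      using MI.avoid_small[OF policy_\<rho>0, of T "\<epsilon> / 2"] \<epsilon> by auto
    let ?N = "{h \<in> hists n. entry T (lift_hist h) = None}"
    let ?E = "{h \<in> hists n. entry T (lift_hist h) \<noteq> None}"
    have w0: "0 \<le> weight affinity \<pi> h" if "h \<in> hists n" for h
      using af.weight_nonneg[OF _ that] finM by simp
    have "(\<lambda>t. weight affinity \<pi> h * af.surv \<pi> t h) \<longlonglongrightarrow> 0" if h: "h \<in> ?E" for h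
    proof (cases "weight affinity \<pi> h = 0")
      case False
      obtain x where x: "entry T (lift_hist h) = Some x" using h by auto
      then obtain X U where "(X, U) \<in> \<C>" "x \<in> X" "Orig (last_state h) \<in> X" "alive h"
        using entered_in_MEC[OF _ False] h by blast
      then have "(\<lambda>t. af.surv \<pi> t h) \<longlonglongrightarrow> 0" using survival_in_MEC x by blast
      then show ?thesis by (rule tendsto_mult_right_zero)
    qed simp
    then have "(\<lambda>t. \<Sum>h\<in>?E. weight affinity \<pi> h * af.surv \<pi> t h) \<longlonglongrightarrow> 0"
      by (rule tendsto_null_sum)
    then have "\<forall>\<^sub>F t in sequentially. (\<Sum>h\<in>?E. weight affinity \<pi> h * af.surv \<pi> t h) < \<epsilon> / 2"
      using \<epsilon> by (intro order_tendstoD(2)) auto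
    then obtain k where k: "\<And>t. k \<le> t \<Longrightarrow> (\<Sum>h\<in>?E. weight affinity \<pi> h * af.surv \<pi> t h) < \<epsilon> / 2"
      unfolding eventually_sequentially by blast
    have "?v (n + t) < \<epsilon>" if t: "k \<le> t" for t
    proof -
      have "?v (n + t) = (\<Sum>h\<in>hists n. weight affinity \<pi> h * af.surv \<pi> t h)"
        using af.sum_weight[of "minit M" \<pi> "n + t"] af.sum_weight_add[of "minit M" \<pi> n t] finM by simp
      also have "hists n = ?N \<union> ?E" by auto
      also have "(\<Sum>h\<in>?N \<union> ?E. weight affinity \<pi> h * af.surv \<pi> t h) =
          (\<Sum>h\<in>?N. weight affinity \<pi> h * af.surv \<pi> t h) + (\<Sum>h\<in>?E. weight affinity \<pi> h * af.surv \<pi> t h)"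
        using finite_hists by (intro sum.union_disjoint) auto
      also have "(\<Sum>h\<in>?N. weight affinity \<pi> h * af.surv \<pi> t h) \<le> (\<Sum>h\<in>?N. weight affinity \<pi> h)"
        using w0 paths_last_state finM by (intro sum_mono mult_left_le af.surv_le_1) auto
      also have "\<dots> \<le> (\<Sum>h\<in>{h \<in> histories MI n. visited h \<inter> T = {}}. hist_prob MI \<rho>0 h)"
        by (rule sum_weight_before_entry)
      finally show ?thesis using n k[OF t] by simp
    qed
    then have "?v t < \<epsilon>" if "n + k \<le> t" for t
      using that by (metis add_leD1 le_add_diff_inverse nat_add_left_cancel_le)
    then show "\<exists>N. \<forall>t\<ge>N. norm (?v t - 0) < \<epsilon>" using v0 by auto
  qed
qed

end

section \<open>Existence of the returned policies\<close>

context biapd_input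
begin

lemma mhistories_last_state: "h \<in> mhistories P t \<Longrightarrow> last_state h \<in> states MI"
  using is_history_preprocessed_MI MI.is_history_last_state by (auto simp: mhistories_iff simp del: MI_simps)

text \<open>
  MECs are disjoint, so the entry state determines the component to follow. Any available action
  will do on histories that have left that component.
\<close>

lemma follows_exists:
  assumes \<pi>0: "reaching_policy MI T R \<pi>0"
  shows "\<exists>\<rho>. follows P (assemble \<pi>0 \<C>) \<rho>"
proof -
  define MEC_of where "MEC_of x = (SOME C. C \<in> \<C> \<and> x \<in> fst C)" for x
  have MEC_of: "MEC_of x = (X, U)" if "(X, U) \<in> \<C>" "x \<in> X" for x X U
  proof -
    have "MEC_of x \<in> \<C> \<and> x \<in> fst (MEC_of x)"
      unfolding MEC_of_def by (rule someI[of _ "(X, U)"]) (use that in auto)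
    then show ?thesis
      using is_MEC_unique[of MI X U "fst (MEC_of x)" "snd (MEC_of x)" x] that
      by (auto simp: informative_MECs_def)
  qed
  define \<rho> :: "('s ext, 'a ext) policy" where "\<rho> h = (case entry T h of None \<Rightarrow> \<pi>0 (last_state h)
    | Some x \<Rightarrow> if last_state h \<in> fst (MEC_of x) then pmf_of_set (snd (MEC_of x) (last_state h))
        else return_pmf (SOME a. a \<in> actions MI (last_state h)))" for h
  have covered: "covered {C. \<exists>p. (Some C, p) \<in> assemble \<pi>0 \<C>} = T"
    by (rule arg_cong[of _ _ covered]) (auto simp: assemble_def)
  have "set_pmf (\<rho> h) \<subseteq> mactions P (last_state h)" if h: "h \<in> mhistories P t" for t h
  proof (cases "entry T h")
    case None
    then show ?thesis
      using mhistories_last_state[OF h] \<pi>0 unfolding reaching_policy_def \<rho>_def by (auto simp del: MI_simps(1))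
  next
    case (Some x)
    have *: "(SOME a. a \<in> actions MI (last_state h)) \<in> actions MI (last_state h)"
      using MI.actions_nonempty[OF mhistories_last_state[OF h]] by (simp add: some_in_eq)
    have "x \<in> T" using Some by (rule entry_in)
    then obtain X U where C: "(X, U) \<in> \<C>" "x \<in> X" by (auto simp: covered_def)
    have "U y \<subseteq> actions MI y" if "y \<in> X" for y
      using C(1) that by (auto simp: informative_MECs_def is_MEC_def end_component_def component_candidates_def simp del: MI_simps)
    then show ?thesis
      using * Some MEC_finite_actions[OF C(1)] MEC_actions_nonempty[OF C(1)]
      by (auto simp: \<rho>_def MEC_of[OF C] set_pmf_of_set)
  qed
  then have "is_mpolicy P \<rho>" by (auto simp: is_mpolicy_def)
  moreover have "\<rho> h = p (last_state h)" if "(None, p) \<in> assemble \<pi>0 \<C>" "entry T h = None" for h p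
    using that by (auto simp: \<rho>_def assemble_def)
  moreover have "\<rho> h = p (last_state h)"
    if "(Some (X, U), p) \<in> assemble \<pi>0 \<C>" "entry T h = Some x" "x \<in> X" "last_state h \<in> X" for h X U p x
  proof -
    have "(X, U) \<in> \<C>" "p = MEC_policy (X, U)" using that(1) by (auto simp: assemble_def)
    then show ?thesis using MEC_of[of X U x] that by (simp add: \<rho>_def MEC_policy_def)
  qed
  ultimately have "follows P (assemble \<pi>0 \<C>) \<rho>"
    unfolding follows_def covered Let_def by blast
  then show ?thesis by blast
qed

text \<open>
  At the copy of an original state the preprocessed models offer only copies of original actions,
  so an action distribution can be pulled back.
\<close>

lemma used_on_exists:
  assumes \<rho>: "is_mpolicy P \<rho>"
  shows "\<exists>\<pi>. used_on M \<alpha> \<rho> \<pi>"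
proof -
  define \<pi> where "\<pi> h = (if lift_hist h \<in> mhistories P (steps h) then map_pmf (inv Orig) (\<rho> (lift_hist h))
     else return_pmf (SOME a. a \<in> mactions M (last_state h)))" for h
  have last: "last_state h \<in> mstates M" if "h \<in> mhistories M t" for h t
    using that finite_mdp.is_history_last_state[OF finite_mdp_of[OF M]] by (auto simp: mhistories_iff)
  have supp: "set_pmf (\<rho> (lift_hist h)) \<subseteq> Orig ` mactions M (last_state h)"
    if h: "h \<in> mhistories M t" "lift_hist h \<in> mhistories P (steps h)" for h t
  proof -
    have "set_pmf (\<rho> (lift_hist h)) \<subseteq> pre_actions M \<alpha> (Orig (last_state h))"
      using \<rho> h(2) by (fastforce simp: is_mpolicy_def)
    then show ?thesis using pre_actions_Orig[OF last[OF h(1)]] by blast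
  qed
  have inv: "inv Orig (Orig a) = a" for a :: 'a by (rule inv_f_f) (simp add: inj_def)
  have "set_pmf (\<pi> h) \<subseteq> mactions M (last_state h)" if h: "h \<in> mhistories M t" for h t
  proof (cases "lift_hist h \<in> mhistories P (steps h)")
    case True
    have "inv Orig ` set_pmf (\<rho> (lift_hist h)) \<subseteq> inv Orig ` Orig ` mactions M (last_state h)"
      by (rule image_mono[OF supp[OF h True]])
    then show ?thesis using True by (simp add: \<pi>_def image_image inv)
  next
    case False
    then show ?thesis using finM(3)[OF last[OF h]] by (simp add: \<pi>_def some_in_eq)
  qed
  moreover have "map_pmf Orig (\<pi> h) = \<rho> (lift_hist h)"
    if "h \<in> mhistories M t" "lift_hist h \<in> mhistories P t" for h t
  proof -
    have t: "steps h = t" using that(1) by (simp add: mhistories_iff)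
    have "map_pmf Orig (\<pi> h) = map_pmf (\<lambda>u. Orig (inv Orig u)) (\<rho> (lift_hist h))"
      using that t by (simp add: \<pi>_def pmf.map_comp o_def)
    also have "\<dots> = \<rho> (lift_hist h)"
      using supp[OF that(1)] that t by (intro map_pmf_idI) (auto simp: inv)
    finally show ?thesis .
  qed
  ultimately have "used_on M \<alpha> \<rho> \<pi>" by (auto simp: used_on_def is_mpolicy_def)
  then show ?thesis by blast
qed

end

section \<open>Termination and partial correctness of the procedure\<close>

text \<open>
  While \<open>R\<close> is pruned, the invariant records that every state removed so far misses the target with
  uniformly positive probability. In the search for a policy it records that an acceptable
  candidate is still left, which is why that phase cannot get stuck.
\<close>

fun invariant :: "('s, 'a) mmdp \<Rightarrow> ('s, 'a) config \<Rightarrow> bool" where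
  "invariant M Begin \<longleftrightarrow> True"
| "invariant M (FindMECs \<alpha> \<gamma> K F) \<longleftrightarrow> biapd_input M \<alpha> \<gamma> \<and>
     K \<subseteq> component_candidates (informative_mdp M \<alpha> \<gamma>) \<and> informative_MECs M \<alpha> \<gamma> - K \<subseteq> F \<and>
     F \<subseteq> informative_MECs M \<alpha> \<gamma>"
| "invariant M (FindR \<alpha> \<gamma> F R) \<longleftrightarrow> biapd_input M \<alpha> \<gamma> \<and> F = informative_MECs M \<alpha> \<gamma> \<and>
     covered F \<subseteq> R \<and> R \<subseteq> states (informative_mdp M \<alpha> \<gamma>) \<and>
     substochastic.persistent (states (informative_mdp M \<alpha> \<gamma>)) (actions (informative_mdp M \<alpha> \<gamma>))
       (finite_mdp.kill (informative_mdp M \<alpha> \<gamma>) (covered F)) (states (informative_mdp M \<alpha> \<gamma>) - R)"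
| "invariant M (FindPolicy \<alpha> \<gamma> F R K) \<longleftrightarrow> biapd_input M \<alpha> \<gamma> \<and> F = informative_MECs M \<alpha> \<gamma> \<and>
     R = Rmax (informative_mdp M \<alpha> \<gamma>) (covered F) \<and> init (informative_mdp M \<alpha> \<gamma>) \<in> R \<and>
     K \<subseteq> selector_candidates (informative_mdp M \<alpha> \<gamma>) (covered F) R \<and>
     (\<exists>f\<in>K. selector_ok (informative_mdp M \<alpha> \<gamma>) (covered F) f)"
| "invariant M (Return \<alpha> \<gamma> flag \<Psi>) \<longleftrightarrow> biapd_result M \<alpha> \<gamma> flag \<Psi>"

fun rank :: "('s, 'a) config \<Rightarrow> nat \<times> nat" where
  "rank Begin = (4, 0)"
| "rank (FindMECs \<alpha> \<gamma> K F) = (3, card K)"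
| "rank (FindR \<alpha> \<gamma> F R) = (2, card R)"
| "rank (FindPolicy \<alpha> \<gamma> F R K) = (1, card K)"
| "rank (Return \<alpha> \<gamma> flag \<Psi>) = (0, 0)"

context biapd_input
begin

lemma informative_MECs_candidates: "\<C> \<subseteq> component_candidates MI"
  by (auto simp: informative_MECs_def is_MEC_def end_component_def)

lemma finite_selector_candidates: "finite (selector_candidates MI T R)"
proof (rule finite_subset)
  show "selector_candidates MI T R \<subseteq> Pi\<^sub>E (states MI) (actions MI)"
    by (auto simp: selector_candidates_def)
  show "finite (Pi\<^sub>E (states MI) (actions MI))"
    by (intro finite_PiE MI.fin_states MI.fin_actions)
qed

lemma invariant_FindR_start: "invariant M (FindR \<alpha> \<gamma> \<C> (states MI))"
proof -
  have "MI.killed.persistent T (states MI - states MI)"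
    unfolding MI.killed.persistent_def by (auto intro: exI[of _ 1])
  then show ?thesis using T_states biapd_input_axioms by (simp del: MI_simps)
qed

lemma invariant_prune:
  assumes inv: "invariant M (FindR \<alpha> \<gamma> \<C> R)" and s: "s \<in> R" "\<not> can_reach MI T R s"
  shows "invariant M (FindR \<alpha> \<gamma> \<C> (R - {s}))"
proof -
  have "MI.killed.persistent T (states MI - {s \<in> R. can_reach MI T R s})"
    using inv by (intro MI.persistent_cannot_reach) (simp_all del: MI_simps)
  then have "MI.killed.persistent T (states MI - (R - {s}))"
    by (rule MI.killed.persistent_mono) (use s in auto)
  moreover have "s \<notin> T" using s(2) by (auto simp: can_reach_def)
  ultimately show ?thesis using inv by (auto simp del: MI_simps)
qed

lemma FindR_done_Rmax:
  assumes inv: "invariant M (FindR \<alpha> \<gamma> \<C> R)" and "\<forall>s\<in>R. can_reach MI T R s"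
  shows "Rmax MI T = R"
  using assms by (intro MI.Rmax_eqI) (simp_all del: MI_simps)

lemma invariant_FindPolicy_start:
  assumes inv: "invariant M (FindR \<alpha> \<gamma> \<C> R)" and reach: "\<forall>s\<in>R. can_reach MI T R s" and i: "init MI \<in> R"
  shows "invariant M (FindPolicy \<alpha> \<gamma> \<C> R (selector_candidates MI T R))"
proof -
  have "R \<subseteq> states MI" using inv by (simp del: MI_simps)
  then obtain f where f: "f \<in> selector_candidates MI T R" "selector_ok (MI\<lparr>init := init MI\<rparr>) T f"
    using MI.selector_exists[of R T] reach i by blast
  then have "\<exists>f\<in>selector_candidates MI T R. selector_ok MI T f" by (auto simp del: MI_simps)
  then show ?thesis
    using FindR_done_Rmax[OF inv reach] i biapd_input_axioms by (simp del: MI_simps)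
qed

lemma result_accept:
  assumes f: "f \<in> selector_candidates MI T (Rmax MI T)" "selector_ok MI T f" and i: "init MI \<in> Rmax MI T"
  shows "biapd_result M \<alpha> \<gamma> 1 (assemble (\<lambda>s. return_pmf (f s)) \<C>)"
proof -
  have fA: "f s \<in> actions MI s" if "s \<in> states MI" for s
    using f(1) that by (auto simp: selector_candidates_def simp del: MI_simps)
  have "reach_prob MI (\<lambda>h. return_pmf (f (last_state h))) T = 1"
    by (rule MI.selector_reach_prob[OF fA f(2)])
  moreover have "f s \<in> actions MI s \<and> set_pmf (kernel MI s (f s)) \<subseteq> Rmax MI T" if "s \<in> Rmax MI T - T" for s
    using f(1) that fA[of s] by (auto simp: selector_candidates_def Rmax_def simp del: MI_simps)
  ultimately have "reaching_policy MI T (Rmax MI T) (\<lambda>s. return_pmf (f s))"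
    using fA unfolding reaching_policy_def by (auto simp del: MI_simps)
  then show ?thesis
    using \<alpha> \<gamma> i by (auto simp: biapd_result_def Let_def simp del: MI_simps)
qed

end

lemma biapd_step_invariant:
  assumes M: "binary_mmdp M" and "biapd_step M c c'" "invariant M c"
  shows "invariant M c' \<and> (rank c', rank c) \<in> less_than <*lex*> less_than"
  using assms(2,3)
proof (induction rule: biapd_step.induct)
  case (construct \<alpha> \<gamma>)
  then interpret biapd_input M \<alpha> \<gamma> using M by unfold_locales
  show ?case using informative_MECs_candidates biapd_input_axioms by simp
next
  case (check_component C K \<alpha> \<gamma> F)
  then interpret biapd_input M \<alpha> \<gamma> by simp
  have "finite K" using check_component MI.finite_component_candidates finite_subset by auto
  then have "card (K - {C}) < card K" using check_component(1) by (intro psubset_card_mono) auto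
  then show ?case using check_component by (auto simp: informative_MECs_def)
next
  case (components_done \<alpha> \<gamma> F)
  then interpret biapd_input M \<alpha> \<gamma> by simp
  have "F = \<C>" using components_done by auto
  then show ?case using invariant_FindR_start by (simp del: invariant.simps)
next
  case (prune s R \<alpha> \<gamma> F)
  then interpret biapd_input M \<alpha> \<gamma> by simp
  have F: "F = \<C>" and R: "R \<subseteq> states MI" using prune.prems by (simp_all del: MI_simps)
  have "card (R - {s}) < card R"
    using prune.hyps(1) finite_subset[OF R MI.fin_states] by (intro psubset_card_mono) auto
  then show ?case using invariant_prune[of R s] prune unfolding F by (simp del: invariant.simps)
next
  case (negative R \<alpha> \<gamma> F)
  then interpret biapd_input M \<alpha> \<gamma> by simp
  have F: "F = \<C>" using negative.prems by simp
  show ?case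
    using FindR_done_Rmax[of R] negative \<alpha> \<gamma> unfolding F
    by (simp add: biapd_result_def Let_def del: MI_simps)
next
  case (positive R \<alpha> \<gamma> F)
  then interpret biapd_input M \<alpha> \<gamma> by simp
  have F: "F = \<C>" using positive.prems by simp
  show ?case using invariant_FindPolicy_start[of R] positive unfolding F by (simp del: invariant.simps MI_simps)
next
  case (reject f K \<alpha> \<gamma> F R)
  then interpret biapd_input M \<alpha> \<gamma> by simp
  have "K \<subseteq> selector_candidates MI T R" using reject by auto
  then have "finite K" using finite_selector_candidates finite_subset by blast
  then have "card (K - {f}) < card K" using reject.hyps(1) by (intro psubset_card_mono) auto
  then show ?case using reject by auto
next
  case (accept f K \<alpha> \<gamma> F R)
  then interpret biapd_input M \<alpha> \<gamma> by simp
  have F: "F = \<C>" using accept.prems by simp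
  have R: "R = Rmax MI T" using accept.prems by (simp add: F del: MI_simps)
  have "init MI \<in> Rmax MI T" "f \<in> selector_candidates MI T (Rmax MI T)"
    using accept.prems accept.hyps(1) unfolding F R by (auto simp del: MI_simps)
  then show ?case using result_accept[of f] accept.hyps(2) unfolding F by (simp del: MI_simps)
qed

lemma reachable_invariant:
  assumes "binary_mmdp M" "(biapd_step M)\<^sup>*\<^sup>* Begin c"
  shows "invariant M c"
  using assms(2) by (induction rule: rtranclp_induct) (use biapd_step_invariant[OF assms(1)] in auto)

lemma biapd_progress:
  assumes "invariant M c"
  shows "(\<exists>\<alpha> \<gamma> flag \<Psi>. c = Return \<alpha> \<gamma> flag \<Psi>) \<or> (\<exists>c'. biapd_step M c c')"
proof (cases c)
  case Begin
  have "action_choice M (\<lambda>s. SOME a. revealing_pair M s a)"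
    by (auto simp: action_choice_def revealing_state_def intro: someI)
  then show ?thesis unfolding Begin using biapd_step.construct[of M _ "1/2"] by fastforce
next
  case (FindMECs \<alpha> \<gamma> K F)
  then show ?thesis
    by (cases "K = {}") (blast intro: biapd_step.components_done biapd_step.check_component)+
next
  case (FindR \<alpha> \<gamma> F R)
  then show ?thesis by (blast intro: biapd_step.prune biapd_step.negative biapd_step.positive)
next
  case (FindPolicy \<alpha> \<gamma> F R K)
  then show ?thesis using assms by (auto intro: biapd_step.accept)
qed auto

lemma biapd_terminates: "binary_mmdp M \<Longrightarrow> biapd_terminates M"
  unfolding biapd_terminates_def
proof (intro conjI allI impI)
  assume M: "binary_mmdp M"
  show "\<not> (\<exists>c. c 0 = Begin \<and> (\<forall>n. biapd_step M (c n) (c (Suc n))))"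
  proof
    assume "\<exists>c. c 0 = Begin \<and> (\<forall>n. biapd_step M (c n) (c (Suc n)))"
    then obtain c where c: "c 0 = Begin" "\<And>n. biapd_step M (c n) (c (Suc n))" by blast
    have inv: "invariant M (c n)" for n
      by (induction n) (use c biapd_step_invariant[OF M c(2)] in auto)
    have "(c (Suc n), c n) \<in> inv_image (less_than <*lex*> less_than) rank" for n
      using biapd_step_invariant[OF M c(2) inv] by simp
    moreover have "wf (inv_image (less_than <*lex*> less_than) rank)" by (intro wf_inv_image wf_lex_prod) auto
    ultimately show False unfolding wf_iff_no_infinite_down_chain by blast
  qed
qed (use biapd_progress reachable_invariant in blast)

theorem theorem2:
  fixes M :: "('s, 'a) mmdp"
  assumes "binary_mmdp M"
  shows "biapd_terminates M
    \<and> (\<forall>\<alpha> \<gamma> flag \<Psi>. biapd_returns M \<alpha> \<gamma> flag \<Psi> \<longrightarrow> biapd_result M \<alpha> \<gamma> flag \<Psi>)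
    \<and> (\<forall>\<alpha> \<gamma> flag \<Psi>. biapd_result M \<alpha> \<gamma> flag \<Psi> \<longrightarrow>
         flag \<in> {0, 1} \<and> (flag = 1 \<longleftrightarrow> (\<exists>\<pi>. is_mpolicy M \<pi> \<and> achieves_APD M \<pi>)))
    \<and> (\<forall>\<alpha> \<gamma> \<Psi>. biapd_result M \<alpha> \<gamma> 1 \<Psi> \<longrightarrow>
         (\<exists>\<rho> \<pi>. follows (preprocessed M \<alpha>) \<Psi> \<rho> \<and> used_on M \<alpha> \<rho> \<pi>) \<and>
         (\<forall>\<rho> \<pi>. follows (preprocessed M \<alpha>) \<Psi> \<rho> \<and> used_on M \<alpha> \<rho> \<pi> \<longrightarrow>
            is_mpolicy M \<pi> \<and> achieves_APD M \<pi>))"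
proof -
  have input: "biapd_input M \<alpha> \<gamma>" if "biapd_result M \<alpha> \<gamma> flag \<Psi>" for \<alpha> \<gamma> flag \<Psi>
    using that assms by unfold_locales (auto simp: biapd_result_def)
  have sound: "is_mpolicy M \<pi> \<and> achieves_APD M \<pi>"
    if r: "biapd_result M \<alpha> \<gamma> 1 \<Psi>" and u: "follows (preprocessed M \<alpha>) \<Psi> \<rho>" "used_on M \<alpha> \<rho> \<pi>"
    for \<alpha> \<gamma> \<Psi> \<rho> \<pi>
  proof -
    interpret biapd_input M \<alpha> \<gamma> by (rule input[OF r])
    obtain \<pi>0 where "reaching_policy MI T (Rmax MI T) \<pi>0" "\<Psi> = assemble \<pi>0 \<C>"
      using r by (auto simp: biapd_result_def Let_def simp del: MI_simps split: if_splits)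
    then interpret biapd_success M \<alpha> \<gamma> \<pi>0 \<rho> \<pi> using u by unfold_locales auto
    show ?thesis using mpolicy_\<pi> follower_achieves_APD by blast
  qed
  have exist: "\<exists>\<rho> \<pi>. follows (preprocessed M \<alpha>) \<Psi> \<rho> \<and> used_on M \<alpha> \<rho> \<pi>"
    if r: "biapd_result M \<alpha> \<gamma> 1 \<Psi>" for \<alpha> \<gamma> \<Psi>
  proof -
    interpret biapd_input M \<alpha> \<gamma> by (rule input[OF r])
    obtain \<pi>0 where \<pi>0: "reaching_policy MI T (Rmax MI T) \<pi>0" "\<Psi> = assemble \<pi>0 \<C>"
      using r by (auto simp: biapd_result_def Let_def simp del: MI_simps split: if_splits)
    obtain \<rho> where \<rho>: "follows P \<Psi> \<rho>" using follows_exists[OF \<pi>0(1)] \<pi>0(2) by blast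
    then have "is_mpolicy P \<rho>" by (simp add: follows_def)
    then show ?thesis using \<rho> used_on_exists by blast
  qed
  have flag: "flag \<in> {0, 1} \<and> (flag = 1 \<longleftrightarrow> (\<exists>\<pi>. is_mpolicy M \<pi> \<and> achieves_APD M \<pi>))"
    if r: "biapd_result M \<alpha> \<gamma> flag \<Psi>" for \<alpha> \<gamma> flag \<Psi>
  proof -
    interpret biapd_input M \<alpha> \<gamma> by (rule input[OF r])
    have fl: "flag = (if init MI \<in> Rmax MI T then 1 else 0)"
      using r by (auto simp: biapd_result_def Let_def simp del: MI_simps split: if_splits)
    show ?thesis
    proof (intro conjI iffI)
      show "flag \<in> {0, 1}" unfolding fl by simp
      show "\<exists>\<pi>. is_mpolicy M \<pi> \<and> achieves_APD M \<pi>" if "flag = 1"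
        using exist sound r unfolding that by blast
      show "flag = 1" if "\<exists>\<pi>. is_mpolicy M \<pi> \<and> achieves_APD M \<pi>"
        using that APD_imp_init_Rmax unfolding fl by auto
    qed
  qed
  show ?thesis
  proof (intro conjI allI impI)
    show "biapd_terminates M" by (rule biapd_terminates[OF assms])
    show "biapd_result M \<alpha> \<gamma> flag \<Psi>" if "biapd_returns M \<alpha> \<gamma> flag \<Psi>" for \<alpha> \<gamma> flag \<Psi>
      using reachable_invariant[OF assms, of "Return \<alpha> \<gamma> flag \<Psi>"] that by (simp add: biapd_returns_def)
    show "flag \<in> {0, 1}" if "biapd_result M \<alpha> \<gamma> flag \<Psi>" for \<alpha> \<gamma> flag \<Psi>
      using flag[OF that] by (rule conjunct1)
    show "flag = 1 \<longleftrightarrow> (\<exists>\<pi>. is_mpolicy M \<pi> \<and> achieves_APD M \<pi>)"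
      if "biapd_result M \<alpha> \<gamma> flag \<Psi>" for \<alpha> \<gamma> flag \<Psi>
      using flag[OF that] by (rule conjunct2)
    show "\<exists>\<rho> \<pi>. follows (preprocessed M \<alpha>) \<Psi> \<rho> \<and> used_on M \<alpha> \<rho> \<pi>"
      if "biapd_result M \<alpha> \<gamma> 1 \<Psi>" for \<alpha> \<gamma> \<Psi>
      by (rule exist[OF that])
    fix \<alpha> \<gamma> \<Psi> \<rho> \<pi>
    assume "biapd_result M \<alpha> \<gamma> 1 \<Psi>" "follows (preprocessed M \<alpha>) \<Psi> \<rho> \<and> used_on M \<alpha> \<rho> \<pi>"
    then have "is_mpolicy M \<pi> \<and> achieves_APD M \<pi>" using sound by blast
    then show "is_mpolicy M \<pi>" "achieves_APD M \<pi>" by simp_all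
  qed
qed

end
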